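(* Let $A$ be a maximal indecomposable cyclotomic $\mathbb{Z}[\omega]$-matrix, where $\omega=1/2+\sqrt{-3}/2$, that has at least one nonzero entry on the diagonal. Then $A$ is equivalent to an adjacency matrix of one of the graphs $S_1$, $S_2^\dagger$, $C_{2k}^{++}$ ($k\geqslant2$), $C_{2k}^{+-}$ ($k\geqslant2$), $S_5$, $S_6$, $S_6^\dagger$, $S_7$, $S_8$, $S_8'$.
   Context: **Matrices.** Let $R=\mathbb{Z}[\omega]$, $\omega=1/2+\sqrt{-3}/2$. A cyclotomic matrix over $R$ is a (finite, square) Hermitian matrix with entries in $R$ all of whose eigenvalues lie in $[-2,2]$. A Hermitian $R$-matrix is the adjacency matrix $(w(u,v))_{u,v}$ of a weighted directed graph ($R$-graph) with weight function $w$ satisfying $w(v,u)=\overline{w(u,v)}$; $w(v,v)$ is the charge of $v$. A matrix is indecomposable if its underlying graph (distinct $u,v$ adjacent iff $w(u,v)\neq 0$) is connected. An indecomposable cyclotomic $R$-matrix is maximal if it is not a (proper) principal submatrix of any other indecomposable cyclotomic $R$-matrix. Two $n\times n$ matrices $A,B$ over $R$ are equivalent if $A=\pm\sigma(QBQ^* )$ for some unitary matrix $Q$ with entries in $R$ ($QQ^*=Q^*Q=I$), some choice of sign, and $\sigma$ either the identity or complex conjugation applied entrywise. **Graphs.** Weights not determined by the listed ones via $w(v,u)=\overline{w(u,v)}$ are $0$; in particular vertices are uncharged unless a charge is listed. "Ladder on $t_1,b_1,\dots,t_k,b_k$" means: for $1\le j\le k-1$, $w(t_j,t_{j+1})=w(t_j,b_{j+1})=1$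 and $w(b_j,t_{j+1})=w(b_j,b_{j+1})=-1$. $S_1$: a single vertex of charge $2$. $S_2^\dagger$: vertices $a,b$ of charges $-1,1$; $w(b,a)=1+\omega$. $C_{2k}^{++}$ ($k\ge2$): ladder on $t_1,b_1,\dots,t_k,b_k$, with $t_1,b_1,t_k,b_k$ of charge $1$, $w(t_1,b_1)=1$, $w(t_k,b_k)=-1$. $C_{2k}^{+-}$ ($k\ge2$): ladder on $t_1,b_1,\dots,t_k,b_k$, with $t_1,b_1$ of charge $1$, $t_k,b_k$ of charge $-1$, $w(t_1,b_1)=1$, $w(t_k,b_k)=1$. $S_5$: vertices $a,b,c,d,e$; $c,d$ have charge $1$, $a,b,e$ charge $0$; weight $1$: $ce, de, ad, bc, ab$; $w(a,c)=w(b,d)=w(e,b)=w(e,a)=-\omega$. $S_6$: vertices $a,\dots,f$; $b,d,f$ have charge $1$, $a,c,e$ charge $-1$; weight $1$: $bc, cf, cd, af, be$; $w(b,a)=w(a,d)=w(f,e)=w(e,d)=-\omega$. $S_6^\dagger$: vertices $a,\dots,f$; $d$ has charge $1$, $c$ charge $-1$, $a,b,e,f$ charge $0$; weight $1$: $bc, cf, cd, bf, af, be$; weight $-1$: $ae$; $w(b,a)=w(a,d)=w(f,e)=w(e,d)=-\omega$. $S_7$: vertices $a,\dots,g$; $a,e,f$ have charge $1$, $d$ has charge $-1$, $b,c,g$ charge $0$; weight $1$: $ab, ad, cf, bg, de, df, cg, eg, bc$; weight $-1$: $ac, fg, be$. $S_8$: vertices $a,\dots,h$; $b,c,e,h$ have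 charge $1$, $a,d,f,g$ charge $-1$; weight $1$: $ab, ae, cg, cd, bd, ef, eg, fh, dh$; weight $-1$: $ac, bf, gh$. $S_8'$: vertices $a,\dots,h$; $b,g$ have charge $1$, $a,h$ charge $-1$, $c,d,e,f$ charge $0$; weight $1$: $ab, ac, ae, cg, bd, ef, gh, fh, dh, df, ce$; weight $-1$: $cd, bf, eg$. *)

theory Defs
  imports
    Complex_Main
    "Jordan_Normal_Form.Char_Poly"
    "Jordan_Normal_Form.Schur_Decomposition"
    "Jordan_Normal_Form.DL_Submatrix"
begin

section \<open>Cyclotomic matrices over the Eisenstein integers\<close>

text \<open>\<open>omega = 1/2 + sqrt(-3)/2\<close> is a primitive sixth (not third) root of unity.\<close>

definition omega :: complex where
  "omega = Complex (1/2) (sqrt 3 / 2)"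

definition eisenstein_ints :: "complex set" where
  "eisenstein_ints = {of_int m + of_int n * omega | m n :: int. True}"

definition eisenstein_mat :: "nat \<Rightarrow> complex mat \<Rightarrow> bool" where
  "eisenstein_mat n A \<longleftrightarrow> A \<in> carrier_mat n n \<and> elements_mat A \<subseteq> eisenstein_ints"

definition hermitian_mat :: "complex mat \<Rightarrow> bool" where
  "hermitian_mat A \<longleftrightarrow> mat_adjoint A = A"

definition cyclotomic_mat :: "complex mat \<Rightarrow> bool" where
  "cyclotomic_mat A \<longleftrightarrow>
     eisenstein_mat (dim_row A) A \<and> hermitian_mat A \<and>
     (\<forall>x. eigenvalue A x \<longrightarrow> x \<in> complex_of_real ` {-2..2})"

text \<open>The edge relation of the underlying graph (loops disregarded). For Hermitian \<open>A\<close> it is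
  symmetric, so connectedness is reachability along it. The empty graph does not count as
  connected.\<close>

definition underlying_edges :: "complex mat \<Rightarrow> (nat \<times> nat) set" where
  "underlying_edges A =
     {(u, v). u < dim_row A \<and> v < dim_row A \<and> u \<noteq> v \<and> A $$ (u, v) \<noteq> 0}"

definition indecomposable_mat :: "complex mat \<Rightarrow> bool" where
  "indecomposable_mat A \<longleftrightarrow>
     dim_row A > 0 \<and>
     (\<forall>u < dim_row A. \<forall>v < dim_row A. (u, v) \<in> (underlying_edges A)\<^sup>*)"

definition proper_principal_submatrix :: "complex mat \<Rightarrow> complex mat \<Rightarrow> bool" where
  "proper_principal_submatrix A B \<longleftrightarrow> (\<exists>I. I \<subset> {0..<dim_row B} \<and> A = submatrix B I I)"

definition maximal_indecomposable_cyclotomic_mat :: "complex mat \<Rightarrow> bool" where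
  "maximal_indecomposable_cyclotomic_mat A \<longleftrightarrow>
     cyclotomic_mat A \<and> indecomposable_mat A \<and>
     \<not> (\<exists>B. cyclotomic_mat B \<and> indecomposable_mat B \<and> proper_principal_submatrix A B)"

definition unitary_eisenstein_mat :: "nat \<Rightarrow> complex mat \<Rightarrow> bool" where
  "unitary_eisenstein_mat n Q \<longleftrightarrow>
     eisenstein_mat n Q \<and> Q * mat_adjoint Q = 1\<^sub>m n \<and> mat_adjoint Q * Q = 1\<^sub>m n"

definition equivalent_mat :: "complex mat \<Rightarrow> complex mat \<Rightarrow> bool" where
  "equivalent_mat A B \<longleftrightarrow>
     (\<exists>n. eisenstein_mat n A \<and> eisenstein_mat n B \<and>
       (\<exists>Q s \<sigma>. unitary_eisenstein_mat n Q \<and> s \<in> {1, -1} \<and> \<sigma> \<in> {id, cnj} \<and>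
         A = s \<cdot>\<^sub>m map_mat \<sigma> (Q * B * mat_adjoint Q)))"

section \<open>Weighted graphs and their adjacency matrices\<close>

text \<open>A graph is a finite vertex set with a weight function; the weight \<open>w v v\<close> is the charge
  of \<open>v\<close>.\<close>

type_synonym 'v rgraph = "'v set \<times> ('v \<Rightarrow> 'v \<Rightarrow> complex)"

text \<open>An adjacency matrix depends on an enumeration of the vertices.\<close>

definition adjacency_mat_of :: "'v rgraph \<Rightarrow> complex mat \<Rightarrow> bool" where
  "adjacency_mat_of G B \<longleftrightarrow>
     (\<exists>vs. distinct vs \<and> set vs = fst G \<and>
       B = mat (length vs) (length vs) (\<lambda>(i, j). snd G (vs ! i) (vs ! j)))"

definition equivalent_to_graph :: "complex mat \<Rightarrow> 'v rgraph \<Rightarrow> bool" where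
  "equivalent_to_graph A G \<longleftrightarrow> (\<exists>B. adjacency_mat_of G B \<and> equivalent_mat A B)"

text \<open>Each edge is listed in one direction only; the weight of the reverse pair is the complex
  conjugate, and unlisted pairs have weight 0.\<close>

definition weight_fun :: "(('v \<times> 'v) \<times> complex) list \<Rightarrow> 'v \<Rightarrow> 'v \<Rightarrow> complex" where
  "weight_fun ws u v =
     (case map_of ws (u, v) of
        Some x \<Rightarrow> x
      | None \<Rightarrow> (case map_of ws (v, u) of Some x \<Rightarrow> cnj x | None \<Rightarrow> 0))"

definition edges :: "complex \<Rightarrow> ('v \<times> 'v) list \<Rightarrow> (('v \<times> 'v) \<times> complex) list" where
  "edges x es = map (\<lambda>e. (e, x)) es"

definition charges :: "complex \<Rightarrow> 'v list \<Rightarrow> (('v \<times> 'v) \<times> complex) list" where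
  "charges x vs = map (\<lambda>v. ((v, v), x)) vs"

section \<open>The sporadic charged graphs\<close>

datatype letter = VA | VB | VC | VD | VE | VF | VG | VH

definition graph_S1 :: "letter rgraph" where
  "graph_S1 = ({VA}, weight_fun (charges 2 [VA]))"

definition graph_S2_dagger :: "letter rgraph" where
  "graph_S2_dagger = ({VA, VB}, weight_fun (
     charges (-1) [VA] @ charges 1 [VB] @
     edges (1 + omega) [(VB, VA)]))"

definition graph_S5 :: "letter rgraph" where
  "graph_S5 = ({VA, VB, VC, VD, VE}, weight_fun (
     charges 1 [VC, VD] @
     edges 1 [(VC, VE), (VD, VE), (VA, VD), (VB, VC), (VA, VB)] @
     edges (- omega) [(VA, VC), (VB, VD), (VE, VB), (VE, VA)]))"

definition graph_S6 :: "letter rgraph" where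
  "graph_S6 = ({VA, VB, VC, VD, VE, VF}, weight_fun (
     charges 1 [VB, VD, VF] @ charges (-1) [VA, VC, VE] @
     edges 1 [(VB, VC), (VC, VF), (VC, VD), (VA, VF), (VB, VE)] @
     edges (- omega) [(VB, VA), (VA, VD), (VF, VE), (VE, VD)]))"

definition graph_S6_dagger :: "letter rgraph" where
  "graph_S6_dagger = ({VA, VB, VC, VD, VE, VF}, weight_fun (
     charges 1 [VD] @ charges (-1) [VC] @
     edges 1 [(VB, VC), (VC, VF), (VC, VD), (VB, VF), (VA, VF), (VB, VE)] @
     edges (-1) [(VA, VE)] @
     edges (- omega) [(VB, VA), (VA, VD), (VF, VE), (VE, VD)]))"

definition graph_S7 :: "letter rgraph" where
  "graph_S7 = ({VA, VB, VC, VD, VE, VF, VG}, weight_fun (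
     charges 1 [VA, VE, VF] @ charges (-1) [VD] @
     edges 1 [(VA, VB), (VA, VD), (VC, VF), (VB, VG), (VD, VE), (VD, VF), (VC, VG),
              (VE, VG), (VB, VC)] @
     edges (-1) [(VA, VC), (VF, VG), (VB, VE)]))"

definition graph_S8 :: "letter rgraph" where
  "graph_S8 = ({VA, VB, VC, VD, VE, VF, VG, VH}, weight_fun (
     charges 1 [VB, VC, VE, VH] @ charges (-1) [VA, VD, VF, VG] @
     edges 1 [(VA, VB), (VA, VE), (VC, VG), (VC, VD), (VB, VD), (VE, VF), (VE, VG),
              (VF, VH), (VD, VH)] @
     edges (-1) [(VA, VC), (VB, VF), (VG, VH)]))"

definition graph_S8_prime :: "letter rgraph" where
  "graph_S8_prime = ({VA, VB, VC, VD, VE, VF, VG, VH}, weight_fun (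
     charges 1 [VB, VG] @ charges (-1) [VA, VH] @
     edges 1 [(VA, VB), (VA, VC), (VA, VE), (VC, VG), (VB, VD), (VE, VF), (VG, VH),
              (VF, VH), (VD, VH), (VD, VF), (VC, VE)] @
     edges (-1) [(VC, VD), (VB, VF), (VE, VG)]))"

section \<open>The two infinite families\<close>

text \<open>\<open>Top j\<close> and \<open>Bot j\<close>, for \<open>1 \<le> j \<le> k\<close>, are the vertices \<open>t_j\<close> and \<open>b_j\<close>.\<close>

datatype ladder_vertex = Top nat | Bot nat

definition ladder_vertices :: "nat \<Rightarrow> ladder_vertex set" where
  "ladder_vertices k = Top ` {1..k} \<union> Bot ` {1..k}"

definition ladder_edges :: "nat \<Rightarrow> ((ladder_vertex \<times> ladder_vertex) \<times> complex) list" where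
  "ladder_edges k = concat (map (\<lambda>j.
     edges 1 [(Top j, Top (j + 1)), (Top j, Bot (j + 1))] @
     edges (-1) [(Bot j, Top (j + 1)), (Bot j, Bot (j + 1))]) [1..<k])"

definition graph_Cpp :: "nat \<Rightarrow> ladder_vertex rgraph" where
  "graph_Cpp k = (ladder_vertices k, weight_fun (
     ladder_edges k @
     charges 1 [Top 1, Bot 1, Top k, Bot k] @
     edges 1 [(Top 1, Bot 1)] @ edges (-1) [(Top k, Bot k)]))"

definition graph_Cpm :: "nat \<Rightarrow> ladder_vertex rgraph" where
  "graph_Cpm k = (ladder_vertices k, weight_fun (
     ladder_edges k @
     charges 1 [Top 1, Bot 1] @ charges (-1) [Top k, Bot k] @
     edges 1 [(Top 1, Bot 1), (Top k, Bot k)]))"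

end

(*
A border column c = (4 - A^2) q with a suitable real corner entry extends A to a cyclotomic
matrix, because the bordered 2 - A and 2 + A are then congruent to 2 - A and 2 + A up to a
nonnegative corner; so maximality excludes many local configurations. Row norms are integers at
most 4; an entry of norm 3 or 4 forces S_2^dagger or S_1, and otherwise all nonzero entries are
units and maximality forces every row to have exactly four of them, that is, A^2 = 4.
Orthogonality of the rows then determines the graph locally. If two adjacent vertices carry the
same charge, the equations propagate along a ladder that has to close up with two charged
vertices, giving the two infinite families. Otherwise, after switching a charged vertex v to have
three neighbours joined by weight 1, these are three vertices of the opposite charge with no edges
among them, or one opposite charge and an uncharged edge, or an uncharged triangle; following the
orthogonality relations outwards closes up after at most eight vertices in one of the sporadic
graphs.
*)
theory Submission
  imports Defs "HOL-Analysis.Function_Topology"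
begin

section \<open>Eisenstein integers\<close>

text \<open>Why the border column has that shape: a column that keeps both 2 - A and 2 + A
  semidefinite must be orthogonal to their kernels, so it lies in the range of 4 - A^2 = (2 - A)(2 +
  A). Hence q and the corner are the only freedom, and q may be fractional as long as (4 - A^2) q is
  integral. Vectors q supported on one or two vertices, with values 1, 1/2 or 1/3 up to sign, are
  all that occurs, and each exclusion becomes a local computation in A^2.

  The obstacle is that four units per row cannot be reached by such extensions alone. Around an
  uncharged vertex with four neighbours some configurations with rows of norm 1 or 2 survive; they
  close up into graphs without any charge, and only the charge hypothesis removes them. If no row
  has norm 4, there is no orthogonality to work with, and a different extension, doubling a charged
  vertex, takes over.

  The classification itself uses relabelling, sign and diagonal switching only, so weights can be
  set to 1 along a tree and the others are solved for.\<close>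

lemma omega_re_im [simp]: "Re omega = 1/2" "Im omega = sqrt 3 / 2"
  by (simp_all add: omega_def)

lemma omega_sq: "omega * omega = omega - 1"
  by (simp add: complex_eq_iff)

lemma cnj_omega: "cnj omega = 1 - omega"
  by (simp add: complex_eq_iff)

lemma eisI: "of_int m + of_int n * omega \<in> eisenstein_ints"
  by (auto simp: eisenstein_ints_def)

lemma eis_of_int [simp, intro]: "of_int m \<in> eisenstein_ints"
  using eisI[of m 0] by simp

lemma eis_01 [simp, intro]: "0 \<in> eisenstein_ints" "1 \<in> eisenstein_ints"
  using eis_of_int[of 0] eis_of_int[of 1] by simp_all

lemma eis_omega [simp, intro]: "omega \<in> eisenstein_ints"
  using eisI[of 0 1] by simp

lemma eis_add [intro]:
  assumes "x \<in> eisenstein_ints" "y \<in> eisenstein_ints"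
  shows "x + y \<in> eisenstein_ints"
proof -
  from assms obtain a b c d where "x = of_int a + of_int b * omega" "y = of_int c + of_int d * omega"
    by (auto simp: eisenstein_ints_def)
  then have "x + y = of_int (a + c) + of_int (b + d) * omega" by (simp add: algebra_simps)
  then show ?thesis using eisI by metis
qed

lemma eis_mult [intro]:
  assumes "x \<in> eisenstein_ints" "y \<in> eisenstein_ints"
  shows "x * y \<in> eisenstein_ints"
proof -
  from assms obtain a b c d where xy: "x = of_int a + of_int b * omega" "y = of_int c + of_int d * omega"
    by (auto simp: eisenstein_ints_def)
  have "x * y = of_int a * of_int c + (of_int a * of_int d + of_int b * of_int c) * omega
      + of_int b * of_int d * (omega * omega)"
    unfolding xy by (simp add: algebra_simps)
  also have "\<dots> = of_int (a * c - b * d) + of_int (a * d + b * c + b * d) * omega"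
    unfolding omega_sq by (simp add: algebra_simps)
  finally show ?thesis using eisI by metis
qed

lemma eis_uminus [intro]: "x \<in> eisenstein_ints \<Longrightarrow> - x \<in> eisenstein_ints"
  using eis_mult[OF eis_of_int[of "-1"], of x] by simp

lemma eis_diff [intro]:
  "x \<in> eisenstein_ints \<Longrightarrow> y \<in> eisenstein_ints \<Longrightarrow> x - y \<in> eisenstein_ints"
  using eis_add[of x "-y"] by auto

lemma eis_cnj [intro]:
  assumes "x \<in> eisenstein_ints" shows "cnj x \<in> eisenstein_ints"
proof -
  from assms obtain a b where "x = of_int a + of_int b * omega"
    by (auto simp: eisenstein_ints_def)
  then have "cnj x = of_int (a + b) + of_int (- b) * omega"
    by (simp add: cnj_omega algebra_simps)
  then show ?thesis using eisI by metis
qed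

lemma eis_sum [intro]:
  "(\<And>i. i \<in> S \<Longrightarrow> f i \<in> eisenstein_ints) \<Longrightarrow> sum f S \<in> eisenstein_ints"
  by (induction S rule: infinite_finite_induct) auto

text \<open>Four times the norm is (2a + b)^2 + 3 b^2, and 8 is not of that form. Because of the gap
  at 2, a nonzero entry of norm at most 4 is a unit as soon as the norms 3 and 4 are
  excluded.\<close>

lemma eis_norm:
  assumes "x \<in> eisenstein_ints"
  obtains k :: int where "k \<ge> 0" "(cmod x)\<^sup>2 = of_int k" "k \<noteq> 2"
proof -
  from assms obtain a b where x: "x = of_int a + of_int b * omega"
    by (auto simp: eisenstein_ints_def)
  define k where "k = a\<^sup>2 + a * b + b\<^sup>2"
  have n: "(cmod x)\<^sup>2 = of_int k"
    unfolding cmod_power2 x k_def by (simp add: power2_eq_square field_simps)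
  have "k \<ge> 0" using n by (metis of_int_0_le_iff zero_le_power2)
  moreover have "k \<noteq> 2"
  proof
    assume "k = 2"
    then have e: "(2 * a + b)\<^sup>2 + 3 * b\<^sup>2 = 8" by (simp add: k_def power2_eq_square algebra_simps)
    then have "b\<^sup>2 \<le> 2" by (smt (verit) zero_le_power2)
    then have "\<not> \<bar>b\<bar> \<ge> 2"
      using mult_mono[of 2 "\<bar>b\<bar>" 2 "\<bar>b\<bar>"] by (auto simp: power2_eq_square)
    then have "b \<in> {-1, 0, 1}" by auto
    then have "b\<^sup>2 = 0 \<or> b\<^sup>2 = 1" by auto
    with e have "(2 * a + b)\<^sup>2 = 8 \<or> (2 * a + b)\<^sup>2 = 5" by auto
    moreover have "z\<^sup>2 \<noteq> 8 \<and> z\<^sup>2 \<noteq> 5" for z :: int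
    proof -
      have "\<bar>z\<bar> \<le> 2 \<or> \<bar>z\<bar> \<ge> 3" by linarith
      then show ?thesis
      proof
        assume "\<bar>z\<bar> \<le> 2"
        then have "z \<in> {-2,-1,0,1,2}" by auto
        then show ?thesis by auto
      next
        assume "\<bar>z\<bar> \<ge> 3"
        then have "\<bar>z\<bar> * \<bar>z\<bar> \<ge> 3 * 3" by (intro mult_mono) auto
        then show ?thesis by (simp add: power2_eq_square)
      qed
    qed
    ultimately show False by auto
  qed
  ultimately show ?thesis using n that by blast
qed

lemma eis_real:
  assumes "x \<in> eisenstein_ints" "Im x = 0"
  obtains k :: int where "x = of_int k"
proof -
  from assms obtain a b where x: "x = of_int a + of_int b * omega"
    by (auto simp: eisenstein_ints_def)
  with assms(2) have "b = 0" by simp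
  with x that show ?thesis by simp
qed

text \<open>A purely imaginary Eisenstein integer is a multiple of sqrt(-3), so its norm is 3 a^2.
  This removes the weight that the star equations would otherwise leave open.\<close>

lemma eis_pure_imaginary:
  assumes "x \<in> eisenstein_ints" "Re x = 0" "cmod x = 1"
  shows False
proof -
  from assms obtain a b where x: "x = of_int a + of_int b * omega"
    by (auto simp: eisenstein_ints_def)
  with assms(2) have "2 * real_of_int a + real_of_int b = 0" by simp
  then have "real_of_int (2 * a + b) = real_of_int 0" by simp
  then have b: "b = - 2 * a" unfolding of_int_eq_iff by simp
  have "(cmod x)\<^sup>2 = 3 * (real_of_int a)\<^sup>2"
    unfolding cmod_power2 x b by (simp add: power2_eq_square field_simps)
  then have "3 * (real_of_int a)\<^sup>2 = 1" using assms(3) by simp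
  then have "real_of_int (3 * a\<^sup>2) = real_of_int 1" by simp
  then have "3 * a\<^sup>2 = 1" unfolding of_int_eq_iff .
  then show False by presburger
qed

section \<open>Hermitian forms indexed by an initial segment\<close>

text \<open>Matrices and vectors are total functions read only below \<open>n\<close>. Adding a
  border vertex is then the passage from \<open>n\<close> to \<open>Suc n\<close>, and switching is
  a pointwise product.\<close>

definition mv :: "nat \<Rightarrow> (nat \<Rightarrow> nat \<Rightarrow> complex) \<Rightarrow> (nat \<Rightarrow> complex) \<Rightarrow> nat \<Rightarrow> complex" where
  "mv n a z i = (\<Sum>j<n. a i j * z j)"

definition ip :: "nat \<Rightarrow> (nat \<Rightarrow> complex) \<Rightarrow> (nat \<Rightarrow> complex) \<Rightarrow> complex" where
  "ip n u v = (\<Sum>i<n. cnj (u i) * v i)"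

definition herm :: "nat \<Rightarrow> (nat \<Rightarrow> nat \<Rightarrow> complex) \<Rightarrow> bool" where
  "herm n a \<longleftrightarrow> (\<forall>i<n. \<forall>j<n. a j i = cnj (a i j))"

text \<open>For Hermitian \<open>a\<close> this says that 2 - A and 2 + A are both semidefinite. In
  this shape the bound can be checked on a bordered matrix by completing squares, which eigenvalues
  do not allow.\<close>

definition bounded_form :: "nat \<Rightarrow> (nat \<Rightarrow> nat \<Rightarrow> complex) \<Rightarrow> bool" where
  "bounded_form n a \<longleftrightarrow> (\<forall>z. \<bar>Re (ip n z (mv n a z))\<bar> \<le> 2 * Re (ip n z z))"

lemma hermD: "herm n a \<Longrightarrow> i < n \<Longrightarrow> j < n \<Longrightarrow> a j i = cnj (a i j)"
  unfolding herm_def by blast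

lemma ip_add: "ip n (\<lambda>i. u i + v i) w = ip n u w + ip n v w"
  "ip n w (\<lambda>i. u i + v i) = ip n w u + ip n w v"
  by (simp_all add: ip_def algebra_simps sum.distrib)

lemma ip_diff: "ip n (\<lambda>i. u i - v i) w = ip n u w - ip n v w"
  "ip n w (\<lambda>i. u i - v i) = ip n w u - ip n w v"
  by (simp_all add: ip_def algebra_simps sum_subtractf)

lemma ip_scale: "ip n (\<lambda>i. k * u i) w = cnj k * ip n u w"
  "ip n w (\<lambda>i. k * u i) = k * ip n w u"
  by (simp_all add: ip_def sum_distrib_left mult_ac)

lemma ip_cnj: "cnj (ip n u v) = ip n v u"
  by (simp add: ip_def mult.commute)

lemma ip_self: "ip n z z = of_real (\<Sum>i<n. (cmod (z i))\<^sup>2)"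
  by (simp add: ip_def complex_norm_square mult.commute del: of_real_power)

lemma ip_self_nonneg: "0 \<le> Re (ip n z z)"
  by (simp add: ip_self sum_nonneg)

lemma mv_add: "mv n a (\<lambda>i. u i + v i) = (\<lambda>i. mv n a u i + mv n a v i)"
  by (simp add: mv_def algebra_simps sum.distrib fun_eq_iff)

lemma mv_diff: "mv n a (\<lambda>i. u i - v i) = (\<lambda>i. mv n a u i - mv n a v i)"
  by (simp add: mv_def algebra_simps sum_subtractf fun_eq_iff)

lemma mv_scale: "mv n a (\<lambda>i. k * u i) = (\<lambda>i. k * mv n a u i)"
  by (simp add: mv_def sum_distrib_left mult_ac fun_eq_iff)

lemmas ip_mv_linear = ip_add ip_diff ip_scale mv_add mv_diff mv_scale

lemma ip_mv:
  assumes "herm n a"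
  shows "ip n u (mv n a v) = ip n (mv n a u) v"
proof -
  have "ip n u (mv n a v) = (\<Sum>i<n. \<Sum>j<n. cnj (u i) * a i j * v j)"
    by (simp add: ip_def mv_def sum_distrib_left mult_ac)
  also have "\<dots> = (\<Sum>j<n. \<Sum>i<n. cnj (u i) * a i j * v j)"
    by (rule sum.swap)
  also have "\<dots> = (\<Sum>j<n. \<Sum>i<n. cnj (a j i * u i) * v j)"
    by (intro sum.cong refl) (simp add: hermD[OF assms, symmetric])
  also have "\<dots> = ip n (mv n a u) v"
    by (simp add: ip_def mv_def sum_distrib_right)
  finally show ?thesis .
qed

lemma ip_mv_real: "herm n a \<Longrightarrow> Im (ip n z (mv n a z)) = 0"
  using ip_cnj[of n z "mv n a z"] ip_mv[of n a z z] by (simp add: complex_eq_iff)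

lemma ip_cong: "(\<And>i. i < n \<Longrightarrow> u i = u' i) \<Longrightarrow> (\<And>i. i < n \<Longrightarrow> v i = v' i) \<Longrightarrow> ip n u v = ip n u' v'"
  by (auto simp: ip_def intro: sum.cong)

lemma mv_cong: "(\<And>j. j < n \<Longrightarrow> a i j = a' i j) \<Longrightarrow> (\<And>i. i < n \<Longrightarrow> v i = v' i) \<Longrightarrow> mv n a v i = mv n a' v' i"
  by (auto simp: mv_def intro: sum.cong)

text \<open>The contraction property follows from the bound on the form by polarising \<open>z\<close> against half
  its image.\<close>

lemma bounded_form_contraction:
  assumes h: "herm n a" and b: "bounded_form n a"
  shows "Re (ip n (mv n a z) (mv n a z)) \<le> 4 * Re (ip n z z)"
proof -
  let ?w = "\<lambda>i. (1/2) * mv n a z i"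
  let ?N = "Re (ip n (mv n a z) (mv n a z))"
  have 1: "Re (ip n (\<lambda>i. z i + ?w i) (mv n a (\<lambda>i. z i + ?w i))) \<le> 2 * Re (ip n (\<lambda>i. z i + ?w i) (\<lambda>i. z i + ?w i))"
    and 2: "- Re (ip n (\<lambda>i. z i - ?w i) (mv n a (\<lambda>i. z i - ?w i))) \<le> 2 * Re (ip n (\<lambda>i. z i - ?w i) (\<lambda>i. z i - ?w i))"
    using b unfolding bounded_form_def abs_le_iff by blast+
  have e: "ip n z (mv n a (mv n a z)) = ip n (mv n a z) (mv n a z)"
    by (rule ip_mv[OF h])
  show ?thesis
    using 1 2 unfolding ip_mv_linear e by (simp add: algebra_simps)
qed

text \<open>Moving from \<open>z\<close> by a small multiple of its image changes the form at first
  order by -2 t N, which would make it negative unless the image has norm N = 0. It serves twice: to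
  find an eigenvector at a maximum, and to clear the rows of 4 - A^2 whose diagonal entry is
  0.\<close>

lemma form_kernel:
  assumes h: "herm n a" and nn: "\<And>w. 0 \<le> Re (ip n w (mv n a w))"
    and z: "Re (ip n z (mv n a z)) = 0" and i: "i < n"
  shows "mv n a z i = 0"
proof -
  let ?r = "mv n a z"
  define N where "N = Re (ip n ?r ?r)"
  define K where "K = Re (ip n ?r (mv n a ?r))"
  have K: "K \<ge> 0" using nn by (simp add: K_def)
  have e: "ip n z (mv n a ?r) = ip n ?r ?r" by (rule ip_mv[OF h])
  have q: "0 \<le> - 2 * t * N + t\<^sup>2 * K" for t :: real
    using nn[of "\<lambda>i. z i - of_real t * ?r i"] z
    unfolding ip_mv_linear e N_def K_def by (simp add: algebra_simps power2_eq_square)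
  have "N = 0"
  proof (rule ccontr)
    assume "N \<noteq> 0"
    then have N: "N > 0" using ip_self_nonneg[of n ?r] by (simp add: N_def)
    \<comment> \<open>The value t = N / (K + 1) keeps the quadratic term t^2 K at most t N; the
      summand 1 covers K = 0.\<close>
    have "0 \<le> - 2 * (N / (K + 1)) * N + (N / (K + 1))\<^sup>2 * K" by (rule q)
    moreover have "(N / (K + 1))\<^sup>2 * K \<le> (N / (K + 1)) * N"
    proof -
      have "(N / (K + 1))\<^sup>2 * K = (N / (K + 1)) * N * (K / (K + 1))"
        by (simp add: power2_eq_square)
      also have "\<dots> \<le> (N / (K + 1)) * N * 1"
        by (rule mult_left_mono) (use K N in auto)
      finally show ?thesis by simp
    qed
    moreover have "(N / (K + 1)) * N > 0" using N K by simp
    ultimately have "0 < (0::real)" by simp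
    then show False by simp
  qed
  then have "(\<Sum>i<n. (cmod (?r i))\<^sup>2) = 0" by (simp add: N_def ip_self)
  then have "(cmod (?r i))\<^sup>2 = 0" using i by (subst (asm) sum_nonneg_eq_0_iff) auto
  then show ?thesis by simp
qed

text \<open>Spectral theorem in the form needed here: the maximum of the form on the unit sphere is
  attained at an eigenvector.\<close>

lemma form_le_of_eigenvalues:
  assumes h: "herm n a"
    and ev: "\<And>M z. (\<exists>i<n. z i \<noteq> 0) \<Longrightarrow> (\<And>i. i < n \<Longrightarrow> mv n a z i = of_real M * z i) \<Longrightarrow> M \<le> B"
  shows "Re (ip n z (mv n a z)) \<le> B * Re (ip n z z)"
proof (cases "\<exists>i<n. z i \<noteq> 0")
  case False
  then have "ip n z v = 0" for v by (simp add: ip_def)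
  then show ?thesis by simp
next
  case True
  \<comment> \<open>A square that contains the unit disc, compact as a continuous image of a real
    rectangle.\<close>
  define K where "K = (\<lambda>p. Complex (fst p) (snd p)) ` ({-1..1::real} \<times> {-1..1::real})"
  have cK: "compact K" unfolding K_def
    by (intro compact_continuous_image compact_Times compact_Icc continuous_intros)
  have inK: "x \<in> K" if "cmod x \<le> 1" for x
    using that abs_Re_le_cmod[of x] abs_Im_le_cmod[of x] unfolding K_def
    by (intro image_eqI[of _ _ "(Re x, Im x)"]) (auto simp: abs_le_iff)
  \<comment> \<open>\<open>PiE\<close> pins the values outside \<open>{..<n}\<close> to
    \<open>undefined\<close>. Vectors are functions on all naturals, so without this the sphere
    would not be compact.\<close>
  define S where "S = {w. Re (ip n w w) = 1} \<inter> PiE {..<n} (\<lambda>_. K)"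
  define Q where "Q w = Re (ip n w (mv n a w))" for w
  have cont1: "continuous_on UNIV (\<lambda>w. Re (ip n w w))"
    unfolding ip_def by (intro continuous_intros continuous_on_product_coordinates)
  have cont2: "continuous_on UNIV Q"
    unfolding ip_def mv_def Q_def
    by (intro continuous_intros continuous_on_product_coordinates)
  have extend: "\<exists>w'\<in>S. (\<forall>i<n. w' i = w i)" if "Re (ip n w w) = 1" for w
  proof -
    have "(cmod (w i))\<^sup>2 \<le> 1" if "i < n" for i
      using that \<open>Re (ip n w w) = 1\<close> member_le_sum[of i "{..<n}" "\<lambda>i. (cmod (w i))\<^sup>2"]
      by (simp add: ip_self)
    then have le: "cmod (w i) \<le> 1" if "i < n" for i
      using that by (simp add: power_le_one_iff)
    define w' where "w' = restrict w {..<n}"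
    have "ip n w' w' = ip n w w" by (rule ip_cong) (auto simp: w'_def)
    then have "w' \<in> S" using that le by (auto simp: S_def w'_def intro: inK)
    then show ?thesis by (intro bexI[of _ w']) (simp_all add: w'_def)
  qed
  have "compactin (product_topology (\<lambda>_. euclidean) UNIV) (PiE UNIV (\<lambda>i::nat. if i < n then K else {undefined}))"
    by (rule compactin_PiE[THEN iffD2], rule disjI2)
      (simp only: compactin_euclidean_iff, simp add: cK)
  moreover have "PiE UNIV (\<lambda>i::nat. if i < n then K else {undefined})
      = PiE {..<n} (\<lambda>_. K)"
  proof (rule Set.set_eqI)
    fix w :: "nat \<Rightarrow> complex"
    have "(\<forall>i. w i \<in> (if i < n then K else {undefined})) \<longleftrightarrow>
        (\<forall>i<n. w i \<in> K) \<and> (\<forall>i. \<not> i < n \<longrightarrow> w i = undefined)"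
      by (metis singletonD singletonI)
    then show "w \<in> PiE UNIV (\<lambda>i. if i < n then K else {undefined}) \<longleftrightarrow> w \<in> PiE {..<n} (\<lambda>_. K)"
      unfolding PiE_iff extensional_def by blast
  qed
  ultimately have "compact (PiE {..<n} (\<lambda>_. K))"
    by (simp only: euclidean_product_topology compactin_euclidean_iff)
  moreover have "closed {w. Re (ip n w w) = 1}"
    by (rule closed_Collect_eq[of "\<lambda>w. Re (ip n w w)" "\<lambda>_. 1"]) (rule cont1, rule continuous_on_const)
  ultimately have cS: "compact S" unfolding S_def by (intro closed_Int_compact)
  define N where "N = Re (ip n z z)"
  have N: "N > 0"
  proof -
    from True obtain i where i: "i < n" "z i \<noteq> 0" by auto
    then have "0 < (cmod (z i))\<^sup>2" by simp
    also have "\<dots> \<le> N" using i member_le_sum[of i "{..<n}" "\<lambda>i. (cmod (z i))\<^sup>2"]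
      by (simp add: ip_self N_def)
    finally show ?thesis .
  qed
  have scale: "Re (ip n (\<lambda>i. of_real c * w i) (\<lambda>i. of_real c * w i)) = c\<^sup>2 * Re (ip n w w)"
    "Q (\<lambda>i. of_real c * w i) = c\<^sup>2 * Q w" for c w
    by (simp_all add: Q_def ip_mv_linear power2_eq_square)
  have Qc: "Q w = Q w'" if "\<forall>i<n. w i = w' i" for w w'
    unfolding Q_def using that by (intro arg_cong[where f = Re] ip_cong mv_cong) auto
  have norm1: "Re (ip n w w) > 0 \<Longrightarrow> Re (ip n (\<lambda>i. of_real (1 / sqrt (Re (ip n w w))) * w i) (\<lambda>i. of_real (1 / sqrt (Re (ip n w w))) * w i)) = 1" for w
    unfolding scale(1) by (simp add: power_divide)
  have "S \<noteq> {}" using extend[OF norm1[of z]] N by (auto simp: N_def)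
  then obtain x where x: "x \<in> S" "\<And>y. y \<in> S \<Longrightarrow> Q y \<le> Q x"
    using continuous_attains_sup[OF cS, of Q] cont2 continuous_on_subset by blast
  define M where "M = Q x"
  have max: "Q w \<le> M * Re (ip n w w)" for w
  proof (cases "Re (ip n w w) > 0")
    case True
    define c where "c = 1 / sqrt (Re (ip n w w))"
    from extend[OF norm1[OF True]] obtain w' where w': "w' \<in> S" "\<forall>i<n. w' i = of_real c * w i"
      unfolding c_def by blast
    have "Q w' = c\<^sup>2 * Q w" using Qc[OF w'(2)] scale(2) by simp
    with x(2)[OF w'(1)] have "c\<^sup>2 * Q w \<le> M" by (simp add: M_def)
    then show ?thesis using True by (simp add: c_def power_divide field_simps)
  next
    case False
    then have "Re (ip n w w) = 0" using ip_self_nonneg[of n w] by simp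
    then have "\<forall>i<n. w i = 0" by (simp add: ip_self sum_nonneg_eq_0_iff)
    then show ?thesis by (simp add: Q_def ip_def)
  qed
  \<comment> \<open>M - A is nonnegative because M is the maximum, and its form vanishes at the
    maximiser x; \<open>form_kernel\<close> then makes x an eigenvector.\<close>
  let ?b = "\<lambda>i j. (if i = j then of_real M else 0) - a i j"
  have mvb: "mv n ?b w i = of_real M * w i - mv n a w i" if "i < n" for w i
  proof -
    have "mv n ?b w i = (\<Sum>j<n. (if i = j then of_real M * w j else 0) - a i j * w j)"
      unfolding mv_def by (intro sum.cong) (auto simp: algebra_simps)
    also have "\<dots> = of_real M * w i - mv n a w i"
      using that by (simp add: sum_subtractf mv_def)
    finally show ?thesis .
  qed
  have formb: "Re (ip n w (mv n ?b w)) = M * Re (ip n w w) - Q w" for w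
  proof -
    have "ip n w (mv n ?b w) = ip n w (\<lambda>i. of_real M * w i - mv n a w i)"
      by (rule ip_cong) (auto simp: mvb)
    then show ?thesis by (simp add: ip_mv_linear Q_def)
  qed
  have x1: "Re (ip n x x) = 1" using x(1) by (simp add: S_def)
  have eig: "mv n a x i = of_real M * x i" if "i < n" for i
  proof -
    have "mv n ?b x i = 0"
    proof (rule form_kernel)
      show "herm n ?b" unfolding herm_def
      proof (intro allI impI)
        fix i j assume "i < n" "j < n"
        then show "?b j i = cnj (?b i j)" using hermD[OF h, of i j] by auto
      qed
      show "0 \<le> Re (ip n w (mv n ?b w))" for w using max[of w] by (simp add: formb)
      show "Re (ip n x (mv n ?b x)) = 0" unfolding formb x1 by (simp add: M_def)
    qed fact
    then show ?thesis using mvb[OF that] by simp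
  qed
  have "\<exists>i<n. x i \<noteq> 0"
  proof (rule ccontr)
    assume "\<not> ?thesis"
    then have "ip n x x = 0" by (simp add: ip_def)
    with x1 show False by simp
  qed
  from ev[OF this eig] have "M \<le> B" .
  then have "M * N \<le> B * N" using N by (intro mult_right_mono) auto
  with max[of z] show ?thesis by (simp add: Q_def N_def)
qed

section \<open>One-vertex extensions\<close>

definition cyc :: "nat \<Rightarrow> (nat \<Rightarrow> nat \<Rightarrow> complex) \<Rightarrow> bool" where
  "cyc n a \<longleftrightarrow> (\<forall>i<n. \<forall>j<n. a i j \<in> eisenstein_ints) \<and> herm n a \<and> bounded_form n a"

definition ext :: "nat \<Rightarrow> (nat \<Rightarrow> nat \<Rightarrow> complex) \<Rightarrow> (nat \<Rightarrow> complex) \<Rightarrow> complex \<Rightarrow> nat \<Rightarrow> nat \<Rightarrow> complex" where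
  "ext n a c d i j =
     (if i < n then if j < n then a i j else c i else if j < n then cnj (c j) else d)"

text \<open>The nonzero border entry keeps the enlarged graph connected, so such an extension really
  contradicts maximality. The corner \<open>d\<close> is the charge of the new vertex.\<close>

definition extendable :: "nat \<Rightarrow> (nat \<Rightarrow> nat \<Rightarrow> complex) \<Rightarrow> bool" where
  "extendable n a \<longleftrightarrow> (\<exists>c d. (\<exists>i<n. c i \<noteq> 0) \<and> cyc (Suc n) (ext n a c d))"

definition sq :: "nat \<Rightarrow> (nat \<Rightarrow> nat \<Rightarrow> complex) \<Rightarrow> nat \<Rightarrow> nat \<Rightarrow> complex" where
  "sq n a i j = (\<Sum>k<n. a i k * a k j)"

lemma cycD:
  assumes "cyc n a"
  shows "i < n \<Longrightarrow> j < n \<Longrightarrow> a i j \<in> eisenstein_ints" "herm n a" "bounded_form n a"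
  using assms unfolding cyc_def by blast+

lemma ext_form:
  "ip (Suc n) z (mv (Suc n) (ext n a c d) z) =
     ip n z (mv n a z) + z n * ip n z c + cnj (z n) * ip n c z + d * (cnj (z n) * z n)"
proof -
  have 1: "mv (Suc n) (ext n a c d) z i = mv n a z i + z n * c i" if "i < n" for i
    using that by (simp add: mv_def ext_def mult.commute)
  have 2: "mv (Suc n) (ext n a c d) z n = ip n c z + d * z n"
    by (simp add: mv_def ext_def ip_def)
  have "ip (Suc n) z (mv (Suc n) (ext n a c d) z)
      = (\<Sum>i<n. cnj (z i) * mv (Suc n) (ext n a c d) z i) + cnj (z n) * (ip n c z + d * z n)"
    by (simp add: ip_def 2)
  also have "(\<Sum>i<n. cnj (z i) * mv (Suc n) (ext n a c d) z i) = ip n z (\<lambda>i. mv n a z i + z n * c i)"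
    unfolding ip_def by (intro sum.cong) (auto simp: 1)
  finally show ?thesis unfolding ip_mv_linear by (simp only: distrib_left mult.assoc mult.left_commute add.assoc)
qed

lemma ip_Suc: "ip (Suc n) z z = ip n z z + cnj (z n) * z n"
  by (simp add: ip_def)

lemma cnj_mult_self: "cnj z * z = of_real ((cmod z)\<^sup>2)"
  by (simp add: complex_norm_square mult.commute del: of_real_power)

text \<open>\<open>k\<close> is the coordinate at the new vertex, and \<open>lo\<close> and
  \<open>hi\<close> are the bordered forms of 2 + A and 2 - A written out.\<close>

lemma cyc_extI:
  assumes a: "cyc n a" and c: "\<And>i. i < n \<Longrightarrow> c i \<in> eisenstein_ints"
    and lo: "\<And>z k. 0 \<le> 2 * Re (ip n z z) + Re (ip n z (mv n a z)) + 2 * Re (k * ip n z c) + (2 + of_int d) * (cmod k)\<^sup>2"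
    and hi: "\<And>z k. 0 \<le> 2 * Re (ip n z z) - Re (ip n z (mv n a z)) - 2 * Re (k * ip n z c) + (2 - of_int d) * (cmod k)\<^sup>2"
  shows "cyc (Suc n) (ext n a c (of_int d))"
  unfolding cyc_def
proof (intro conjI allI impI)
  show "ext n a c (of_int d) i j \<in> eisenstein_ints" for i j
    using cycD(1)[OF a] c by (cases "i < n"; cases "j < n") (auto simp: ext_def)
  show "herm (Suc n) (ext n a c (of_int d))"
    unfolding herm_def
  proof (intro allI impI)
    fix i j assume "i < Suc n" "j < Suc n"
    then show "ext n a c (of_int d) j i = cnj (ext n a c (of_int d) i j)"
      using hermD[OF cycD(2)[OF a], of i j] by (auto simp: ext_def)
  qed
  show "bounded_form (Suc n) (ext n a c (of_int d))"
    unfolding bounded_form_def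
  proof
    fix z
    have e: "Re (cnj (z n) * ip n c z) = Re (z n * ip n z c)"
      by (metis ip_cnj complex_cnj_mult complex_cnj_cnj complex_cnj(1) complex.sel(1) cnj.simps(1))
    show "\<bar>Re (ip (Suc n) z (mv (Suc n) (ext n a c (of_int d)) z))\<bar> \<le> 2 * Re (ip (Suc n) z z)"
      unfolding abs_le_iff
      using lo[of z "z n"] hi[of z "z n"] e
      unfolding ext_form ip_Suc cnj_mult_self by (simp add: algebra_simps)
  qed
qed

text \<open>With \<open>W = 4 - A\<^sup>2\<close>, the bordered matrix is congruent to \<open>2 \<plusminus> A\<close> up to a
  nonnegative slack in the corner.\<close>

lemma extendableI:
  assumes a: "cyc n a"
    and p: "p = mv n a q" and c: "c = (\<lambda>i. 4 * q i - mv n a p i)"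
    and cE: "\<And>i. i < n \<Longrightarrow> c i \<in> eisenstein_ints" and nz: "i0 < n" "c i0 \<noteq> 0"
    and lo: "2 * Re (ip n q c) - Re (ip n p c) \<le> 2 + of_int d"
    and hi: "2 * Re (ip n q c) + Re (ip n p c) \<le> 2 - of_int d"
  shows "extendable n a"
proof -
  note h = cycD(2)[OF a] and b = cycD(3)[OF a]
  have swap: "ip n q (mv n a z) = ip n p z" "ip n p (mv n a z) = ip n (mv n a p) z" for z
    unfolding p by (rule ip_mv[OF h])+
  have cz: "ip n c z = 4 * ip n q z - ip n (mv n a p) z" for z
    unfolding c by (simp add: ip_mv_linear)
  have zc: "ip n z c = 4 * ip n z q - ip n z (mv n a p)" for z
    unfolding c by (simp add: ip_mv_linear)
  have zc': "Re (k * ip n z c) = Re (cnj k * ip n c z)" for k z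
    by (metis ip_cnj complex_cnj_mult complex_cnj_cnj complex_cnj(1) complex.sel(1) cnj.simps(1))
  have k2: "Re (k * (cnj k * x)) = (cmod k)\<^sup>2 * Re x" for k x
  proof -
    have "k * (cnj k * x) = of_real ((cmod k)\<^sup>2) * x"
      using cnj_mult_self[of k] by (simp add: mult_ac del: of_real_power)
    then show ?thesis by (metis Re_complex_of_real Im_complex_of_real mult_zero_left diff_zero times_complex.sel(1))
  qed
  have "cyc (Suc n) (ext n a c (of_int d))"
  proof (rule cyc_extI[OF a cE])
    fix z :: "nat \<Rightarrow> complex" and k
    \<comment> \<open>y = z + k (2 - A) q. In the form of 2 + A the cross term pairs z with (2 +
      A)(2 - A) q = c, so this square is the bordered form up to the corner.\<close>
    define y where "y = (\<lambda>i. z i + k * (2 * q i - p i))"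
    have "2 * ip n y y + ip n y (mv n a y)
        = 2 * ip n z z + ip n z (mv n a z) + k * ip n z c + cnj k * ip n c z
          + k * (cnj k * (2 * ip n q c - ip n p c))"
      unfolding y_def ip_mv_linear swap cz zc p[symmetric] by (simp add: algebra_simps)
    then have e: "2 * Re (ip n y y) + Re (ip n y (mv n a y))
        = 2 * Re (ip n z z) + Re (ip n z (mv n a z)) + 2 * Re (k * ip n z c)
          + (cmod k)\<^sup>2 * (2 * Re (ip n q c) - Re (ip n p c))"
      using zc'[of k z] k2[of k "2 * ip n q c - ip n p c"] by (simp add: complex_eq_iff)
    have "0 \<le> 2 * Re (ip n y y) + Re (ip n y (mv n a y))"
      using b[unfolded bounded_form_def abs_le_iff, THEN spec, of y] by linarith
    moreover have "(cmod k)\<^sup>2 * (2 * Re (ip n q c) - Re (ip n p c)) \<le> (cmod k)\<^sup>2 * (2 + of_int d)"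
      by (rule mult_left_mono[OF lo]) simp
    ultimately show "0 \<le> 2 * Re (ip n z z) + Re (ip n z (mv n a z)) + 2 * Re (k * ip n z c) + (2 + of_int d) * (cmod k)\<^sup>2"
      unfolding e by (simp add: mult.commute)
    \<comment> \<open>The mirror image for 2 - A, with (2 + A) q subtracted because the border now
      enters with the opposite sign.\<close>
    define x where "x = (\<lambda>i. z i - k * (2 * q i + p i))"
    have "2 * ip n x x - ip n x (mv n a x)
        = 2 * ip n z z - ip n z (mv n a z) - k * ip n z c - cnj k * ip n c z
          + k * (cnj k * (2 * ip n q c + ip n p c))"
      unfolding x_def ip_mv_linear swap cz zc p[symmetric] by (simp add: algebra_simps)
    then have e: "2 * Re (ip n x x) - Re (ip n x (mv n a x))
        = 2 * Re (ip n z z) - Re (ip n z (mv n a z)) - 2 * Re (k * ip n z c)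
          + (cmod k)\<^sup>2 * (2 * Re (ip n q c) + Re (ip n p c))"
      using zc'[of k z] k2[of k "2 * ip n q c + ip n p c"] by (simp add: complex_eq_iff)
    have "0 \<le> 2 * Re (ip n x x) - Re (ip n x (mv n a x))"
      using b[unfolded bounded_form_def abs_le_iff, THEN spec, of x] by linarith
    moreover have "(cmod k)\<^sup>2 * (2 * Re (ip n q c) + Re (ip n p c)) \<le> (cmod k)\<^sup>2 * (2 - of_int d)"
      by (rule mult_left_mono[OF hi]) simp
    ultimately show "0 \<le> 2 * Re (ip n z z) - Re (ip n z (mv n a z)) - 2 * Re (k * ip n z c) + (2 - of_int d) * (cmod k)\<^sup>2"
      unfolding e by (simp add: mult.commute)
  qed
  then show ?thesis using nz unfolding extendable_def by blast
qed

lemma mv_mv: "mv n a (mv n a q) i = (\<Sum>j<n. sq n a i j * q j)"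
proof -
  have "mv n a (mv n a q) i = (\<Sum>k<n. \<Sum>j<n. a i k * a k j * q j)"
    by (simp add: mv_def sum_distrib_left mult_ac)
  also have "\<dots> = (\<Sum>j<n. \<Sum>k<n. a i k * a k j * q j)"
    by (rule sum.swap)
  finally show ?thesis by (simp add: sq_def sum_distrib_right)
qed

text \<open>The hypothesis on \<open>c\<close> is c = (4 - A^2) q for q = \<alpha> e_u + \<beta>
  e_v. Then \<open>s\<close> and \<open>t\<close> are the real parts of the pairings of q and of A q
  with c, so the corner conditions involve c and A c at u and v only. The coefficients may be
  fractions.\<close>

lemma extendable_pairI:
  fixes \<alpha> \<beta> :: complex
  assumes a: "cyc n a" and u: "u < n" "v < n" "u \<noteq> v"
    and c: "\<And>i. i < n \<Longrightarrow> c i = (if i = u then 4 * \<alpha> else 0) + (if i = v then 4 * \<beta> else 0)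
        - \<alpha> * sq n a i u - \<beta> * sq n a i v"
    and cE: "\<And>i. i < n \<Longrightarrow> c i \<in> eisenstein_ints" and nz: "i0 < n" "c i0 \<noteq> 0"
    and s: "s = Re (cnj \<alpha> * c u + cnj \<beta> * c v)"
    and t: "t = Re (cnj \<alpha> * mv n a c u + cnj \<beta> * mv n a c v)"
    and lo: "2 * s - t \<le> 2 + of_int d" and hi: "2 * s + t \<le> 2 - of_int d"
  shows "extendable n a"
proof -
  define q where "q = (\<lambda>i. if i = u then \<alpha> else if i = v then \<beta> else 0)"
  define c' where "c' = (\<lambda>i. 4 * q i - mv n a (mv n a q) i)"
  have sumq: "(\<Sum>j<n. f j * q j) = f u * \<alpha> + f v * \<beta>" for f :: "nat \<Rightarrow> complex"
  proof -
    have "(\<Sum>j<n. f j * q j) = (\<Sum>j\<in>{u,v}. f j * q j)"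
      by (rule sum.mono_neutral_right) (use u in \<open>auto simp: q_def\<close>)
    then show ?thesis using u by (simp add: q_def)
  qed
  have cc: "c' i = c i" if "i < n" for i
    unfolding c'_def mv_mv sumq c[OF that] using u by (auto simp: q_def)
  have ipq: "ip n q w = cnj \<alpha> * w u + cnj \<beta> * w v" for w
    using sumq[of "\<lambda>i. cnj (w i)"] unfolding ip_def
    by (metis (no_types, lifting) complex_cnj_cnj complex_cnj_add complex_cnj_mult cnj_sum mult.commute sum.cong)
  have qc: "ip n q c' = cnj \<alpha> * c u + cnj \<beta> * c v"
    unfolding ipq using u by (simp add: cc)
  have "ip n (mv n a q) c' = ip n q (mv n a c')"
    by (rule ip_mv[OF cycD(2)[OF a], symmetric])
  also have "\<dots> = cnj \<alpha> * mv n a c u + cnj \<beta> * mv n a c v"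
    unfolding ipq using mv_cong[of n a _ a c' c] cc by (metis (no_types, lifting))
  finally have pc: "ip n (mv n a q) c' = \<dots>" .
  show ?thesis
    by (rule extendableI[OF a refl c'_def _ nz(1), where d = d])
      (use cE nz lo hi in \<open>simp_all add: cc qc pc s t\<close>)
qed

section \<open>Row norms and the deficit form 4 - A^2\<close>

definition rowsq :: "nat \<Rightarrow> (nat \<Rightarrow> nat \<Rightarrow> complex) \<Rightarrow> nat \<Rightarrow> real" where
  "rowsq n a i = (\<Sum>j<n. (cmod (a i j))\<^sup>2)"

lemma sq_diag:
  assumes "herm n a" "i < n" shows "sq n a i i = of_real (rowsq n a i)"
proof -
  have "sq n a i i = (\<Sum>k<n. of_real ((cmod (a i k))\<^sup>2))"
    unfolding sq_def
  proof (intro sum.cong refl)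
    fix k assume "k \<in> {..<n}"
    then have "a k i = cnj (a i k)" using hermD[OF assms(1,2)] by simp
    then show "a i k * a k i = of_real ((cmod (a i k))\<^sup>2)" by (simp add: complex_norm_square del: of_real_power)
  qed
  then show ?thesis by (simp add: rowsq_def)
qed

lemma sq_herm:
  assumes "herm n a" "i < n" "j < n" shows "sq n a j i = cnj (sq n a i j)"
proof -
  have "sq n a j i = (\<Sum>k<n. cnj (a k j) * cnj (a i k))"
    unfolding sq_def
    by (intro sum.cong refl arg_cong2[where f = "(*)"] hermD[OF assms(1)]) (use assms in auto)
  then show ?thesis by (simp add: sq_def mult.commute)
qed

text \<open>The value at z is 4 |z|^2 - |A z|^2, nonnegative by the contraction property. A row of
  norm 4 puts a zero on the diagonal of this semidefinite matrix and so clears the row off the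
  diagonal; all orthogonality relations come from here.\<close>

lemma form_deficit:
  assumes "cyc n a"
  defines "W \<equiv> \<lambda>i j. (if i = j then 4 else 0) - sq n a i j"
  shows "herm n W" "0 \<le> Re (ip n z (mv n W z))"
proof -
  note h = cycD(2)[OF assms(1)]
  show "herm n W" unfolding herm_def
  proof (intro allI impI)
    fix i j assume "i < n" "j < n"
    then show "W j i = cnj (W i j)" using sq_herm[OF h, of i j] by (auto simp: W_def)
  qed
  have "mv n W z i = 4 * z i - mv n a (mv n a z) i" if "i < n" for i
  proof -
    have "mv n W z i = (\<Sum>j<n. (if i = j then 4 * z j else 0) - sq n a i j * z j)"
      unfolding mv_def by (intro sum.cong) (auto simp: W_def algebra_simps)
    then show ?thesis using that by (simp add: sum_subtractf mv_mv)
  qed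
  then have "ip n z (mv n W z) = ip n z (\<lambda>i. 4 * z i - mv n a (mv n a z) i)"
    by (intro ip_cong) auto
  also have "\<dots> = 4 * ip n z z - ip n (mv n a z) (mv n a z)"
    unfolding ip_mv_linear ip_mv[OF h] by simp
  finally show "0 \<le> Re (ip n z (mv n W z))"
    using bounded_form_contraction[OF h cycD(3)[OF assms(1)], of z] by simp
qed

lemma mv_unit: "i < n \<Longrightarrow> mv n a (\<lambda>j. if j = i then 1 else 0) k = a k i"
  by (simp add: mv_def if_distrib cong: if_cong)

lemma ip_unit: "i < n \<Longrightarrow> ip n (\<lambda>j. if j = i then 1 else 0) w = w i"
proof -
  assume "i < n"
  have "ip n (\<lambda>j. if j = i then 1 else 0) w = (\<Sum>j<n. if j = i then w j else 0)"
    unfolding ip_def by (intro sum.cong) auto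
  then show ?thesis using \<open>i < n\<close> by simp
qed

lemma rowsq_le:
  assumes "cyc n a" "i < n" shows "rowsq n a i \<le> 4"
proof -
  have "0 \<le> Re (ip n (\<lambda>j. if j = i then 1 else 0) (mv n (\<lambda>i j. (if i = j then 4 else 0) - sq n a i j) (\<lambda>j. if j = i then 1 else 0)))"
    by (rule form_deficit[OF assms(1)])
  then show ?thesis
    using assms(2) sq_diag[OF cycD(2)[OF assms(1)]] by (simp add: ip_unit mv_unit)
qed

lemma sq_zero:
  assumes "cyc n a" "i < n" "rowsq n a i = 4" "j < n" "j \<noteq> i" shows "sq n a j i = 0"
proof -
  let ?W = "\<lambda>i j. (if i = j then 4 else 0) - sq n a i j"
  have "mv n ?W (\<lambda>j. if j = i then 1 else 0) j = 0"
  proof (rule form_kernel[OF form_deficit[OF assms(1)]])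
    show "Re (ip n (\<lambda>j. if j = i then 1 else 0) (mv n ?W (\<lambda>j. if j = i then 1 else 0))) = 0"
      using assms sq_diag[OF cycD(2)[OF assms(1)]] by (simp add: ip_unit mv_unit)
  qed fact
  then show ?thesis using assms by (simp add: mv_unit)
qed

text \<open>With q = e_i the new column is a column of 4 - A^2, with entry 4 - 3 = 1 at i. If t is
  the pairing of A q with c, the corner conditions read 2 - t <= 2 + d and 2 + t <= 2 - d, so d = -t
  is forced. It is admissible because t is a real Eisenstein integer.\<close>

lemma rowsq_3_extendable:
  assumes a: "cyc n a" and i: "i < n" and r: "rowsq n a i = 3"
  shows "extendable n a"
proof -
  note h = cycD(2)[OF a]
  let ?q = "\<lambda>j. if j = i then 1 else 0 :: complex"
  define p where "p = mv n a ?q"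
  define c where "c = (\<lambda>j. 4 * ?q j - mv n a p j)"
  have cj: "c j = 4 * ?q j - sq n a j i" if "j < n" for j
    unfolding c_def p_def mv_mv using i by (simp add: if_distrib cong: if_cong)
  have pj: "p j = a j i" for j unfolding p_def using i by (simp add: mv_unit)
  have ci: "c i = 1" using sq_diag[OF h i] r by (simp add: cj i)
  have cE: "c j \<in> eisenstein_ints" if "j < n" for j
  proof -
    have "sq n a j i \<in> eisenstein_ints" unfolding sq_def
      using cycD(1)[OF a] that i by (intro eis_sum eis_mult) auto
    moreover have "4 * ?q j \<in> eisenstein_ints"
      using eis_of_int[of 4] by auto
    ultimately show ?thesis unfolding cj[OF that] by (rule eis_diff[rotated])
  qed
  have "ip n p c \<in> eisenstein_ints" unfolding ip_def
    using cycD(1)[OF a] cE i by (intro eis_sum eis_mult eis_cnj) (auto simp: pj)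
  moreover have "Im (ip n p c) = 0"
  proof -
    have "ip n p c = 4 * ip n ?q (mv n a ?q) - ip n p (mv n a p)"
      unfolding c_def ip_mv_linear p_def ip_mv[OF h] by simp
    then show ?thesis using ip_mv_real[OF h] by simp
  qed
  ultimately obtain d where d: "ip n p c = of_int d" using eis_real by blast
  have "ip n ?q c = 1" using i by (simp add: ip_unit ci)
  then show ?thesis
    by (intro extendableI[OF a p_def c_def cE i, where d = "-d"]) (auto simp: ci d)
qed

text \<open>Each cross term is at most the mean of two squares, and Hermitian symmetry turns the
  half that is summed along columns back into rows.\<close>

lemma gershgorin:
  assumes h: "herm n a" and r: "\<And>i. i < n \<Longrightarrow> (\<Sum>j<n. cmod (a i j)) \<le> 2"
  shows "\<bar>Re (ip n z (mv n a z))\<bar> \<le> 2 * Re (ip n z z)"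
proof -
  have "\<bar>Re (ip n z (mv n a z))\<bar> \<le> cmod (ip n z (mv n a z))" by (rule abs_Re_le_cmod)
  also have "\<dots> = cmod (\<Sum>i<n. \<Sum>j<n. cnj (z i) * (a i j * z j))"
    by (simp add: ip_def mv_def sum_distrib_left)
  also have "\<dots> \<le> (\<Sum>i<n. \<Sum>j<n. cmod (a i j) * (((cmod (z i))\<^sup>2 + (cmod (z j))\<^sup>2) / 2))"
  proof (intro sum_norm_le)
    fix i j
    have "cmod (z i) * cmod (z j) \<le> ((cmod (z i))\<^sup>2 + (cmod (z j))\<^sup>2) / 2"
      using sum_squares_bound[of "cmod (z i)" "cmod (z j)"] by simp
    then have "cmod (a i j) * (cmod (z i) * cmod (z j)) \<le> cmod (a i j) * (((cmod (z i))\<^sup>2 + (cmod (z j))\<^sup>2) / 2)"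
      by (rule mult_left_mono) simp
    then show "cmod (cnj (z i) * (a i j * z j)) \<le> cmod (a i j) * (((cmod (z i))\<^sup>2 + (cmod (z j))\<^sup>2) / 2)"
      by (simp add: norm_mult mult_ac)
  qed
  also have "\<dots> = (\<Sum>i<n. \<Sum>j<n. cmod (a i j) * (cmod (z i))\<^sup>2 / 2) + (\<Sum>i<n. \<Sum>j<n. cmod (a i j) * (cmod (z j))\<^sup>2 / 2)"
    by (simp only: sum.distrib[symmetric]) (intro sum.cong refl, simp add: field_simps)
  also have "(\<Sum>i<n. \<Sum>j<n. cmod (a i j) * (cmod (z j))\<^sup>2 / 2) = (\<Sum>j<n. \<Sum>i<n. cmod (a i j) * (cmod (z j))\<^sup>2 / 2)"
    by (rule sum.swap)
  also have "\<dots> = (\<Sum>j<n. \<Sum>i<n. cmod (a j i) * (cmod (z j))\<^sup>2 / 2)"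
  proof (intro sum.cong refl)
    fix i j assume "i \<in> {..<n}" "j \<in> {..<n}"
    then show "cmod (a i j) * (cmod (z j))\<^sup>2 / 2 = cmod (a j i) * (cmod (z j))\<^sup>2 / 2"
      using hermD[OF h, of i j] by simp
  qed
  also have "(\<Sum>i<n. \<Sum>j<n. cmod (a i j) * (cmod (z i))\<^sup>2 / 2) + \<dots> = (\<Sum>i<n. (\<Sum>j<n. cmod (a i j)) * (cmod (z i))\<^sup>2)"
    by (simp only: sum.distrib[symmetric] sum_distrib_right field_sum_of_halves)
  also have "\<dots> \<le> (\<Sum>i<n. 2 * (cmod (z i))\<^sup>2)"
    by (intro sum_mono mult_right_mono r) auto
  also have "\<dots> = 2 * Re (ip n z z)" by (simp add: ip_self sum_distrib_left)
  finally show ?thesis .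
qed

text \<open>If no row exceeds the Gershgorin bound, a vertex of charge 1 can be doubled: the Gram vector
  of the copy with respect to \<open>2 - A\<close> is the negative of the original one.\<close>

lemma twin_extendable:
  assumes a: "cyc n a" and r: "\<And>i. i < n \<Longrightarrow> (\<Sum>j<n. cmod (a i j)) \<le> 2"
    and v: "v < n" "a v v = 1"
  shows "extendable n a"
proof -
  note h = cycD(2)[OF a] and b = cycD(3)[OF a]
  let ?e = "\<lambda>j. if j = v then 1 else 0 :: complex"
  define c where "c = (\<lambda>j. 2 * ?e j - mv n a ?e j)"
  have cj: "c j = 2 * ?e j - a j v" for j unfolding c_def using v by (simp add: mv_unit)
  have cv: "c v = 1" using v by (simp add: cj)
  have cE: "c j \<in> eisenstein_ints" if "j < n" for j
    unfolding cj using eis_of_int[of 2] cycD(1)[OF a that v(1)] by (auto intro!: eis_diff)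
  have zc: "ip n z c = 2 * ip n z ?e - ip n z (mv n a ?e)" for z
    unfolding c_def by (simp add: ip_mv_linear)
  have zc': "Re (cnj k * ip n c z) = Re (k * ip n z c)" for k z
    by (metis ip_cnj complex_cnj_mult complex_cnj_cnj complex_cnj(1) complex.sel(1) cnj.simps(1))
  have cz: "ip n c z = 2 * ip n ?e z - ip n (mv n a ?e) z" for z
    unfolding c_def by (simp add: ip_mv_linear)
  have ee: "ip n ?e ?e = 1" "ip n ?e (mv n a ?e) = 1" "ip n (mv n a ?e) ?e = 1"
    using v ip_mv[OF h, of ?e ?e] by (simp_all add: ip_unit mv_unit)
  have form: "2 * Re (ip n w w) - Re (ip n w (mv n a w)) =
      2 * Re (ip n z z) - Re (ip n z (mv n a z)) - 2 * Re (k * ip n z c) + (cmod k)\<^sup>2"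
    if w: "w = (\<lambda>i. z i - k * ?e i)" for w z k
  proof -
    have "2 * ip n w w - ip n w (mv n a w) = 2 * ip n z z - ip n z (mv n a z) - k * ip n z c
        - cnj k * ip n c z + cnj k * k"
      unfolding w ip_mv_linear zc cz ee ip_mv[OF h, of ?e z] by (simp add: algebra_simps)
    then show ?thesis using zc'[of k z] cnj_mult_self[of k] by (simp add: complex_eq_iff)
  qed
  have low: "2 * (cmod (w v))\<^sup>2 \<le> 2 * Re (ip n w w) + Re (ip n w (mv n a w))" for w
  proof -
    \<comment> \<open>Turning the charge at v from 1 into -1 leaves the absolute row sums alone. The
      Gershgorin bound for \<open>a'\<close> therefore improves the one for 2 + A by 2 |w
      v|^2.\<close>
    define a' where "a' = (\<lambda>i j. a i j - (if i = v \<and> j = v then 2 else 0))"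
    have "herm n a'" unfolding herm_def
    proof (intro allI impI)
      fix i j assume "i < n" "j < n"
      then show "a' j i = cnj (a' i j)" using hermD[OF h, of i j] by (auto simp: a'_def)
    qed
    moreover have "(\<Sum>j<n. cmod (a' i j)) \<le> 2" if "i < n" for i
    proof -
      have "cmod (a' i j) = cmod (a i j)" for j using v by (auto simp: a'_def)
      then show ?thesis using r[OF that] by simp
    qed
    ultimately have "\<bar>Re (ip n w (mv n a' w))\<bar> \<le> 2 * Re (ip n w w)" by (rule gershgorin)
    moreover have "ip n w (mv n a' w) = ip n w (mv n a w) - 2 * (cnj (w v) * w v)"
    proof -
      have "mv n a' w i = mv n a w i - 2 * w v * ?e i" for i
      proof -
        have "mv n a' w i = (\<Sum>j<n. a i j * w j - (if j = v then 2 * w v * ?e i else 0))"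
          unfolding mv_def by (intro sum.cong) (auto simp: a'_def algebra_simps)
        then show ?thesis using v by (simp add: sum_subtractf mv_def)
      qed
      then have "ip n w (mv n a' w) = ip n w (\<lambda>i. mv n a w i - (2 * w v) * ?e i)" by (intro ip_cong) auto
      also have "\<dots> = ip n w (mv n a w) - 2 * w v * ip n w ?e" by (simp only: ip_mv_linear)
      also have "ip n w ?e = cnj (w v)" using ip_unit[OF v(1), of w] ip_cnj[of n ?e w] by simp
      finally show ?thesis by (simp add: mult_ac)
    qed
    ultimately show ?thesis unfolding cnj_mult_self by simp
  qed
  have split: "Re (ip n z z) = (cmod (z v))\<^sup>2 + (\<Sum>i\<in>{..<n}-{v}. (cmod (z i))\<^sup>2)" for z
    unfolding ip_self using v by (simp add: sum.remove[of "{..<n}" v])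
  have "cyc (Suc n) (ext n a c (of_int 1))"
  proof (rule cyc_extI[OF a cE])
    fix z :: "nat \<Rightarrow> complex" and k
    define w where "w = (\<lambda>i. z i - k * ?e i)"
    note f = form[OF w_def]
    have "0 \<le> 2 * Re (ip n w w) - Re (ip n w (mv n a w))"
      using b[unfolded bounded_form_def abs_le_iff, THEN spec, of w] by linarith
    then show "0 \<le> 2 * Re (ip n z z) - Re (ip n z (mv n a z)) - 2 * Re (k * ip n z c) + (2 - of_int 1) * (cmod k)\<^sup>2"
      using f by simp
    have "w v = z v - k" by (simp add: w_def)
    moreover have "(\<Sum>i\<in>{..<n}-{v}. (cmod (w i))\<^sup>2) = (\<Sum>i\<in>{..<n}-{v}. (cmod (z i))\<^sup>2)"
      by (intro sum.cong) (auto simp: w_def)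
    moreover have "(cmod (z v - k))\<^sup>2 \<le> 2 * (cmod (z v))\<^sup>2 + 2 * (cmod k)\<^sup>2"
    proof -
      have "(cmod (z v - k))\<^sup>2 \<le> (cmod (z v) + cmod k)\<^sup>2"
        by (intro power_mono norm_triangle_ineq4) auto
      also have "\<dots> \<le> 2 * (cmod (z v))\<^sup>2 + 2 * (cmod k)\<^sup>2"
        using sum_squares_bound[of "cmod (z v)" "cmod k"] by (simp add: power2_sum)
      finally show ?thesis .
    qed
    \<comment> \<open>After inserting \<open>f\<close> and \<open>low\<close> the claim is 4 |z v|^2
      + 4 |k|^2 >= 2 |z v - k|^2.\<close>
    ultimately show "0 \<le> 2 * Re (ip n z z) + Re (ip n z (mv n a z)) + 2 * Re (k * ip n z c) + (2 + of_int 1) * (cmod k)\<^sup>2"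
      using f low[of w] split[of w] split[of z] by simp
  qed
  then show ?thesis using v cv unfolding extendable_def by (metis zero_neq_one)
qed

section \<open>Matrices and entry functions\<close>

lemma mat_adjoint_dim [simp]: "dim_row (mat_adjoint A) = dim_col A" "dim_col (mat_adjoint A) = dim_row A"
  by (simp_all add: mat_adjoint_def)

lemma mat_adjoint_index:
  fixes A :: "complex mat"
  shows "i < dim_col A \<Longrightarrow> j < dim_row A \<Longrightarrow> mat_adjoint A $$ (i, j) = cnj (A $$ (j, i))"
  by (simp add: mat_adjoint_def mat_of_rows_def)

lemma cyclotomic_matD:
  assumes "cyclotomic_mat A"
  defines "n \<equiv> dim_row A"
  shows "A \<in> carrier_mat n n"
    "\<And>i j. i < n \<Longrightarrow> j < n \<Longrightarrow> A $$ (i, j) \<in> eisenstein_ints"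
    "herm n (\<lambda>i j. A $$ (i, j))"
proof -
  have c: "A \<in> carrier_mat n n" and e: "elements_mat A \<subseteq> eisenstein_ints" and h: "mat_adjoint A = A"
    using assms by (simp_all add: cyclotomic_mat_def eisenstein_mat_def hermitian_mat_def)
  show "A \<in> carrier_mat n n" by fact
  show "A $$ (i, j) \<in> eisenstein_ints" if "i < n" "j < n" for i j
    using e that c by (auto simp: subset_iff intro!: elements_matI[of A n n])
  show "herm n (\<lambda>i j. A $$ (i, j))" unfolding herm_def
  proof (intro allI impI)
    fix i j assume "i < n" "j < n"
    then show "A $$ (j, i) = cnj (A $$ (i, j))"
      using mat_adjoint_index[of j A i] c h by auto
  qed
qed

lemma mv_mult_mat_vec:
  assumes "A \<in> carrier_mat n n" "i < n"
  shows "(A *\<^sub>v vec n z) $ i = mv n (\<lambda>i j. A $$ (i, j)) z i"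
  using assms by (auto simp: mult_mat_vec_def scalar_prod_def mv_def lessThan_atLeast0 intro!: sum.cong)

lemma eigenvalue_of_mv:
  assumes "A \<in> carrier_mat n n" "\<exists>i<n. z i \<noteq> 0"
    and "\<And>i. i < n \<Longrightarrow> mv n (\<lambda>i j. A $$ (i, j)) z i = M * z i"
  shows "eigenvalue A M"
proof -
  have "vec n z \<noteq> 0\<^sub>v n"
  proof
    assume "vec n z = 0\<^sub>v n"
    then have "vec n z $ i = 0" if "i < n" for i using that by simp
    then show False using assms(2) by auto
  qed
  moreover have "A *\<^sub>v vec n z = M \<cdot>\<^sub>v vec n z"
    using assms(1,3) by (intro eq_vecI) (auto simp del: index_mult_mat_vec simp: mv_mult_mat_vec)
  ultimately show ?thesis using assms(1)
    unfolding eigenvalue_def eigenvector_def by (intro exI[of _ "vec n z"]) auto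
qed

lemma mv_uminus: "mv n (\<lambda>i j. - a i j) z i = - mv n a z i"
  by (simp add: mv_def sum_negf)

lemma ip_uminus: "ip n u (\<lambda>i. - v i) = - ip n u v"
  by (simp add: ip_def sum_negf)

lemma herm_uminus: "herm n (\<lambda>i j. - a i j) \<longleftrightarrow> herm n a"
  unfolding herm_def by (metis complex_cnj_minus neg_equal_iff_equal)

lemma form_uminus: "ip n z (mv n (\<lambda>i j. - a i j) z) = - ip n z (mv n a z)"
  using ip_cong[of n z z "mv n (\<lambda>i j. - a i j) z" "\<lambda>i. - mv n a z i"]
  by (simp add: mv_uminus ip_uminus)

lemma cyclotomic_mat_cyc:
  assumes A: "cyclotomic_mat A"
  shows "cyc (dim_row A) (\<lambda>i j. A $$ (i, j))"
proof -
  let ?n = "dim_row A" and ?a = "\<lambda>i j. A $$ (i, j)"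
  note d = cyclotomic_matD[OF A]
  have ev: "eigenvalue A (of_real M) \<Longrightarrow> -2 \<le> M \<and> M \<le> 2" for M
    using A by (auto simp: cyclotomic_mat_def)
  have up: "Re (ip ?n z (mv ?n ?a z)) \<le> 2 * Re (ip ?n z z)" for z
    by (rule form_le_of_eigenvalues[OF d(3)]) (use ev eigenvalue_of_mv[OF d(1)] in blast)
  have lo: "Re (ip ?n z (mv ?n (\<lambda>i j. - ?a i j) z)) \<le> 2 * Re (ip ?n z z)" for z
  proof (rule form_le_of_eigenvalues)
    show "herm ?n (\<lambda>i j. - ?a i j)" using d(3) by (simp only: herm_uminus)
    fix M z assume z: "\<exists>i<?n. z i \<noteq> 0" "\<And>i. i < ?n \<Longrightarrow> mv ?n (\<lambda>i j. - ?a i j) z i = complex_of_real M * z i"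
    have "mv ?n ?a z i = complex_of_real (- M) * z i" if "i < ?n" for i
      using z(2)[OF that] by (simp add: mv_uminus minus_equation_iff[of "mv ?n ?a z i"])
    then show "M \<le> 2" using ev[of "-M"] eigenvalue_of_mv[OF d(1) z(1)] by fastforce
  qed
  have "bounded_form ?n ?a" unfolding bounded_form_def abs_le_iff
    using up lo unfolding form_uminus by simp
  then show ?thesis using d unfolding cyc_def by blast
qed

lemma cyc_cyclotomic_mat:
  assumes a: "cyc n a"
  shows "cyclotomic_mat (mat n n (\<lambda>(i, j). a i j))" (is "cyclotomic_mat ?A")
  unfolding cyclotomic_mat_def
proof (intro conjI allI impI)
  show "eisenstein_mat (dim_row ?A) ?A"
    using cycD(1)[OF a] by (auto simp: eisenstein_mat_def dest!: elements_matD)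
  show "hermitian_mat ?A" unfolding hermitian_mat_def
  proof (rule eq_matI)
    fix i j assume "i < dim_row ?A" "j < dim_col ?A"
    then show "mat_adjoint ?A $$ (i, j) = ?A $$ (i, j)"
      using hermD[OF cycD(2)[OF a], of j i] by (simp add: mat_adjoint_index)
  qed auto
  fix x assume "eigenvalue ?A x"
  then obtain v where v: "v \<in> carrier_vec n" "v \<noteq> 0\<^sub>v n" "?A *\<^sub>v v = x \<cdot>\<^sub>v v"
    unfolding eigenvalue_def eigenvector_def by auto
  define z where "z = (\<lambda>i. v $ i)"
  have vz: "v = vec n z" using v(1) by (auto simp: z_def)
  have eq: "mv n a z i = x * z i" if "i < n" for i
  proof -
    have "mv n (\<lambda>i j. ?A $$ (i, j)) z i = (x \<cdot>\<^sub>v v) $ i"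
      by (metis mv_mult_mat_vec mat_carrier that v(3) vz)
    moreover have "mv n (\<lambda>i j. ?A $$ (i, j)) z i = mv n a z i"
      using that by (intro mv_cong) auto
    ultimately show ?thesis using that v(1) by (simp add: z_def)
  qed
  define N where "N = Re (ip n z z)"
  have "N \<noteq> 0"
  proof
    assume "N = 0"
    then have "\<forall>i<n. z i = 0" by (simp add: N_def ip_self sum_nonneg_eq_0_iff)
    then have "v = 0\<^sub>v n" unfolding vz by auto
    with v show False by simp
  qed
  then have N: "N > 0" using ip_self_nonneg[of n z] by (simp add: N_def)
  have NN: "ip n z z = of_real N" by (simp add: N_def ip_self)
  have f: "ip n z (mv n a z) = x * of_real N"
  proof -
    have "ip n z (mv n a z) = ip n z (\<lambda>i. x * z i)" by (rule ip_cong) (auto simp: eq)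
    then show ?thesis by (simp add: ip_mv_linear NN)
  qed
  have "Im x = 0" using ip_mv_real[OF cycD(2)[OF a], of z] N by (simp add: f)
  moreover have "\<bar>Re x * N\<bar> \<le> 2 * N"
    using cycD(3)[OF a, unfolded bounded_form_def, THEN spec, of z] unfolding f NN by simp
  then have "\<bar>Re x\<bar> \<le> 2" using N by (simp add: abs_mult)
  ultimately show "x \<in> complex_of_real ` {-2..2}"
    by (intro image_eqI[of _ _ "Re x"]) (auto simp: complex_eq_iff)
qed

text \<open>Connectedness in terms of closed sets instead of paths: every later use exhibits a set
  of vertices closed under adjacency and concludes that it is everything.\<close>

definition conn :: "nat \<Rightarrow> (nat \<Rightarrow> nat \<Rightarrow> complex) \<Rightarrow> bool" where
  "conn n a \<longleftrightarrow> (\<forall>C. C \<subseteq> {..<n} \<longrightarrow> C \<noteq> {} \<longrightarrow> (\<forall>x\<in>C. \<forall>y<n. a x y \<noteq> 0 \<longrightarrow> y \<in> C) \<longrightarrow> C = {..<n})"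

lemma connD:
  assumes "conn n a" "x0 \<in> C" "\<And>x. x \<in> C \<Longrightarrow> x < n"
    and "\<And>x y. x \<in> C \<Longrightarrow> y < n \<Longrightarrow> a x y \<noteq> 0 \<Longrightarrow> y \<in> C"
  shows "C = {..<n}"
  using assms unfolding conn_def by blast

lemma indecomposable_conn:
  assumes "indecomposable_mat A"
  shows "conn (dim_row A) (\<lambda>i j. A $$ (i, j))"
  unfolding conn_def
proof (intro allI impI)
  fix C assume C: "C \<subseteq> {..<dim_row A}" "C \<noteq> {}"
    and cl: "\<forall>x\<in>C. \<forall>y<dim_row A. A $$ (x, y) \<noteq> 0 \<longrightarrow> y \<in> C"
  obtain x where x: "x \<in> C" using C by auto
  have "v \<in> C" if "v < dim_row A" for v
  proof -
    have "(x, v) \<in> (underlying_edges A)\<^sup>*"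
      using assms x C that by (auto simp: indecomposable_mat_def)
    then show ?thesis
      by (induction rule: rtrancl_induct) (use x cl in \<open>auto simp: underlying_edges_def\<close>)
  qed
  then show "C = {..<dim_row A}" using C by auto
qed

lemma pick_initial: "i < n \<Longrightarrow> pick {0..<n} i = i"
proof (induction i)
  case 0
  then show ?case by (simp add: Least_equality)
next
  case (Suc i)
  then have "pick {0..<n} i = i" by simp
  have "(LEAST a. a \<in> {0..<n} \<and> i < a) = Suc i"
    by (rule Least_equality) (use Suc.prems in auto)
  then show ?case using \<open>pick {0..<n} i = i\<close> by simp
qed

text \<open>The bordered matrix contains A on its first indices, and the nonzero border entry joins
  the new vertex to an already connected graph.\<close>

lemma maximal_not_extendable:
  assumes "maximal_indecomposable_cyclotomic_mat A"
  shows "\<not> extendable (dim_row A) (\<lambda>i j. A $$ (i, j))"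
proof
  let ?n = "dim_row A" and ?a = "\<lambda>i j. A $$ (i, j)"
  have A: "cyclotomic_mat A" "indecomposable_mat A"
    using assms by (auto simp: maximal_indecomposable_cyclotomic_mat_def)
  have car: "A \<in> carrier_mat ?n ?n" by (rule cyclotomic_matD[OF A(1)])
  assume "extendable ?n ?a"
  then obtain c d i0 where i0: "i0 < ?n" "c i0 \<noteq> 0" and cyc: "cyc (Suc ?n) (ext ?n ?a c d)"
    unfolding extendable_def by blast
  define B where "B = mat (Suc ?n) (Suc ?n) (\<lambda>(i, j). ext ?n ?a c d i j)"
  have B: "cyclotomic_mat B" unfolding B_def by (rule cyc_cyclotomic_mat[OF cyc])
  have sub: "underlying_edges A \<subseteq> underlying_edges B"
    by (auto simp: underlying_edges_def B_def ext_def)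
  have e: "(i0, ?n) \<in> underlying_edges B" "(?n, i0) \<in> underlying_edges B"
    using i0 by (auto simp: underlying_edges_def B_def ext_def)
  have p: "(u, v) \<in> (underlying_edges B)\<^sup>*" if "u < ?n" "v < ?n" for u v
    using A(2) that rtrancl_mono[OF sub] by (auto simp: indecomposable_mat_def)
  have "(u, v) \<in> (underlying_edges B)\<^sup>*" if "u < Suc ?n" "v < Suc ?n" for u v
  proof (cases "u = ?n"; cases "v = ?n")
    assume "u = ?n" "v \<noteq> ?n"
    then show ?thesis using that e(2) p[OF i0(1), of v] converse_rtrancl_into_rtrancl by fastforce
  next
    assume "u \<noteq> ?n" "v = ?n"
    then show ?thesis using that e(1) p[OF _ i0(1), of u] rtrancl_into_rtrancl by fastforce
  qed (use that p in auto)
  then have indB: "indecomposable_mat B" by (simp add: indecomposable_mat_def B_def)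
  have "A = submatrix B {0..<?n} {0..<?n}"
  proof (rule eq_matI)
    have "{i. i < Suc ?n \<and> i \<in> {0..<?n}} = {0..<?n}" by auto
    then have cd: "card {i. i < Suc ?n \<and> i \<in> {0..<?n}} = ?n" by simp
    show "dim_row A = dim_row (submatrix B {0..<?n} {0..<?n})"
      "dim_col A = dim_col (submatrix B {0..<?n} {0..<?n})"
      using carrier_matD(2)[OF car] cd by (simp_all add: dim_submatrix B_def)
    fix i j assume "i < dim_row (submatrix B {0..<?n} {0..<?n})" "j < dim_col (submatrix B {0..<?n} {0..<?n})"
    then have ij: "i < card {i. i < Suc ?n \<and> i \<in> {0..<?n}}" "j < card {i. i < Suc ?n \<and> i \<in> {0..<?n}}"
      by (simp_all add: dim_submatrix B_def)
    then have ij': "i < ?n" "j < ?n" unfolding cd .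
    have "submatrix B {0..<?n} {0..<?n} $$ (i, j) = B $$ (pick {0..<?n} i, pick {0..<?n} j)"
      by (rule submatrix_index) (use ij in \<open>simp_all add: B_def\<close>)
    then show "A $$ (i, j) = submatrix B {0..<?n} {0..<?n} $$ (i, j)"
      using ij' by (simp add: pick_initial B_def ext_def)
  qed
  then have "proper_principal_submatrix A B"
    unfolding proper_principal_submatrix_def by (intro exI[of _ "{0..<?n}"]) (auto simp: B_def)
  then show False using assms B indB by (auto simp: maximal_indecomposable_cyclotomic_mat_def)
qed

section \<open>Switching equivalence\<close>

definition unit :: "complex \<Rightarrow> bool" where
  "unit x \<longleftrightarrow> x \<in> eisenstein_ints \<and> cmod x = 1"

lemma unit_1 [simp, intro]: "unit 1" "unit (-1)"
  using eis_uminus[OF eis_01(2)] by (auto simp: unit_def)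

lemma unit_mult [intro]: "unit x \<Longrightarrow> unit y \<Longrightarrow> unit (x * y)"
  by (auto simp: unit_def norm_mult)

lemma unit_cnj [intro]: "unit x \<Longrightarrow> unit (cnj x)"
  by (auto simp: unit_def)

lemma unit_uminus [intro]: "unit x \<Longrightarrow> unit (- x)"
  by (auto simp: unit_def)

lemma unit_cnj_mult: "unit x \<Longrightarrow> cnj x * x = 1" "unit x \<Longrightarrow> x * cnj x = 1"
  using cnj_mult_self[of x] by (simp_all add: unit_def mult.commute)

lemma unit_nz: "unit x \<Longrightarrow> x \<noteq> 0"
  by (auto simp: unit_def)

text \<open>Equivalence by a monomial matrix: a relabelling, a diagonal of units, a sign and
  possibly conjugation. The classification produces only equivalences of this kind.\<close>

definition graph_iso :: "nat \<Rightarrow> (nat \<Rightarrow> nat \<Rightarrow> complex) \<Rightarrow> 'v rgraph \<Rightarrow> bool" where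
  "graph_iso n a G \<longleftrightarrow> (\<exists>\<phi> g s \<sigma>. bij_betw \<phi> (fst G) {..<n} \<and> (\<forall>v\<in>fst G. unit (g v)) \<and>
     s \<in> {1, -1} \<and> \<sigma> \<in> {id, cnj} \<and>
     (\<forall>u\<in>fst G. \<forall>v\<in>fst G. a (\<phi> u) (\<phi> v) = s * \<sigma> (g u * snd G u v * cnj (g v))))"

lemma graph_iso_switch:
  assumes h: "\<And>i. i < n \<Longrightarrow> unit (h i)"
    and iso: "graph_iso n (\<lambda>i j. h i * a i j * cnj (h j)) G"
  shows "graph_iso n a G"
proof -
  from iso obtain \<phi> g s \<sigma> where b: "bij_betw \<phi> (fst G) {..<n}" and g: "\<forall>v\<in>fst G. unit (g v)"
    and s: "s \<in> {1, -1}" "\<sigma> \<in> {id, cnj}"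
    and e: "\<And>u v. u \<in> fst G \<Longrightarrow> v \<in> fst G \<Longrightarrow>
      h (\<phi> u) * a (\<phi> u) (\<phi> v) * cnj (h (\<phi> v)) = s * \<sigma> (g u * snd G u v * cnj (g v))"
    unfolding graph_iso_def by blast
  \<comment> \<open>\<open>g\<close> sits inside \<open>\<sigma>\<close>, so the inverse switching
    has to pass through \<open>\<sigma>\<close> before it can be absorbed.\<close>
  define g' where "g' = (\<lambda>v. \<sigma> (cnj (h (\<phi> v))) * g v)"
  have un: "unit (h (\<phi> v))" if "v \<in> fst G" for v
    using b that by (intro h) (auto simp: bij_betw_def)
  have "unit (g' v)" if "v \<in> fst G" for v
    using un[OF that] bspec[OF g that] s(2) unfolding g'_def
    by (auto intro!: unit_mult unit_cnj)
  moreover have "a (\<phi> u) (\<phi> v) = s * \<sigma> (g' u * snd G u v * cnj (g' v))" if uv: "u \<in> fst G" "v \<in> fst G" for u v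
  proof -
    have "a (\<phi> u) (\<phi> v) = (cnj (h (\<phi> u)) * h (\<phi> u)) * a (\<phi> u) (\<phi> v) * (cnj (h (\<phi> v)) * h (\<phi> v))"
      using un uv by (simp add: unit_cnj_mult)
    also have "\<dots> = cnj (h (\<phi> u)) * (s * \<sigma> (g u * snd G u v * cnj (g v))) * h (\<phi> v)"
      unfolding e[OF uv, symmetric] by (simp add: mult_ac)
    also have "\<dots> = s * \<sigma> (g' u * snd G u v * cnj (g' v))"
      using s(2) by (auto simp: g'_def mult_ac)
    finally show ?thesis .
  qed
  ultimately show ?thesis using b s unfolding graph_iso_def by blast
qed

lemma graph_iso_neg:
  assumes "graph_iso n (\<lambda>i j. - a i j) G" shows "graph_iso n a G"
proof -
  from assms obtain \<phi> g s \<sigma> where b: "bij_betw \<phi> (fst G) {..<n}" and g: "\<forall>v\<in>fst G. unit (g v)"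
    and s: "s \<in> {1, -1}" "\<sigma> \<in> {id, cnj}"
    and e: "\<And>u v. u \<in> fst G \<Longrightarrow> v \<in> fst G \<Longrightarrow> - a (\<phi> u) (\<phi> v) = s * \<sigma> (g u * snd G u v * cnj (g v))"
    unfolding graph_iso_def by blast
  have "a (\<phi> u) (\<phi> v) = (- s) * \<sigma> (g u * snd G u v * cnj (g v))" if "u \<in> fst G" "v \<in> fst G" for u v
    using e[OF that] by (metis mult_minus_left add.inverse_inverse)
  moreover have "- s \<in> {1, -1}" using s by auto
  ultimately show ?thesis using b g s(2) unfolding graph_iso_def by blast
qed

text \<open>The relabelling is absorbed into the enumeration of the vertices, via the inverse of
  \<open>\<phi>\<close>, which leaves a diagonal unitary matrix. Integrality of the graph matrix is
  inherited from A, since sign, conjugation and units can all be undone.\<close>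

lemma graph_iso_equivalent:
  assumes A: "eisenstein_mat n A" and iso: "graph_iso n (\<lambda>i j. A $$ (i, j)) G"
  shows "equivalent_to_graph A G"
proof -
  from iso obtain \<phi> g s \<sigma> where b: "bij_betw \<phi> (fst G) {..<n}" and g: "\<forall>v\<in>fst G. unit (g v)"
    and s: "s \<in> {1, -1}" "\<sigma> \<in> {id, cnj}"
    and e: "\<And>u v. u \<in> fst G \<Longrightarrow> v \<in> fst G \<Longrightarrow> A $$ (\<phi> u, \<phi> v) = s * \<sigma> (g u * snd G u v * cnj (g v))"
    unfolding graph_iso_def by blast
  have car: "A \<in> carrier_mat n n" and elE: "\<And>i j. i < n \<Longrightarrow> j < n \<Longrightarrow> A $$ (i, j) \<in> eisenstein_ints"
    using A by (auto simp: eisenstein_mat_def subset_iff intro!: elements_matI[of A n n])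
  define \<psi> where "\<psi> = inv_into (fst G) \<phi>"
  have \<psi>: "\<psi> i \<in> fst G" "\<phi> (\<psi> i) = i" if "i < n" for i
    using b that unfolding \<psi>_def
    by (auto simp: bij_betw_def f_inv_into_f inv_into_into)
  define vs where "vs = map \<psi> [0..<n]"
  have lvs: "length vs = n" "\<And>i. i < n \<Longrightarrow> vs ! i = \<psi> i" by (auto simp: vs_def)
  have dvs: "distinct vs"
    unfolding vs_def distinct_map by (auto intro!: inj_onI) (metis \<psi>(2))
  have svs: "set vs = fst G"
  proof
    show "set vs \<subseteq> fst G" using \<psi> by (auto simp: vs_def)
    show "fst G \<subseteq> set vs"
    proof
      fix v assume v: "v \<in> fst G"
      then have "\<phi> v < n" "\<psi> (\<phi> v) = v" using b unfolding \<psi>_def by (auto simp: bij_betw_def)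
      then show "v \<in> set vs" unfolding vs_def by (metis atLeastLessThan_iff imageI le0 set_map set_upt)
    qed
  qed
  define B where "B = mat n n (\<lambda>(i, j). snd G (\<psi> i) (\<psi> j))"
  have "adjacency_mat_of G B"
    unfolding adjacency_mat_of_def B_def
    by (intro exI[of _ vs] conjI dvs svs eq_matI) (auto simp: lvs)
  define q where "q = (\<lambda>i. g (\<psi> i))"
  have uq: "unit (q i)" if "i < n" for i using g \<psi>(1)[OF that] by (simp add: q_def)
  define Q where "Q = mat n n (\<lambda>(i, j). if i = j then q i else 0)"
  have Qa: "mat_adjoint Q = mat n n (\<lambda>(i, j). if i = j then cnj (q i) else 0)"
    by (rule eq_matI) (auto simp: mat_adjoint_index Q_def)
  have diagl: "(mat n n (\<lambda>(i, j). if i = j then f i else 0) * M) $$ (i, j) = f i * M $$ (i, j)"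
    if "M \<in> carrier_mat n n" "i < n" "j < n" for f and M :: "complex mat" and i j
  proof -
    have "(mat n n (\<lambda>(i, j). if i = j then f i else 0) * M) $$ (i, j) = (\<Sum>k=0..<n. mat n n (\<lambda>(i, j). if i = j then f i else 0) $$ (i, k) * M $$ (k, j))"
      using that by (simp add: scalar_prod_def)
    also have "\<dots> = (\<Sum>k=0..<n. if k = i then f i * M $$ (i, j) else 0)"
      by (rule sum.cong) (use that in auto)
    finally show ?thesis using that by simp
  qed
  have diagr: "(M * mat n n (\<lambda>(i, j). if i = j then f i else 0)) $$ (i, j) = M $$ (i, j) * f j"
    if "M \<in> carrier_mat n n" "i < n" "j < n" for f and M :: "complex mat" and i j
  proof -
    have "(M * mat n n (\<lambda>(i, j). if i = j then f i else 0)) $$ (i, j) = (\<Sum>k=0..<n. M $$ (i, k) * mat n n (\<lambda>(i, j). if i = j then f i else 0) $$ (k, j))"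
      using that by (simp add: scalar_prod_def)
    also have "\<dots> = (\<Sum>k=0..<n. if k = j then M $$ (i, j) * f j else 0)"
      by (rule sum.cong) (use that in auto)
    finally show ?thesis using that by simp
  qed
  have Bc: "B \<in> carrier_mat n n" by (simp add: B_def)
  have Qc: "Q \<in> carrier_mat n n" "mat_adjoint Q \<in> carrier_mat n n"
    unfolding Qa by (simp_all add: Q_def)
  have QBQ: "(Q * B * mat_adjoint Q) $$ (i, j) = q i * snd G (\<psi> i) (\<psi> j) * cnj (q j)" if "i < n" "j < n" for i j
  proof -
    have "Q * B \<in> carrier_mat n n" using Qc Bc by simp
    then have "(Q * B * mat_adjoint Q) $$ (i, j) = (Q * B) $$ (i, j) * cnj (q j)"
      unfolding Qa by (rule diagr) (use that in auto)
    also have "(Q * B) $$ (i, j) = q i * B $$ (i, j)"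
      unfolding Q_def by (rule diagl[OF Bc that])
    finally show ?thesis using that by (simp add: B_def)
  qed
  have un: "unitary_eisenstein_mat n Q"
    unfolding unitary_eisenstein_mat_def
  proof (intro conjI)
    show "eisenstein_mat n Q"
      using uq by (auto simp: eisenstein_mat_def Q_def unit_def dest!: elements_matD)
    show "Q * mat_adjoint Q = 1\<^sub>m n"
      by (rule eq_matI, unfold Qa, subst diagr) (auto simp: Q_def unit_cnj_mult uq)
    show "mat_adjoint Q * Q = 1\<^sub>m n"
      by (rule eq_matI, unfold Qa, subst diagl) (auto simp: Q_def unit_cnj_mult uq)
  qed
  have Aij: "A $$ (i, j) = s * \<sigma> (q i * snd G (\<psi> i) (\<psi> j) * cnj (q j))" if "i < n" "j < n" for i j
    using e[of "\<psi> i" "\<psi> j"] that \<psi> by (simp add: q_def)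
  have "A = s \<cdot>\<^sub>m map_mat \<sigma> (Q * B * mat_adjoint Q)"
  proof (rule eq_matI)
    fix i j assume "i < dim_row (s \<cdot>\<^sub>m map_mat \<sigma> (Q * B * mat_adjoint Q))" "j < dim_col (s \<cdot>\<^sub>m map_mat \<sigma> (Q * B * mat_adjoint Q))"
    then have "i < n" "j < n" by (simp_all add: Q_def)
    then show "A $$ (i, j) = (s \<cdot>\<^sub>m map_mat \<sigma> (Q * B * mat_adjoint Q)) $$ (i, j)"
      using Qc by (simp add: Aij QBQ[symmetric] del: index_mult_mat(1))
  qed (use car in \<open>auto simp: Q_def\<close>)
  moreover have "eisenstein_mat n B"
  proof -
    have "snd G (\<psi> i) (\<psi> j) \<in> eisenstein_ints" if ij: "i < n" "j < n" for i j
    proof -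
      let ?x = "snd G (\<psi> i) (\<psi> j)"
      have "s * A $$ (i, j) = (s * s) * \<sigma> (q i * ?x * cnj (q j))" unfolding Aij[OF ij] by simp
      then have 1: "\<sigma> (s * A $$ (i, j)) = q i * ?x * cnj (q j)"
        using s by auto
      have "?x = (cnj (q i) * q i) * ?x * (cnj (q j) * q j)" using uq ij by (simp add: unit_cnj_mult)
      also have "\<dots> = cnj (q i) * \<sigma> (s * A $$ (i, j)) * q j" unfolding 1 by (simp add: mult_ac)
      also have "\<dots> \<in> eisenstein_ints"
        using uq[OF ij(1)] uq[OF ij(2)] elE[OF ij] s
        by (auto simp: unit_def intro!: eis_mult eis_cnj eis_uminus)
      finally show ?thesis .
    qed
    then show ?thesis by (auto simp: eisenstein_mat_def B_def dest!: elements_matD)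
  qed
  ultimately have "equivalent_mat A B"
    unfolding equivalent_mat_def using A un s by blast
  then show ?thesis using \<open>adjacency_mat_of G B\<close> unfolding equivalent_to_graph_def by blast
qed

section \<open>Switching preserves maximality\<close>

lemma cyc_cong:
  assumes "\<And>i j. i < n \<Longrightarrow> j < n \<Longrightarrow> a i j = b i j" "cyc n a"
  shows "cyc n b"
proof -
  have "ip n z (mv n b z) = ip n z (mv n a z)" for z
    by (intro ip_cong mv_cong) (auto simp: assms(1))
  then have "bounded_form n b" using cycD(3)[OF assms(2)] by (simp add: bounded_form_def)
  moreover have "herm n b"
    unfolding herm_def
  proof (intro allI impI)
    fix i j assume "i < n" "j < n"
    then show "b j i = cnj (b i j)" using hermD[OF cycD(2)[OF assms(2)], of i j] assms(1) by simp
  qed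
  ultimately show ?thesis unfolding cyc_def using cycD(1)[OF assms(2)] assms(1) by metis
qed

lemma cyc_switch:
  assumes h: "\<And>i. i < n \<Longrightarrow> unit (h i)" and a: "cyc n a"
  shows "cyc n (\<lambda>i j. h i * a i j * cnj (h j))"
  unfolding cyc_def
proof (intro conjI allI impI)
  let ?a = "\<lambda>i j. h i * a i j * cnj (h j)"
  show "?a i j \<in> eisenstein_ints" if "i < n" "j < n" for i j
    using h[OF that(1)] h[OF that(2)] cycD(1)[OF a that] by (auto simp: unit_def)
  show "herm n ?a" unfolding herm_def
  proof (intro allI impI)
    fix i j assume "i < n" "j < n"
    then show "?a j i = cnj (?a i j)" using hermD[OF cycD(2)[OF a], of i j] by simp
  qed
  show "bounded_form n ?a" unfolding bounded_form_def
  proof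
    fix z
    define w where "w = (\<lambda>i. cnj (h i) * z i)"
    have "mv n ?a z i = h i * mv n a w i" for i
      by (simp add: mv_def w_def sum_distrib_left mult_ac)
    then have "ip n z (mv n ?a z) = ip n w (mv n a w)"
      unfolding ip_def w_def by (simp add: mult_ac)
    moreover have "ip n w w = ip n z z"
      unfolding ip_def
    proof (intro sum.cong refl)
      fix i assume "i \<in> {..<n}"
      then have "h i * cnj (h i) = 1" using unit_cnj_mult h by blast
      then show "cnj (w i) * w i = cnj (z i) * z i"
        by (simp add: w_def mult.left_commute[of _ "cnj (h i)"] mult.assoc[symmetric] mult.commute[of "cnj (z i)" "h i"])
    qed
    ultimately show "\<bar>Re (ip n z (mv n ?a z))\<bar> \<le> 2 * Re (ip n z z)"
      using cycD(3)[OF a] unfolding bounded_form_def by metis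
  qed
qed

lemma cyc_neg: "cyc n a \<Longrightarrow> cyc n (\<lambda>i j. - a i j)"
  unfolding cyc_def herm_uminus bounded_form_def form_uminus by auto

lemma extendable_switch:
  assumes h: "\<And>i. i < n \<Longrightarrow> unit (h i)"
    and e: "extendable n (\<lambda>i j. h i * a i j * cnj (h j))"
  shows "extendable n a"
proof -
  let ?a = "\<lambda>i j. h i * a i j * cnj (h j)"
  from e obtain c d i0 where i0: "i0 < n" "c i0 \<noteq> 0" and c: "cyc (Suc n) (ext n ?a c d)"
    unfolding extendable_def by blast
  \<comment> \<open>The new vertex keeps the unit 1, so undoing the switching changes the border
    only by the factors \<open>cnj (h i)\<close>.\<close>
  define g where "g = (\<lambda>i. if i < n then cnj (h i) else 1)"
  have "cyc (Suc n) (\<lambda>i j. g i * ext n ?a c d i j * cnj (g j))"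
    by (rule cyc_switch[OF _ c]) (use h in \<open>auto simp: g_def\<close>)
  moreover have "g i * ext n ?a c d i j * cnj (g j) = ext n a (\<lambda>i. cnj (h i) * c i) d i j"
    if "i < Suc n" "j < Suc n" for i j
  proof -
    have inv: "cnj (h i) * (h i * a i j * cnj (h j)) * h j = a i j" if "i < n" "j < n"
    proof -
      have "cnj (h i) * (h i * a i j * cnj (h j)) * h j = (cnj (h i) * h i) * a i j * (cnj (h j) * h j)"
        by (simp add: mult_ac)
      then show ?thesis using that h by (simp add: unit_cnj_mult)
    qed
    show ?thesis using inv that by (auto simp: ext_def g_def mult.commute)
  qed
  ultimately have "cyc (Suc n) (ext n a (\<lambda>i. cnj (h i) * c i) d)"
    by (rule cyc_cong[rotated])
  moreover have "cnj (h i0) * c i0 \<noteq> 0" using i0 h unit_nz by simp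
  ultimately show ?thesis unfolding extendable_def using i0(1) by (intro exI conjI) auto
qed

lemma extendable_neg:
  assumes "extendable n (\<lambda>i j. - a i j)" shows "extendable n a"
proof -
  from assms obtain c d i0 where i0: "i0 < n" "c i0 \<noteq> 0" and c: "cyc (Suc n) (ext n (\<lambda>i j. - a i j) c d)"
    unfolding extendable_def by blast
  have "cyc (Suc n) (ext n a (\<lambda>i. - c i) (- d))"
    by (rule cyc_cong[OF _ cyc_neg[OF c]]) (auto simp: ext_def)
  then show ?thesis unfolding extendable_def using i0 by (intro exI conjI) auto
qed

section \<open>Maximal charged matrices\<close>

definition charged_max :: "nat \<Rightarrow> (nat \<Rightarrow> nat \<Rightarrow> complex) \<Rightarrow> bool" where
  "charged_max n a \<longleftrightarrow> cyc n a \<and> \<not> extendable n a \<and> conn n a \<and> (\<exists>i<n. a i i \<noteq> 0)"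

lemma charged_max_switch:
  assumes h: "\<And>i. i < n \<Longrightarrow> unit (h i)" and a: "charged_max n a"
  shows "charged_max n (\<lambda>i j. h i * a i j * cnj (h j))"
proof -
  have z: "h i * a i j * cnj (h j) \<noteq> 0 \<longleftrightarrow> a i j \<noteq> 0" if "i < n" "j < n" for i j
    using that h unit_nz by simp
  have "conn n (\<lambda>i j. h i * a i j * cnj (h j))"
    unfolding conn_def
  proof (intro allI impI)
    fix C assume C: "C \<subseteq> {..<n}" "C \<noteq> {}" "\<forall>x\<in>C. \<forall>y<n. h x * a x y * cnj (h y) \<noteq> 0 \<longrightarrow> y \<in> C"
    then have "\<forall>x\<in>C. \<forall>y<n. a x y \<noteq> 0 \<longrightarrow> y \<in> C" using z by (metis lessThan_iff subsetD)
    then show "C = {..<n}" using C(1,2) a unfolding charged_max_def conn_def by blast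
  qed
  moreover have "\<exists>i<n. h i * a i i * cnj (h i) \<noteq> 0" using a z unfolding charged_max_def by blast
  ultimately show ?thesis
    using a cyc_switch[of n h a] extendable_switch[of n h a] h unfolding charged_max_def by blast
qed

locale max_charged =
  fixes n a
  assumes charged_max: "charged_max n a"
begin

lemma cyc: "cyc n a" and nonext: "\<not> extendable n a" and conn: "conn n a" and charged: "\<exists>i<n. a i i \<noteq> 0"
  using charged_max by (auto simp: charged_max_def)

lemma eis: "i < n \<Longrightarrow> j < n \<Longrightarrow> a i j \<in> eisenstein_ints"
  using cycD(1)[OF cyc] .

lemma herm: "i < n \<Longrightarrow> j < n \<Longrightarrow> a j i = cnj (a i j)"
  using hermD[OF cycD(2)[OF cyc]] .

lemma zero_sym: "i < n \<Longrightarrow> j < n \<Longrightarrow> a j i = 0 \<longleftrightarrow> a i j = 0"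
  using herm[of i j] by simp

lemma diag_real:
  assumes "i < n" obtains k :: int where "a i i = of_int k"
  using eis_real[OF eis[OF assms assms]] herm[OF assms assms] by (auto simp: complex_eq_iff)

text \<open>The exit for configurations that no extension excludes: once they are closed under
  adjacency and uncharged, they are the whole graph, contrary to the charge.\<close>

lemma closed_charged:
  assumes "x0 \<in> C" "\<And>x. x \<in> C \<Longrightarrow> x < n" "\<And>x y. x \<in> C \<Longrightarrow> y < n \<Longrightarrow> a x y \<noteq> 0 \<Longrightarrow> y \<in> C"
    and "\<And>x. x \<in> C \<Longrightarrow> a x x = 0"
  shows False
proof -
  have "C = {..<n}" by (rule connD[OF conn assms(1)]) (use assms(2,3) in blast)+
  then show False using charged assms(4) by blast
qed

lemma norm_cases:
  assumes "i < n" "j < n"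
  shows "(cmod (a i j))\<^sup>2 \<in> {0, 1, 3, 4}"
proof -
  obtain k where k: "k \<ge> 0" "(cmod (a i j))\<^sup>2 = of_int k" "k \<noteq> 2"
    using eis_norm[OF eis[OF assms]] .
  have "(cmod (a i j))\<^sup>2 \<le> rowsq n a i"
    unfolding rowsq_def by (rule member_le_sum) (use assms in auto)
  with rowsq_le[OF cyc assms(1)] k(2) have "k \<le> 4" by linarith
  with k(1,3) have "k \<in> {0, 1, 3, 4}" by auto
  then show ?thesis unfolding k(2) by auto
qed

lemma row_bound:
  assumes "i < n" "j < n" "k < n" "j \<noteq> k"
  shows "(cmod (a i j))\<^sup>2 + (cmod (a i k))\<^sup>2 \<le> rowsq n a i"
proof -
  have "(\<Sum>l\<in>{j, k}. (cmod (a i l))\<^sup>2) \<le> rowsq n a i"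
    unfolding rowsq_def by (rule sum_mono2) (use assms in auto)
  then show ?thesis using assms(4) by simp
qed

lemma rowsq_neq_3: "i < n \<Longrightarrow> rowsq n a i \<noteq> 3"
  using rowsq_3_extendable[OF cyc] nonext by blast

text \<open>The total 3 is excluded by an extension, so the row has another nonzero entry, and below
  4 there is room for just one unit.\<close>

lemma row_norm_3:
  assumes ij: "i < n" "j < n" and N: "(cmod (a i j))\<^sup>2 = 3"
  obtains k where "k < n" "k \<noteq> j" "cmod (a i k) = 1"
    "\<And>l. l < n \<Longrightarrow> l \<noteq> j \<Longrightarrow> l \<noteq> k \<Longrightarrow> a i l = 0" "rowsq n a i = 4"
proof -
  have r: "rowsq n a i = 3 + (\<Sum>l\<in>{..<n}-{j}. (cmod (a i l))\<^sup>2)"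
    unfolding rowsq_def using ij N by (simp add: sum.remove[of "{..<n}" j])
  have "(\<Sum>l\<in>{..<n}-{j}. (cmod (a i l))\<^sup>2) \<noteq> 0" using r rowsq_neq_3[OF ij(1)] by simp
  then obtain k where "k \<in> {..<n}-{j}" and k0: "(cmod (a i k))\<^sup>2 \<noteq> 0"
    by (rule sum.not_neutral_contains_not_neutral)
  then have k: "k < n" "k \<noteq> j" "(cmod (a i k))\<^sup>2 \<noteq> 0" by auto
  have "(cmod (a i j))\<^sup>2 + (cmod (a i k))\<^sup>2 \<le> 4"
    using row_bound[OF ij k(1)] k(2) rowsq_le[OF cyc ij(1)] by fastforce
  then have k1: "(cmod (a i k))\<^sup>2 = 1" using N k(3) norm_cases[OF ij(1) k(1)] by auto
  have r': "rowsq n a i = 4 + (\<Sum>l\<in>{..<n}-{j}-{k}. (cmod (a i l))\<^sup>2)"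
    using r k k1 by (simp add: sum.remove[of "{..<n}-{j}" k])
  moreover have "0 \<le> (\<Sum>l\<in>{..<n}-{j}-{k}. (cmod (a i l))\<^sup>2)" by (intro sum_nonneg) auto
  ultimately have z: "rowsq n a i = 4" "(\<Sum>l\<in>{..<n}-{j}-{k}. (cmod (a i l))\<^sup>2) = 0"
    using rowsq_le[OF cyc ij(1)] by auto
  then have "a i l = 0" if "l < n" "l \<noteq> j" "l \<noteq> k" for l
    using that by (subst (asm) sum_nonneg_eq_0_iff) auto
  moreover have "cmod (a i k) = 1" using k1 by (simp add: power2_eq_1_iff)
    (use norm_ge_zero[of "a i k"] in linarith)
  ultimately show ?thesis using that k z by blast
qed

lemma sq_two:
  assumes "i < n" "j < n" "k < n" "j \<noteq> k" "\<And>l. l < n \<Longrightarrow> l \<noteq> j \<Longrightarrow> l \<noteq> k \<Longrightarrow> a i l = 0"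
  shows "sq n a i m = a i j * a j m + a i k * a k m"
proof -
  have "sq n a i m = (\<Sum>l\<in>{j, k}. a i l * a l m)"
    unfolding sq_def by (rule sum.mono_neutral_right) (use assms in auto)
  then show ?thesis using assms(4) by simp
qed

lemma sq_sat: "i < n \<Longrightarrow> rowsq n a i = 4 \<Longrightarrow> j < n \<Longrightarrow> j \<noteq> i \<Longrightarrow> sq n a i j = 0 \<and> sq n a j i = 0"
  using sq_zero[OF cyc] sq_herm[OF cycD(2)[OF cyc]] by (metis complex_cnj_zero)

end

text \<open>1 + omega generates the prime above 3. The norm equation gives (m - n)^2 = 3 (1 - m n),
  so 3 divides m - n, and the quotient by 1 + omega can be written down.\<close>

lemma eis_norm_3:
  assumes "x \<in> eisenstein_ints" "(cmod x)\<^sup>2 = 3"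
  obtains u where "unit u" "x = u * (1 + omega)"
proof -
  from assms obtain m n where x: "x = of_int m + of_int n * omega"
    by (auto simp: eisenstein_ints_def)
  have "(cmod x)\<^sup>2 = of_int (m\<^sup>2 + m * n + n\<^sup>2)"
    unfolding cmod_power2 x by (simp add: power2_eq_square field_simps)
  then have e: "m\<^sup>2 + m * n + n\<^sup>2 = 3" using assms(2) by (metis of_int_eq_iff of_int_numeral)
  then have "(m - n)\<^sup>2 = 3 * (1 - m * n)" by (simp add: power2_eq_square algebra_simps)
  then have "3 dvd (m - n)\<^sup>2" by simp
  then have "3 dvd m - n" by (subst (asm) prime_dvd_power_iff) auto
  then obtain k where k: "m = n + 3 * k" by (metis add_diff_cancel_left' diff_add_cancel dvdE add.commute)
  define u where "u = of_int (n + 2 * k) + of_int (- k) * omega"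
  have "u * (1 + omega) = of_int (n + 2 * k) + of_int (n + k) * omega + of_int (- k) * (omega * omega)"
    by (simp add: u_def algebra_simps)
  also have "\<dots> = x" unfolding omega_sq x k by (simp add: algebra_simps)
  finally have xu: "x = u * (1 + omega)" by simp
  have "(cmod (1 + omega))\<^sup>2 = 3" unfolding cmod_power2 by (simp add: power2_eq_square)
  then have "(cmod u)\<^sup>2 = 1" using assms(2) unfolding xu norm_mult power_mult_distrib by simp
  then have "cmod u = 1" by (simp add: power2_eq_1_iff) (use norm_ge_zero[of u] in linarith)
  moreover have "u \<in> eisenstein_ints" unfolding u_def by (rule eisI)
  ultimately show ?thesis using xu that by (simp add: unit_def)
qed

lemma graph_iso_S1:
  assumes "a 0 0 = 2 \<or> a 0 0 = - 2" shows "graph_iso 1 a graph_S1"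
  unfolding graph_iso_def
proof (intro exI conjI)
  show "bij_betw (\<lambda>_. 0) (fst graph_S1) {..<1::nat}" by (auto simp: graph_S1_def bij_betw_def)
  show "\<forall>v\<in>fst graph_S1. unit ((\<lambda>_. 1) v)" by simp
  show "(if a 0 0 = 2 then 1 else -1) \<in> {1, - 1 :: complex}" by simp
  show "id \<in> {id, cnj}" by simp
  show "\<forall>u\<in>fst graph_S1. \<forall>v\<in>fst graph_S1. a 0 0 = (if a 0 0 = 2 then 1 else - 1) * id (1 * snd graph_S1 u v * cnj 1)"
    using assms by (auto simp: graph_S1_def weight_fun_def charges_def)
qed

lemma graph_iso_S2_dagger:
  assumes ij: "{i, j} = {..<n}" "i \<noteq> j" and d: "a i i = -1" "a j j = 1"
    and u: "unit u" "a j i = u * (1 + omega)" "a i j = cnj (a j i)"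
  shows "graph_iso n a graph_S2_dagger"
  unfolding graph_iso_def
proof (intro exI conjI)
  let ?\<phi> = "\<lambda>v. if v = VA then i else j" and ?g = "\<lambda>v. if v = VA then 1 else u"
  show "bij_betw ?\<phi> (fst graph_S2_dagger) {..<n}"
    using ij by (auto simp: graph_S2_dagger_def bij_betw_def inj_on_def)
  show "\<forall>v\<in>fst graph_S2_dagger. unit (?g v)" using u by simp
  show "1 \<in> {1, - 1 :: complex}" "id \<in> {id, cnj}" by simp_all
  show "\<forall>v\<in>fst graph_S2_dagger. \<forall>w\<in>fst graph_S2_dagger. a (?\<phi> v) (?\<phi> w) = 1 * id (?g v * snd graph_S2_dagger v w * cnj (?g w))"
    using d u by (auto simp: graph_S2_dagger_def weight_fun_def charges_def edges_def unit_cnj_mult mult_ac)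
qed

context max_charged
begin

text \<open>An entry of norm 4 fills its row: on the diagonal this is S_1, off the diagonal a closed
  uncharged pair. An entry of norm 3 leaves one unit in each of its two rows. If these units are
  loops, the graph is S_2^dagger; otherwise orthogonality closes an uncharged 4-cycle with norms 3,
  1, 3, 1.\<close>

lemma unit_entries:
  assumes "\<not> graph_iso n a graph_S1" "\<not> graph_iso n a graph_S2_dagger" "i < n" "j < n" "a i j \<noteq> 0"
  shows "unit (a i j)"
proof (rule ccontr)
  assume "\<not> unit (a i j)"
  then have c: "cmod (a i j) \<noteq> 1" using eis assms(3,4) by (simp add: unit_def)
  then have "(cmod (a i j))\<^sup>2 \<noteq> 1" using norm_ge_zero[of "a i j"] by (metis abs_norm_cancel abs_square_eq_1)
  then consider (four) "(cmod (a i j))\<^sup>2 = 4" | (three) "(cmod (a i j))\<^sup>2 = 3"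
    using norm_cases[OF assms(3,4)] assms(5) by auto
  then show False
  proof cases
    case four
    have other: "a x l = 0" if "x < n" "y < n" "(cmod (a x y))\<^sup>2 = 4" "l < n" "l \<noteq> y" for x y l
    proof -
      have "(cmod (a x y))\<^sup>2 + (cmod (a x l))\<^sup>2 \<le> 4"
        using row_bound[OF that(1,2,4)] rowsq_le[OF cyc that(1)] that(5) by linarith
      then have "(cmod (a x l))\<^sup>2 \<le> 0" using that(3) by linarith
      then show ?thesis by simp
    qed
    show False
    proof (cases "i = j")
      case True
      have "{i} = {..<n}"
        by (rule connD[OF conn, of i]) (use other[OF assms(3,4) four] True assms in auto)
      then have "card {i} = card {..<n}" by simp
      then have n: "n = 1" "i = 0" using assms(3) by simp_all
      obtain k where k: "a i i = of_int k" using diag_real[OF assms(3)] .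
      have "k\<^sup>2 = 4" using four True k by (simp add: norm_of_int) (metis of_int_eq_iff of_int_numeral of_int_power)
      then have "(k - 2) * (k + 2) = 0" by (simp add: power2_eq_square algebra_simps)
      then have "k = 2 \<or> k = -2" by auto
      then show False using assms(1) graph_iso_S1[of a] k n by auto
    next
      case False
      have "cmod (a j i) = cmod (a i j)" using herm[OF assms(3,4)] by simp
      then have four': "(cmod (a j i))\<^sup>2 = 4" using four by simp
      show False
        by (rule closed_charged[of i "{i, j}"])
          (use other[OF assms(3,4) four] other[OF assms(4,3) four'] False assms in auto)
    qed
  next
    case three
    have ij: "i \<noteq> j"
    proof
      assume "i = j"
      obtain k where k: "a i i = of_int k" using diag_real[OF assms(3)] .
      have "k\<^sup>2 = 3" using three \<open>i = j\<close> k by (simp add: norm_of_int) (metis of_int_eq_iff of_int_numeral of_int_power)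
      then have "\<not> \<bar>k\<bar> \<ge> 2" using mult_mono[of 2 "\<bar>k\<bar>" 2 "\<bar>k\<bar>"] by (auto simp: power2_eq_square)
      then have "k \<in> {-1, 0, 1}" by auto
      then show False using \<open>k\<^sup>2 = 3\<close> by auto
    qed
    have three': "(cmod (a j i))\<^sup>2 = 3" using herm[OF assms(3,4)] three by simp
    obtain k where k: "k < n" "k \<noteq> j" "cmod (a i k) = 1"
      "\<And>l. l < n \<Longrightarrow> l \<noteq> j \<Longrightarrow> l \<noteq> k \<Longrightarrow> a i l = 0" "rowsq n a i = 4"
      using row_norm_3[OF assms(3,4) three] by blast
    obtain l where l: "l < n" "l \<noteq> i" "cmod (a j l) = 1"
      "\<And>m. m < n \<Longrightarrow> m \<noteq> i \<Longrightarrow> m \<noteq> l \<Longrightarrow> a j m = 0" "rowsq n a j = 4"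
      using row_norm_3[OF assms(4,3) three'] by blast
    have nz: "a i j \<noteq> 0" "a j i \<noteq> 0" "a i k \<noteq> 0" "a j l \<noteq> 0" using three three' k(3) l(3) by auto
    have sqi: "sq n a i m = a i j * a j m + a i k * a k m" for m
      by (rule sq_two) (use assms k in auto)
    have sqj: "sq n a j m = a j i * a i m + a j l * a l m" for m
      by (rule sq_two) (use assms l in auto)
    have e1: "a i j * a j j + a i k * a k j = 0"
      using sq_sat[OF assms(3) k(5) assms(4)] ij sqi[of j] by simp
    have e2: "a j i * a i i + a j l * a l i = 0"
      using sq_sat[OF assms(4) l(5) assms(3)] ij sqj[of i] by simp
    show False
    proof (cases "k = i")
      case True
      then have "a i j * (a j j + a i i) = 0" using e1 by (simp add: algebra_simps)
      then have jj: "a j j = - a i i" using nz by (simp add: eq_neg_iff_add_eq_0)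
      then have "a j j \<noteq> 0" using nz True by simp
      then have lj: "l = j" using l(4)[of j] ij assms by metis
      have all: "{i, j} = {..<n}"
        by (rule connD[OF conn, of i]) (use k(4) l(4) True lj assms in blast)+
      obtain c where c: "a i i = of_int c" using diag_real[OF assms(3)] .
      have "\<bar>c\<bar> = 1" using k(3) True c by (simp add: norm_of_int)
      then consider "c = 1" | "c = -1" by linarith
      then show False
      proof cases
        case 1
        obtain u where "unit u" "a i j = u * (1 + omega)" using eis_norm_3[OF eis[OF assms(3,4)] three] .
        then have "graph_iso n a graph_S2_dagger"
          by (intro graph_iso_S2_dagger[of j i n a u]) (use all ij jj c 1 herm[OF assms(3,4)] in auto)
        then show False using assms(2) by simp
      next
        case 2
        obtain u where "unit u" "a j i = u * (1 + omega)" using eis_norm_3[OF eis[OF assms(4,3)] three'] .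
        then have "graph_iso n a graph_S2_dagger"
          by (intro graph_iso_S2_dagger[of i j n a u]) (use all ij jj c 2 herm[OF assms(4,3)] in auto)
        then show False using assms(2) by simp
      qed
    next
      case False
      then have ii: "a i i = 0" using k(4)[of i] ij assms by auto
      have lj: "l \<noteq> j"
      proof
        assume "l = j"
        then have "a j j = 0" using e2 ii nz by auto
        then show False using nz \<open>l = j\<close> by simp
      qed
      then have jj: "a j j = 0" using l(4)[of j] ij assms by auto
      have kj: "a k j = 0" using e1 jj nz by simp
      then have kl: "k \<noteq> l" using nz zero_sym[OF l(1) assms(4)] by auto
      have jk: "a j k = 0" using kj zero_sym[OF k(1) assms(4)] by simp
      have "sq n a j k = 0" using sq_sat[OF assms(4) l(5) k(1)] k(2) by simp
      \<comment> \<open>The product of row j with column k runs only through i and l, so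
        orthogonality transfers the norm 3 from the edge between i and j to the edge between k and
        l.\<close>
      then have e: "a j i * a i k = - (a j l * a l k)" using sqj[of k] by (simp add: eq_neg_iff_add_eq_0)
      then have "cmod (a j i) * 1 = cmod (a l k)"
        using k(3) l(3) by (metis mult.commute mult_1 norm_minus_cancel norm_mult)
      then have lk: "(cmod (a l k))\<^sup>2 = 3" using three' by simp
      have kl3: "(cmod (a k l))\<^sup>2 = 3" using lk herm[OF l(1) k(1)] by simp
      have row: "m \<in> {y, t} " if xy: "x < n" "y < n" "(cmod (a x y))\<^sup>2 = 3" "t < n" "t \<noteq> y" "a x t \<noteq> 0" "m < n" "a x m \<noteq> 0" for x y t m
        using row_norm_3[OF xy(1-3)] xy(4-8) by (metis insertCI)
      have ki: "a k i \<noteq> 0" using nz zero_sym[OF assms(3) k(1)] by simp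
      have lj': "a l j \<noteq> 0" using nz zero_sym[OF assms(4) l(1)] by simp
      have rk: "m \<in> {l, i}" if "m < n" "a k m \<noteq> 0" for m
        using row[OF k(1) l(1) kl3 assms(3) l(2)[symmetric] ki that] .
      have rl: "m \<in> {k, j}" if "m < n" "a l m \<noteq> 0" for m
        using row[OF l(1) k(1) lk assms(4) k(2)[symmetric] lj' that] .
      have "a k k = 0" using rk[OF k(1)] kl False by auto
      moreover have "a l l = 0" using rl[OF l(1)] kl lj by auto
      moreover have ri: "m \<in> {j, k}" if "m < n" "a i m \<noteq> 0" for m
        using k(4)[OF that(1)] that(2) by blast
      moreover have rj: "m \<in> {i, l}" if "m < n" "a j m \<noteq> 0" for m
        using l(4)[OF that(1)] that(2) by blast
      moreover have "x \<in> {i, j, k, l} \<Longrightarrow> y < n \<Longrightarrow> a x y \<noteq> 0 \<Longrightarrow> y \<in> {i, j, k, l}" for x y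
        using ri[of y] rj[of y] rk[of y] rl[of y] by (elim insertE emptyE) auto
      moreover have "x \<in> {i, j, k, l} \<Longrightarrow> x < n" for x
        using k(1) l(1) assms(3,4) by (elim insertE emptyE) simp_all
      moreover have "i \<in> {i, j, k, l}" by simp
      moreover have "x \<in> {i, j, k, l} \<Longrightarrow> a x x = 0" for x
        using ii jj \<open>a k k = 0\<close> \<open>a l l = 0\<close> by (elim insertE emptyE) simp_all
      ultimately show False using closed_charged[of i "{i, j, k, l}"] by blast
    qed
  qed
qed

end

section \<open>Saturation\<close>

text \<open>A charged vertex belongs to its own neighbour set. For unit entries the cardinality is
  therefore the row norm, loops included.\<close>

definition nb :: "nat \<Rightarrow> (nat \<Rightarrow> nat \<Rightarrow> complex) \<Rightarrow> nat \<Rightarrow> nat set" where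
  "nb n a i = {k. k < n \<and> a i k \<noteq> 0}"

lemma finite_nb [simp]: "finite (nb n a i)"
  by (simp add: nb_def)

lemma nb_switch:
  assumes "\<And>i. i < n \<Longrightarrow> unit (h i)" "i < n"
  shows "nb n (\<lambda>i j. h i * a i j * cnj (h j)) i = nb n a i"
  using assms unit_nz by (auto simp: nb_def)

lemma card4_cases:
  assumes "card X = 4" "u \<in> X"
  obtains x y z where "X = {u, x, y, z}" "distinct [u, x, y, z]"
proof -
  have "card (X - {u}) = 3" using assms by simp
  then obtain x y z where "X - {u} = {x, y, z}" "x \<noteq> y" "y \<noteq> z" "x \<noteq> z"
    by (auto simp: card_3_iff)
  then show ?thesis using that[of x y z] assms(2) by auto
qed

lemma card4_cases2:
  assumes "card X = 4" "u \<in> X" "x \<in> X" "x \<noteq> u"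
  obtains y z where "X = {u, x, y, z}" "distinct [u, x, y, z]"
proof -
  obtain p q r where X: "X = {u, p, q, r}" and d: "distinct [u, p, q, r]" using card4_cases[OF assms(1,2)] .
  consider "x = p" | "x = q" | "x = r" using assms(3,4) X by auto
  then show ?thesis
  proof cases
    case 1 then show ?thesis using that[of q r] X d by auto
  next
    case 2 then show ?thesis using that[of p r] X d by auto
  next
    case 3 then show ?thesis using that[of p q] X d by auto
  qed
qed

lemma card4_eq:
  assumes "card X = 4" "{u, x, y, z} \<subseteq> X" "distinct [u, x, y, z]"
  shows "X = {u, x, y, z}"
proof -
  have "finite X" using assms(1) by (metis card.infinite zero_neq_numeral)
  moreover have "card {u, x, y, z} = 4" using assms(3) by simp
  ultimately show ?thesis using card_subset_eq[of X "{u, x, y, z}"] assms(1,2) by simp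
qed

lemma card2_cases:
  assumes "card X = 2" "u \<in> X"
  obtains k where "X = {u, k}" "k \<noteq> u"
  using assms by (auto simp: card_2_iff)

locale unit_max = max_charged +
  assumes entries: "i < n \<Longrightarrow> j < n \<Longrightarrow> a i j \<noteq> 0 \<Longrightarrow> unit (a i j)"
begin

abbreviation "D \<equiv> nb n a"

lemma D_less: "j \<in> D i \<Longrightarrow> j < n" by (simp add: nb_def)

lemma D_iff: "j < n \<Longrightarrow> j \<in> D i \<longleftrightarrow> a i j \<noteq> 0" by (simp add: nb_def)

lemma D_sym: "i < n \<Longrightarrow> j \<in> D i \<Longrightarrow> i \<in> D j"
  using zero_sym by (simp add: nb_def)

lemma D_zero: "j < n \<Longrightarrow> j \<notin> D i \<Longrightarrow> a i j = 0" by (simp add: nb_def)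

lemma unit_D: "i < n \<Longrightarrow> j \<in> D i \<Longrightarrow> unit (a i j)"
  using entries by (simp add: nb_def)

lemma rowsq_card: assumes "i < n" shows "rowsq n a i = card (D i)"
proof -
  have "rowsq n a i = (\<Sum>j<n. if a i j \<noteq> 0 then 1 else 0)"
    unfolding rowsq_def using entries[OF assms] by (intro sum.cong) (auto simp: unit_def)
  also have "\<dots> = (\<Sum>j\<in>D i. 1)"
    unfolding nb_def by (subst sum.inter_filter[symmetric]) (auto intro!: sum.cong)
  finally show ?thesis by simp
qed

text \<open>Degree 3 is a row of norm 3, excluded by an extension; degree 0 would be an isolated
  uncharged vertex.\<close>

lemma card_D: assumes "i < n" shows "card (D i) \<in> {1, 2, 4}"
proof -
  have "card (D i) \<noteq> 0"
  proof
    assume "card (D i) = 0"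
    then have "D i = {}" by simp
    then show False
      using closed_charged[of i "{i}"] assms D_zero[of _ i] by auto
  qed
  moreover have "card (D i) \<le> 4" "card (D i) \<noteq> 3"
    using rowsq_le[OF cyc assms] rowsq_neq_3[OF assms] unfolding rowsq_card[OF assms] by auto
  ultimately have "card (D i) = 1 \<or> card (D i) = 2 \<or> card (D i) = 4" by linarith
  then show ?thesis by blast
qed

lemma sq_D: "sq n a i j = (\<Sum>k\<in>D i. a i k * a k j)"
  unfolding sq_def by (rule sum.mono_neutral_right) (auto simp: nb_def)

lemma sat: "i < n \<Longrightarrow> card (D i) = 4 \<Longrightarrow> j < n \<Longrightarrow> j \<noteq> i \<Longrightarrow> sq n a i j = 0"
  and sat': "i < n \<Longrightarrow> card (D i) = 4 \<Longrightarrow> j < n \<Longrightarrow> j \<noteq> i \<Longrightarrow> sq n a j i = 0"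
  using sq_sat rowsq_card by auto

lemma sq_cnj: "i < n \<Longrightarrow> j < n \<Longrightarrow> sq n a j i = cnj (sq n a i j)"
  by (rule sq_herm[OF cycD(2)[OF cyc]])

lemma sq_self: "i < n \<Longrightarrow> sq n a i i = of_nat (card (D i))"
  using sq_diag[OF cycD(2)[OF cyc]] rowsq_card by simp

lemma diag_cases: assumes "i < n" shows "a i i \<in> {0, 1, -1}"
proof (cases "a i i = 0")
  case False
  obtain k where k: "a i i = of_int k" using diag_real[OF assms] .
  have "cmod (a i i) = 1" using entries[OF assms assms False] by (simp add: unit_def)
  then have "\<bar>k\<bar> = 1" using k by (simp add: norm_of_int)
  then have "k = 1 \<or> k = -1" by linarith
  then show ?thesis using k by auto
qed simp

section \<open>Three patterns in A and A^2 that allow an extension\<close>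

text \<open>Take q = e_u / 2. The column (4 - A^2) e_u is 2 at u and -2 at z, so its half is
  integral; with corner 0 both conditions read 1 <= 2.\<close>

lemma not_extendable_A1:
  assumes u: "u < n" "z < n" "u \<noteq> z" "card (D u) = 2" "a u u = 0" "a u z = 0"
    and s: "sq n a u z = 2" "\<And>i. i < n \<Longrightarrow> i \<noteq> u \<Longrightarrow> i \<noteq> z \<Longrightarrow> sq n a u i = 0"
  shows False
proof -
  define c where "c = (\<lambda>i. if i = u then 1 else if i = z then -1 else 0 :: complex)"
  have c: "c i = (if i = u then 4 * (1/2) else 0) + (if i = z then 4 * 0 else 0)
      - (1/2) * sq n a i u - 0 * sq n a i z" if "i < n" for i
  proof -
    have "sq n a i u = (if i = u then 2 else if i = z then 2 else 0)"
      using s that u sq_cnj[OF u(1) that] sq_self[OF u(1)] by auto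
    then show ?thesis using u by (auto simp: c_def)
  qed
  have mv: "mv n a c k = a k u - a k z" for k
  proof -
    have "mv n a c k = (\<Sum>j\<in>{u, z}. a k j * c j)"
      unfolding mv_def by (rule sum.mono_neutral_right) (use u in \<open>auto simp: c_def\<close>)
    then show ?thesis using u(3) by (simp add: c_def)
  qed
  have cv: "c u = 1" "c z = -1" "c i \<in> eisenstein_ints" for i using u by (auto simp: c_def)
  have "extendable n a"
    by (rule extendable_pairI[OF cyc u(1-3) c cv(3) u(1), where d = 0 and s = "1/2" and t = 0])
      (use u cv in \<open>auto simp: mv\<close>)
  then show False using nonext by simp
qed

text \<open>Take q = (e_u - e_p) / 3. The columns u and p of 4 - A^2 agree outside {u, p}, and on
  {u, p} they form the block with 2 on and -1 off the diagonal. Their difference is 3 (e_u - e_p),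
  which explains the denominator.\<close>

lemma not_extendable_A2:
  assumes u: "u < n" "p < n" "u \<noteq> p" "card (D u) = 2" "card (D p) = 2" "a u p = 0"
    and s: "sq n a u p = 1" "\<And>i. i < n \<Longrightarrow> i \<noteq> u \<Longrightarrow> i \<noteq> p \<Longrightarrow> sq n a u i = sq n a p i"
  shows False
proof -
  define c where "c = (\<lambda>i. if i = u then 1 else if i = p then -1 else 0 :: complex)"
  have c: "c i = (if i = u then 4 * (1/3) else 0) + (if i = p then 4 * (-1/3) else 0)
      - (1/3) * sq n a i u - (-1/3) * sq n a i p" if "i < n" for i
  proof -
    have "sq n a i u = (if i = u then 2 else if i = p then 1 else sq n a i p)"
      using s that u sq_cnj[OF u(1) that] sq_cnj[OF u(2) that] sq_self[OF u(1)] by auto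
    moreover have "sq n a u p = 1" "sq n a p p = 2" using s sq_self[OF u(2)] u by auto
    ultimately show ?thesis using u(3) by (auto simp: c_def)
  qed
  have mv: "mv n a c k = a k u - a k p" for k
  proof -
    have "mv n a c k = (\<Sum>j\<in>{u, p}. a k j * c j)"
      unfolding mv_def by (rule sum.mono_neutral_right) (use u in \<open>auto simp: c_def\<close>)
    then show ?thesis using u(3) by (simp add: c_def)
  qed
  have pu: "a p u = 0" using u(6) zero_sym[OF u(1,2)] by simp
  have cv: "c u = 1" "c p = -1" "c i \<in> eisenstein_ints" for i using u by (auto simp: c_def)
  have b: "Re (a u u) \<le> 1" "Re (a p p) \<le> 1" "-1 \<le> Re (a u u)" "-1 \<le> Re (a p p)"
    using diag_cases[OF u(1)] diag_cases[OF u(2)] by auto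
  have lo: "2 * (2/3) - Re (a u u + a p p) / 3 \<le> 2 + real_of_int 0" using b by (simp add: field_simps)
  have hi: "2 * (2/3) + Re (a u u + a p p) / 3 \<le> 2 - real_of_int 0" using b by (simp add: field_simps)
  have t: "Re (a u u + a p p) / 3 = Re (cnj (1/3) * mv n a c u + cnj (-1/3) * mv n a c p)"
    using u pu by (simp add: mv)
  have "extendable n a"
    by (rule extendable_pairI[OF cyc u(1-3) c cv(3) u(1) _ _ t lo hi]) (use cv in auto)
  then show False using nonext by simp
qed

text \<open>Take q = (e_x + e_y) / 2. Rows x and y add up to 2 e_s, hence A q = e_s and c = 4 q - A
  e_s, which is 1 at x and y and 0 at s. Both corner conditions hold with equality for corner
  0.\<close>

lemma not_extendable_B:
  assumes u: "x < n" "y < n" "x \<noteq> y" "s < n" and E: "a s s = 0" "a s x = 1" "a s y = 1"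
    and s: "\<And>j. j < n \<Longrightarrow> a x j + a y j = (if j = s then 2 else 0)"
  shows False
proof -
  define c where "c = (\<lambda>i. if i = x \<or> i = y then 2 - a i s else - a i s)"
  have col: "a k x + a k y = (if k = s then 2 else 0)" if "k < n" for k
    using s[OF that] herm[OF u(1) that] herm[OF u(2) that]
    by (metis complex_cnj_add complex_cnj_numeral complex_cnj_zero)
  have sq: "sq n a i x + sq n a i y = 2 * a i s" if "i < n" for i
  proof -
    have "sq n a i x + sq n a i y = (\<Sum>k<n. a i k * (a k x + a k y))"
      by (simp add: sq_def sum.distrib algebra_simps)
    also have "\<dots> = (\<Sum>k<n. if k = s then 2 * a i s else 0)"
      by (intro sum.cong) (auto simp: col)
    finally show ?thesis using u by simp
  qed
  have c: "c i = (if i = x then 4 * (1/2) else 0) + (if i = y then 4 * (1/2) else 0)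
      - (1/2) * sq n a i x - (1/2) * sq n a i y" if "i < n" for i
  proof -
    have "(1/2) * sq n a i x + (1/2) * sq n a i y = a i s" using sq[OF that] by (simp add: field_simps)
    then have e: "z - (1/2) * sq n a i x - (1/2) * sq n a i y = z - a i s" for z
      by (metis diff_diff_eq)
    show ?thesis unfolding e using u(3) by (auto simp: c_def)
  qed
  have xs: "a x s = 1" "a y s = 1" using E herm[OF u(4,1)] herm[OF u(4,2)] by auto
  have cc: "c x = 1" "c y = 1" "c s = 0" using u E xs by (auto simp: c_def)
  have "mv n a c x + mv n a c y = (\<Sum>j<n. (a x j + a y j) * c j)"
    by (simp add: mv_def sum.distrib algebra_simps)
  also have "\<dots> = (\<Sum>j<n. if j = s then 2 * c s else 0)"
    by (intro sum.cong) (auto simp: s)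
  finally have mv: "mv n a c x + mv n a c y = 0" using u cc by simp
  have "c i \<in> eisenstein_ints" if "i < n" for i
    using eis[OF that u(4)] eis_of_int[of 2] unfolding c_def by (auto intro!: eis_diff eis_uminus)
  moreover have "(1/2) * mv n a c x + (1/2) * mv n a c y = 0" using mv by (metis distrib_left mult_zero_right)
  ultimately have "extendable n a"
    by (intro extendable_pairI[OF cyc u(1-3) c _ u(1), where d = 0 and s = 1 and t = 0])
      (auto simp: cc)
  then show False using nonext by simp
qed

end

section \<open>The star of a vertex of degree four\<close>

text \<open>The edges at the centre are switched to weight 1. A loop at \<open>s\<close> is a
  charge, which switching cannot change, so \<open>normal\<close> leaves out
  \<open>x = s\<close>.\<close>

locale star = unit_max +
  fixes s
  assumes s: "s < n" "card (D s) = 4" and normal: "\<And>x. x \<in> D s \<Longrightarrow> x \<noteq> s \<Longrightarrow> a s x = 1"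
begin

lemma normal': "x \<in> D s \<Longrightarrow> x \<noteq> s \<Longrightarrow> a x s = 1"
  using normal herm[OF s(1)] D_less by fastforce

lemma s_real: "a s s \<in> {0, 1, -1}" using diag_cases s by blast

lemma sat_s: "x < n \<Longrightarrow> x \<noteq> s \<Longrightarrow> sq n a x s = 0"
  using sat'[OF s] by blast

text \<open>Orthogonality to row s contains the term 1 times \<open>a s s\<close>, and a row with at
  most two entries has only one further term to cancel it.\<close>

lemma unsat_neighbour:
  assumes "x \<in> D s" "x \<noteq> s" "card (D x) \<noteq> 4"
  shows "D x = {s} \<and> a s s = 0 \<or> (\<exists>k. k \<noteq> s \<and> D x = {s, k} \<and> a s s + a x k * a k s = 0)"
proof -
  have x: "x < n" using assms D_less by blast
  have sx: "s \<in> D x" using D_sym[OF s(1) assms(1)] .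
  have z: "sq n a x s = 0" using sat_s x assms(2) by blast
  consider "card (D x) = 1" | "card (D x) = 2" using card_D[OF x] assms(3) by auto
  then show ?thesis
  proof cases
    case 1
    then obtain w where "D x = {w}" using card_1_singletonE by blast
    then have "D x = {s}" using sx by auto
    then show ?thesis using z normal'[OF assms(1,2)] by (simp add: sq_D)
  next
    case 2
    then obtain k where "D x = {s, k}" "k \<noteq> s" using card2_cases[OF _ sx] by blast
    then show ?thesis using z normal'[OF assms(1,2)] by (auto simp: sq_D)
  qed
qed

text \<open>The loop at u forces s to be charged. Any other neighbour p of s has product 1 with u,
  hence is unsaturated, with its second entry at p or q. Then u and p have equal rows in A^2 outside
  {u, p}, the pattern of \<open>not_extendable_A2\<close>.\<close>

lemma charged_leaf:
  assumes u: "u \<noteq> s" "D u = {s, u}"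
  shows False
proof -
  have us: "u \<in> D s" using D_sym[of u s] u s D_less[of u u] by blast
  then have un: "u < n" by (rule D_less)
  have c2: "card (D u) = 2" using u by auto
  have as: "a s s + a u u * a u s = 0"
    using unsat_neighbour[OF us u(1)] c2 u by (auto simp: doubleton_eq_iff)
  have uu: "a u u \<noteq> 0" using u(2) D_iff[OF un, of u] by blast
  have ss: "a s s \<noteq> 0" using as uu normal'[OF us u(1)] by auto
  have sDs: "s \<in> D s" using ss s D_iff by blast
  obtain p q where Ds: "D s = {s, u, p, q}" "distinct [s, u, p, q]"
    using card4_cases2[OF s(2) sDs us u(1)] .
  have pq: "p < n" "q < n" using Ds D_less by blast+
  have main: "sq n a u x = 1 \<and> (\<exists>k \<in> {p, q}. D x = {s, k} \<and> card (D x) = 2)" if x: "x \<in> {p, q}" for x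
  proof -
    have xn: "x < n" and xD: "x \<in> D s" "x \<noteq> s" "x \<noteq> u" using x Ds pq by auto
    have "a u x = 0" using u(2) D_zero[OF xn, of u] xD by auto
    then have one: "sq n a u x = 1"
      using u Ds normal[OF xD(1,2)] normal'[OF us u(1)] by (auto simp: sq_D)
    then have "card (D x) \<noteq> 4" using sat'[OF xn _ un] xD by auto
    then obtain k where k: "k \<noteq> s" "D x = {s, k}" "a s s + a x k * a k s = 0"
      using unsat_neighbour[OF xD(1,2)] ss by blast
    have kn: "k < n" using k(2) D_less by blast
    have "a k s \<noteq> 0" using k(3) ss by auto
    then have "k \<in> D s" using D_sym[OF kn, of s] D_iff[OF s(1), of k] by blast
    moreover have "k \<noteq> u"
    proof
      assume "k = u"
      then have "x \<in> D u" using k(2) D_sym[OF xn, of u] by blast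
      then show False using u(2) xD by auto
    qed
    ultimately show ?thesis using one k Ds by auto
  qed
  obtain k where k: "k \<in> {p, q}" "D p = {s, k}" "card (D p) = 2" using main[of p] by blast
  obtain l where l: "l \<in> {p, q}" "D q = {s, l}" using main[of q] by blast
  show False
  proof (rule not_extendable_A2[OF un pq(1)])
    show "u \<noteq> p" using Ds by auto
    show "a u p = 0" using u(2) Ds D_zero[OF pq(1), of u] by auto
    show "sq n a u p = 1" using main by blast
    fix i assume i: "i < n" "i \<noteq> u" "i \<noteq> p"
    have ks: "k \<noteq> s" using k(1) Ds by auto
    have p1: "a p s = 1" using normal'[of p] Ds by auto
    have squ: "sq n a u i = a s i + a u u * a u i"
      using u normal'[OF us u(1)] by (auto simp: sq_D)
    have sqp: "sq n a p i = a s i + a p k * a k i"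
      using k(2) ks p1 by (simp add: sq_D)
    have ki: "a k i = 0" if "i \<noteq> s"
    proof (cases "k = p")
      case True
      then show ?thesis using k(2) i that D_zero[OF i(1), of p] by auto
    next
      case False
      then have kq: "k = q" using k(1) by auto
      then have "p \<in> D q" using D_sym[OF pq(1), of q] k(2) by blast
      then have "l = p" using l(2) Ds by auto
      then show ?thesis using kq l(2) i that D_zero[OF i(1), of q] by auto
    qed
    have ui: "a u i = 0" if "i \<noteq> s" using u(2) i that D_zero[OF i(1), of u] by auto
    show "sq n a u i = sq n a p i"
    proof (cases "i = s")
      case True
      then show ?thesis using sat_s[OF un u(1)] sat_s[OF pq(1)] Ds by auto
    next
      case False
      then show ?thesis by (simp add: squ sqp ki ui)
    qed
  qed (use c2 k in auto)
qed

text \<open>The second neighbour k of u is adjacent to s. If k is uncharged, the fourth vertex q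
  becomes a charged leaf. If k is charged, it has the same neighbour set as s, and row u of A^2 is
  supported on u and q with value 2, the pattern of \<open>not_extendable_A1\<close>.\<close>

lemma charged_centre:
  assumes ss: "a s s \<noteq> 0" and u: "u \<in> D s" "u \<noteq> s" "card (D u) \<noteq> 4"
  shows False
proof -
  have un: "u < n" using u D_less by blast
  obtain k where k: "k \<noteq> s" "D u = {s, k}" "a s s + a u k * a k s = 0"
    using unsat_neighbour[OF u] ss by blast
  have ku: "k \<noteq> u" using charged_leaf[of u] u(2) k(2) by auto
  have kn: "k < n" using k(2) D_less by blast
  have "a k s \<noteq> 0" using k(3) ss by auto
  then have kDs: "k \<in> D s" using D_sym[OF kn, of s] D_iff[OF s(1), of k] by blast
  have sDs: "s \<in> D s" using ss s D_iff by blast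
  obtain z q where "D s = {s, u, z, q}" and d0: "distinct [s, u, z, q]"
    using card4_cases2[OF s(2) sDs u(1,2)] .
  then obtain q where Ds: "D s = {s, u, k, q}" "distinct [s, u, k, q]"
    using kDs k(1) ku that by (cases "z = k") auto
  have qn: "q < n" using Ds D_less by blast
  have q: "q \<in> D s" "q \<noteq> s" "q \<noteq> u" "q \<noteq> k" using Ds by auto
  have uk: "a u k = - a s s" using k(3) normal'[OF kDs k(1)] by (simp add: eq_neg_iff_add_eq_0 add.commute)
  have ku': "a k u = - a s s" using herm[OF un kn] uk s_real by auto
  have uu: "a u u = 0" using k(2) u(2) ku D_zero[OF un, of u] by auto
  have uq: "a u q = 0" using k(2) q D_zero[OF qn, of u] by auto
  have e2: "a s s * a s s = 1" using s_real ss by auto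
  have "sq n a s k = 0" using sat[OF s kn k(1)] .
  then have "a k k + a q k = 0"
    using Ds normal[OF kDs k(1)] normal[OF u(1,2)] normal[OF q(1,2)] uk by (auto simp: sq_D)
  then have qk: "a q k = - a k k" by (simp add: eq_neg_iff_add_eq_0 add.commute)
  have kq: "a k q = - a k k" using herm[OF qn kn] qk diag_cases[OF kn] by auto
  have squ: "sq n a u i = a s i - a s s * a k i" for i
    using k(1,2) normal'[OF u(1,2)] uk by (auto simp: sq_D)
  have sqs: "sq n a s i = a s s * a s i + a u i + a k i + a q i" for i
    using Ds normal[OF kDs k(1)] normal[OF u(1,2)] normal[OF q(1,2)] by (auto simp: sq_D)
  have sq0: "sq n a s q = 0" using sat[OF s qn q(2)] .
  show False
  proof (cases "a k k = 0")
    case True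
    have "sq n a u q = 1" using squ[of q] normal[OF q(1,2)] kq True by simp
    then have q4: "card (D q) \<noteq> 4" using sat'[OF qn _ un] q by auto
    have "a q q \<noteq> 0" using sq0 sqs[of q] normal[OF q(1,2)] uq kq True ss by auto
    then have "q \<in> D q" using D_iff[OF qn] by blast
    then have "D q = {s, q}" using unsat_neighbour[OF q(1,2) q4] q(2) by auto
    then show False using charged_leaf[OF q(2)] by blast
  next
    case False
    have sub: "{s, u, k, q} \<subseteq> D k"
      using False kq ku' ss \<open>a k s \<noteq> 0\<close> D_iff s un kn qn by auto
    have k4: "card (D k) = 4"
    proof -
      have "card {s, u, k, q} \<le> card (D k)" by (rule card_mono[OF finite_nb sub])
      then show ?thesis using card_D[OF kn] Ds(2) by auto
    qed
    have Dk: "D k = {s, u, k, q}" by (rule card4_eq[OF k4 sub Ds(2)])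
    have qu: "a q u = 0" using uq zero_sym[OF qn un] by auto
    have "sq n a k u = 0" using sat[OF kn k4 un] ku by auto
    then have "1 - a k k * a s s = 0"
      using Dk Ds(2) normal'[OF kDs k(1)] normal[OF u(1,2)] uu qu ku' by (auto simp: sq_D)
    then have kk: "a k k = a s s" using e2 s_real diag_cases[OF kn] by auto
    have qq: "a q q = 0" using sq0 sqs[of q] normal[OF q(1,2)] uq kq kk by simp
    have squq: "sq n a u q = 2" using squ[of q] normal[OF q(1,2)] kq kk e2 by simp
    have sq_rest: "sq n a u i = 0" if i: "i < n" "i \<noteq> u" "i \<noteq> q" for i
    proof -
      consider "i = s" | "i = k" | "i \<notin> D s" "i \<notin> D k" using i Ds(1) Dk by auto
      then show ?thesis
      proof cases
        case 1 then show ?thesis using sat_s[OF un u(2)] by simp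
      next
        case 2 then show ?thesis using sat'[OF kn k4 un] ku by simp
      next
        case 3 then show ?thesis using squ[of i] D_zero i by simp
      qed
    qed
    have "card (D u) = 2" using k(1,2) by auto
    then show False
      by (rule not_extendable_A1[OF un qn q(3)[symmetric] _ uu uq squq sq_rest])
  qed
qed

end

context unit_max
begin

lemma switch:
  assumes h: "\<And>i. i < n \<Longrightarrow> unit (h i)"
  shows "unit_max n (\<lambda>i j. h i * a i j * cnj (h j))"
proof
  show "charged_max n (\<lambda>i j. h i * a i j * cnj (h j))"
    by (rule charged_max_switch[OF h charged_max])
  fix i j assume "i < n" "j < n" "h i * a i j * cnj (h j) \<noteq> 0"
  then show "unit (h i * a i j * cnj (h j))"
    using h entries by (intro unit_mult unit_cnj) auto
qed

lemma star_switch: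
  assumes s: "s < n" "card (D s) = 4"
  shows "\<exists>h. (\<forall>i<n. unit (h i)) \<and> star n (\<lambda>i j. h i * a i j * cnj (h j)) s \<and> h s = 1"
proof -
  \<comment> \<open>The index s is excluded so that the centre keeps the unit 1 even when it is
    charged.\<close>
  define h where "h = (\<lambda>i. if i \<in> D s \<and> i \<noteq> s then a s i else 1)"
  have h: "unit (h i)" for i using unit_D[OF s(1)] by (simp add: h_def)
  have st: "star n (\<lambda>i j. h i * a i j * cnj (h j)) s"
  proof (intro star.intro star_axioms.intro switch h s(1))
    have e: "nb n (\<lambda>i j. h i * a i j * cnj (h j)) s = D s" by (rule nb_switch[OF h s(1)])
    show "card (nb n (\<lambda>i j. h i * a i j * cnj (h j)) s) = 4" unfolding e by fact
    fix x assume "x \<in> nb n (\<lambda>i j. h i * a i j * cnj (h j)) s" "x \<noteq> s"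
    then have x: "x \<in> D s" "x \<noteq> s" unfolding e by auto
    then show "h s * a s x * cnj (h x) = 1" using unit_cnj_mult(2)[OF unit_D[OF s(1) x(1)]] by (simp add: h_def)
  qed
  have hs: "h s = 1" by (simp add: h_def)
  show ?thesis by (intro exI[of _ h] conjI allI impI h st hs)
qed

lemma saturated_uncharged:
  assumes s: "s < n" "card (D s) = 4" and u: "u \<in> D s" "u \<noteq> s" "card (D u) \<noteq> 4"
  shows "a s s = 0"
proof (rule ccontr)
  assume ss: "a s s \<noteq> 0"
  from star_switch[OF s] obtain h where "\<forall>i<n. unit (h i)" and st: "star n (\<lambda>i j. h i * a i j * cnj (h j)) s"
    by (elim exE conjE)
  then have h: "unit (h i)" if "i < n" for i using that by simp
  have e: "nb n (\<lambda>i j. h i * a i j * cnj (h j)) i = D i" if "i < n" for i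
    by (rule nb_switch[OF h that])
  show False
    by (rule star.charged_centre[OF st, of u]) (use ss u unit_nz[OF h[OF s(1)]] e s(1) D_less in auto)
qed

end

context star
begin

context
  assumes ss: "a s s = 0"
begin

lemma s_notin: "s \<notin> D s" using ss D_iff[OF s(1)] by blast

lemma nb_neq: "x \<in> D s \<Longrightarrow> x \<noteq> s" using s_notin by blast

lemma normal0: "x \<in> D s \<Longrightarrow> a s x = 1" "x \<in> D s \<Longrightarrow> a x s = 1"
  using normal normal' nb_neq by blast+

text \<open>As the centre is uncharged, orthogonality to row s makes the second neighbour of x
  non-adjacent to s.\<close>

lemma unsat_cases:
  assumes "x \<in> D s" "card (D x) \<noteq> 4"
  obtains (leaf) "D x = {s}" | (mid) p where "p \<noteq> s" "p \<notin> D s" "p \<noteq> x" "p < n" "D x = {s, p}"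
proof -
  have x: "x \<noteq> s" "x < n" using nb_neq assms(1) D_less by blast+
  consider "D x = {s}" | k where "k \<noteq> s" "D x = {s, k}" "a s s + a x k * a k s = 0"
    using unsat_neighbour[OF assms(1) x(1) assms(2)] by blast
  then show ?thesis
  proof cases
    case 1 then show ?thesis by (rule leaf)
  next
    case 2
    have k: "k < n" using 2(2) D_less by blast
    have "a x k \<noteq> 0" using 2(2) D_iff[OF k, of x] by blast
    then have "a k s = 0" using 2(3) ss by simp
    then have "k \<notin> D s" using zero_sym[OF k s(1)] D_iff[OF k] by simp
    moreover from this have "k \<noteq> x" using assms(1) by blast
    ultimately show ?thesis using mid 2 k by blast
  qed
qed

lemma column_sum:
  assumes "p < n" "p \<noteq> s" shows "(\<Sum>k\<in>D s. a k p) = 0"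
proof -
  have "(\<Sum>k\<in>D s. a k p) = (\<Sum>k\<in>D s. a s k * a k p)"
    by (intro sum.cong refl) (simp add: normal0)
  also have "\<dots> = 0" using sat[OF s assms] by (simp add: sq_D)
  finally show ?thesis .
qed

text \<open>Rows u and x share s with product 1, which can be cancelled only through the other
  neighbour p of u. So u has such a p, and x is adjacent to it with the opposite weight.\<close>

lemma opposite:
  assumes u: "u \<in> D s" "card (D u) \<noteq> 4" and x: "x \<in> D s" "card (D x) = 4"
  obtains p where "p \<noteq> s" "p \<notin> D s" "p \<noteq> u" "p < n" "D u = {s, p}" "a x p = - a u p" "a u p \<noteq> 0"
proof -
  have un: "u < n" and xn: "x < n" and ux: "u \<noteq> x" using u x D_less by auto
  have z: "sq n a u x = 0" using sat'[OF xn x(2) un ux] .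
  from u show ?thesis
  proof (cases rule: unsat_cases)
    case leaf
    then show ?thesis using z normal0 u x by (simp add: sq_D)
  next
    case (mid p)
    have uz: "unit (a u p)" using mid unit_D[OF un] by blast
    have "1 + a u p * a p x = 0" using z mid normal0 u x by (simp add: sq_D)
    then have "cnj (a u p) * (1 + a u p * a p x) = 0" by simp
    then have "cnj (a u p) + (cnj (a u p) * a u p) * a p x = 0" by (simp add: algebra_simps)
    then have "a p x = - cnj (a u p)" using unit_cnj_mult[OF uz] by (simp add: eq_neg_iff_add_eq_0 add.commute)
    then have "a x p = - a u p" using herm[OF mid(4) xn] by simp
    then show ?thesis using that mid unit_nz[OF uz] by blast
  qed
qed

lemma opposite_entry:
  assumes "u \<in> D s" "card (D u) \<noteq> 4" "x \<in> D s" "card (D x) = 4" "p \<in> D u" "p \<noteq> s"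
  shows "a x p = - a u p"
proof -
  obtain q where q: "q \<noteq> s" "q \<notin> D s" "q \<noteq> u" "q < n" "D u = {s, q}" "a x q = - a u q" "a u q \<noteq> 0"
    using opposite[OF assms(1-4)] .
  then have "p = q" using assms(5,6) by auto
  then show ?thesis using q by simp
qed

text \<open>Up to a unit the weights of u, x, y at p are 1, -1, -1, so the column sum gives z the
  weight of u. Then z is unsaturated too, p has the same neighbours as s, and u and z form the
  pattern of \<open>not_extendable_A1\<close>.\<close>

lemma two_saturated:
  assumes Ds: "D s = {u, x, y, z}" "distinct [u, x, y, z]"
    and c: "card (D u) \<noteq> 4" "card (D x) = 4" "card (D y) = 4"
  shows False
proof -
  have mem: "u \<in> D s" "x \<in> D s" "y \<in> D s" "z \<in> D s" using Ds by auto
  have lt: "u < n" "x < n" "y < n" "z < n" using mem D_less by auto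
  obtain p where p: "p \<noteq> s" "p \<notin> D s" "p \<noteq> u" "p < n" "D u = {s, p}" "a x p = - a u p" "a u p \<noteq> 0"
    using opposite[OF mem(1) c(1) mem(2) c(2)] .
  have pu: "p \<in> D u" using p(5) by simp
  have yp: "a y p = - a u p"
    by (rule opposite_entry[OF mem(1) c(1) mem(3) c(3) pu p(1)])
  have "a u p + a x p + a y p + a z p = 0"
    using column_sum[OF p(4,1)] Ds by (simp add: add.assoc)
  then have zp: "a z p = a u p" using p(6) yp by simp
  have cz: "card (D z) \<noteq> 4"
  proof
    assume "card (D z) = 4"
    then have "a z p = - a u p"
      by (rule opposite_entry[OF mem(1) c(1) mem(4) _ pu p(1)])
    then show False using zp p(7) by simp
  qed
  have "p \<in> D u" "p \<in> D x" "p \<in> D y" "p \<in> D z" using p(4,6,7) yp zp D_iff by auto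
  then have sub: "{u, x, y, z} \<subseteq> D p" using D_sym lt by blast
  have "4 \<le> card (D p)" using card_mono[OF finite_nb sub] Ds(2) by simp
  then have p4: "card (D p) = 4" using card_D[OF p(4)] by auto
  then have Dp: "D p = {u, x, y, z}" by (rule card4_eq[OF _ sub Ds(2)])
  have squ: "sq n a u i = a s i + a u p * a p i" for i
    using p(1,5) normal0 mem by (simp add: sq_D)
  have "unit (a u p)" using unit_D[OF lt(1)] p(5) by blast
  then have "sq n a u z = 2"
    using squ[of z] normal0(1)[OF mem(4)] herm[OF lt(4) p(4)] zp unit_cnj_mult by simp
  moreover have "card (D u) = 2" using p(1,5) by auto
  moreover have "a u u = 0" "a u z = 0"
    using p(2,3,5) nb_neq mem D_zero lt by (metis insertE singletonD)+
  moreover have "sq n a u i = 0" if "i < n" "i \<noteq> u" "i \<noteq> z" for i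
  proof -
    have "i = x \<or> i = y \<or> i \<notin> D s" using Ds(1) that by auto
    then show ?thesis
    proof (elim disjE)
      assume "i = x" then show ?thesis using sat'[OF lt(2) c(2) lt(1)] Ds(2) by simp
    next
      assume "i = y" then show ?thesis using sat'[OF lt(3) c(3) lt(1)] Ds(2) by simp
    next
      assume i: "i \<notin> D s"
      then have "i \<notin> D p" unfolding Ds(1) Dp .
      then show ?thesis using squ[of i] D_zero[OF that(1)] i by simp
    qed
  qed
  ultimately show False using not_extendable_A1[OF lt(1,4)] Ds(2) by simp
qed

text \<open>The column sum at p would give z the weight opposite to that of u, but comparing u and z
  with the saturated x shows that their weights at p agree.\<close>

lemma partners_distinct:
  assumes Ds: "D s = {u, x, y, z}" "distinct [u, x, y, z]"
    and c: "card (D u) \<noteq> 4" "card (D x) = 4" "card (D y) \<noteq> 4" "card (D z) \<noteq> 4"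
    and p: "p \<in> D u" "p \<in> D y" "p \<noteq> s"
  shows False
proof -
  have mem: "u \<in> D s" "x \<in> D s" "y \<in> D s" "z \<in> D s" using Ds by auto
  have op: "a x p = - a w p" if "w \<in> D s" "card (D w) \<noteq> 4" "p \<in> D w" for w
    using opposite_entry[OF that(1,2) mem(2) c(2) that(3) p(3)] .
  have pn: "p < n" using p D_less by blast
  have "a u p + a x p + a y p + a z p = 0"
    using column_sum[OF pn p(3)] Ds by (simp add: add.assoc)
  moreover have "a x p = - a u p" "a x p = - a y p" using op[OF mem(1) c(1) p(1)] op[OF mem(3) c(3) p(2)] by auto
  ultimately have zp: "a z p = - a u p" by (simp add: eq_neg_iff_add_eq_0 add.commute)
  have nz: "a u p \<noteq> 0" using p(1) D_iff[OF pn] by blast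
  then have "p \<in> D z" using zp D_iff[OF pn] by simp
  then have "a x p = - a z p" by (rule op[OF mem(4) c(4)])
  then show False using zp \<open>a x p = - a u p\<close> nz by simp
qed

text \<open>This is the configuration with a saturated neighbour that no extension removes: x is the
  only such neighbour, and the other three neighbours of s, of degree two, are matched by edges with
  the other three neighbours of x.\<close>

lemma mixed_star:
  assumes u: "u \<in> D s" "card (D u) \<noteq> 4" and x: "x \<in> D s" "card (D x) = 4"
  shows "(\<forall>y\<in>D s - {x}. card (D y) \<noteq> 4 \<and> (\<exists>p. p \<noteq> s \<and> p \<notin> D s \<and> D y = {s, p} \<and> p \<in> D x))
    \<and> (\<forall>p\<in>D x. p \<noteq> s \<longrightarrow> (\<exists>y\<in>D s - {x}. D y = {s, p}))"
proof -
  have xu: "x \<noteq> u" using u x by auto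
  obtain y z where Ds: "D s = {u, x, y, z}" "distinct [u, x, y, z]"
    using card4_cases2[OF s(2) u(1) x(1) xu] .
  have mem: "u \<in> D s" "x \<in> D s" "y \<in> D s" "z \<in> D s" using Ds by auto
  have lt: "u < n" "x < n" "y < n" "z < n" using mem D_less by auto
  have cy: "card (D y) \<noteq> 4" using two_saturated[OF Ds u(2) x(2)] by blast
  have cz: "card (D z) \<noteq> 4" using two_saturated[of u x z y] Ds u(2) x(2) by (auto simp: insert_commute)
  have ex: "\<exists>p. p \<noteq> s \<and> p \<notin> D s \<and> D w = {s, p} \<and> p \<in> D x" if w: "w \<in> D s" "card (D w) \<noteq> 4" for w
  proof -
    obtain p where p: "p \<noteq> s" "p \<notin> D s" "p \<noteq> w" "p < n" "D w = {s, p}" "a x p = - a w p" "a w p \<noteq> 0"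
      using opposite[OF w x] .
    then have "p \<in> D x" using D_iff by simp
    then show ?thesis using p by blast
  qed
  obtain p where p: "p \<noteq> s" "p \<notin> D s" "D u = {s, p}" "p \<in> D x" using ex[OF u] by blast
  obtain q where q: "q \<noteq> s" "q \<notin> D s" "D y = {s, q}" "q \<in> D x" using ex[OF mem(3) cy] by blast
  obtain r where r: "r \<noteq> s" "r \<notin> D s" "D z = {s, r}" "r \<in> D x" using ex[OF mem(4) cz] by blast
  have pq: "p \<noteq> q" using partners_distinct[OF Ds u(2) x(2) cy cz, of p] p q by auto
  have "D s = {u, x, z, y}" "distinct [u, x, z, y]" using Ds by auto
  then have pr: "p \<noteq> r" using partners_distinct[of u x z y p] u(2) x(2) cy cz p r by auto
  have "D s = {y, x, z, u}" "distinct [y, x, z, u]" using Ds by auto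
  then have qr: "q \<noteq> r" using partners_distinct[of y x z u q] u(2) x(2) cy cz q r by auto
  have sub: "{s, p, q, r} \<subseteq> D x" using D_sym[OF s(1) x(1)] p q r by auto
  have Dx: "D x = {s, p, q, r}"
    by (rule card4_eq[OF x(2) sub]) (use p q r pq pr qr in auto)
  have "\<forall>w\<in>D s - {x}. card (D w) \<noteq> 4" using Ds u(2) cy cz by auto
  then have 1: "\<forall>w\<in>D s - {x}. card (D w) \<noteq> 4 \<and> (\<exists>p. p \<noteq> s \<and> p \<notin> D s \<and> D w = {s, p} \<and> p \<in> D x)"
    using ex by blast
  have "u \<in> D s - {x}" "y \<in> D s - {x}" "z \<in> D s - {x}" using Ds by auto
  then have 2: "\<forall>p\<in>D x. p \<noteq> s \<longrightarrow> (\<exists>y\<in>D s - {x}. D y = {s, p})"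
    unfolding Dx using p(3) q(3) r(3) by blast
  show ?thesis using 1 2 by blast
qed

text \<open>Equal weights at s and opposite weights at p make rows u and x add up to 2 e_s, the
  pattern of \<open>not_extendable_B\<close>.\<close>

lemma opposite_pair:
  assumes "u \<in> D s" "x \<in> D s" "u \<noteq> x" "D u = {s, p}" "D x = {s, p}" "p \<noteq> s" "a x p = - a u p"
  shows False
proof (rule not_extendable_B[of u x s])
  show "u < n" "x < n" using assms D_less by blast+
  show "a u j + a x j = (if j = s then 2 else 0)" if "j < n" for j
  proof -
    consider "j = s" | "j = p" | "j \<notin> D u" "j \<notin> D x" using assms(4,5) by auto
    then show ?thesis
      using normal0 assms D_zero[OF that] by cases auto
  qed
qed (use ss s normal0 assms in auto)

text \<open>The column sums away from p make z a leaf. The same happens on the side of p: its fourth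
  neighbour w has nonzero product with u, so it is unsaturated, and then a leaf. The seven vertices
  are closed under adjacency and uncharged.\<close>

lemma three_and_leaf:
  assumes Ds: "D s = {u, x, y, z}" "distinct [u, x, y, z]"
    and all: "\<And>x. x \<in> D s \<Longrightarrow> card (D x) \<noteq> 4"
    and p: "p \<noteq> s" "p \<notin> D s" "D u = {s, p}" "D x = {s, p}" "D y = {s, p}" "a z p = 0"
  shows False
proof -
  have mem: "u \<in> D s" "x \<in> D s" "y \<in> D s" "z \<in> D s" using Ds by auto
  have lt: "u < n" "x < n" "y < n" "z < n" using mem D_less by auto
  have pn: "p < n" using p(3) D_less by blast
  have zs: "z \<notin> D p" using p(6) zero_sym[OF pn lt(4)] by (simp add: nb_def)
  have Dz: "D z = {s}"
    using mem(4) all[OF mem(4)]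
  proof (cases rule: unsat_cases)
    case (mid q)
    have "q \<noteq> p" using mid(5) p(6) pn by (auto simp: nb_def)
    then have "a u q = 0" "a x q = 0" "a y q = 0" using D_zero[OF mid(4)] p(3-5) mid(1) by auto
    then have "a z q = 0" using column_sum[OF mid(4,1)] Ds by simp
    then show ?thesis using mid(5) by (auto simp: nb_def)
  qed
  have up: "u \<in> D p" "x \<in> D p" "y \<in> D p" using D_sym[OF lt(1), of p] D_sym[OF lt(2), of p] D_sym[OF lt(3), of p] p by auto
  have "3 \<le> card (D p)" using card_mono[of "D p" "{u, x, y}"] up Ds(2) by auto
  then have p4: "card (D p) = 4" using card_D[OF pn] by auto
  obtain v w where vw: "D p = {u, x, v, w}" "distinct [u, x, v, w]"
    using card4_cases2[OF p4 up(1,2)] Ds(2) by auto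
  then obtain w where Dp: "D p = {u, x, y, w}" "distinct [u, x, y, w]"
    using up(3) Ds(2) that by (cases "v = y") auto
  have wn: "w < n" using Dp D_less by blast
  have pp: "a p p = 0" using saturated_uncharged[OF pn p4 up(1)] all[OF mem(1)] mem(1) p(2) by blast
  have wp: "w \<noteq> p" using pp Dp(1) D_iff[OF pn, of p] by auto
  have "s \<notin> D p" using p(2) D_sym[OF pn, of s] by blast
  then have ws: "w \<noteq> s" using Dp by auto
  have wz: "w \<noteq> z" using zs Dp by auto
  then have wDs: "w \<notin> D s" using Ds Dp by auto
  have "sq n a u w = a s w + a u p * a p w"
    using p(1,3) normal0 mem by (simp add: sq_D)
  moreover have "a u p \<noteq> 0" "a p w \<noteq> 0" "a s w = 0"
    using p(3) Dp(1) wDs by (auto simp: nb_def)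
  ultimately have "sq n a u w \<noteq> 0" by simp
  then have w4: "card (D w) \<noteq> 4" using sat'[OF wn _ lt(1)] Dp(2) by auto
  have pw: "p \<in> D w" using D_sym[OF pn, of w] Dp by auto
  have Dw: "D w = {p}"
  proof (rule ccontr)
    assume "D w \<noteq> {p}"
    then obtain q where q: "q \<in> D w" "q \<noteq> p" using pw by auto
    have qn: "q < n" using q D_less by blast
    have "q \<noteq> s" using q(1) D_sym[OF wn, of s] wDs by auto
    then have "a u q = 0" "a x q = 0" "a y q = 0" using D_zero[OF qn] p(3-5) q by auto
    moreover have "sq n a p q = 0" using sat[OF pn p4 qn q(2)] .
    ultimately have "a p w * a w q = 0" using Dp by (simp add: sq_D)
    then show False using \<open>a p w \<noteq> 0\<close> q(1) by (auto simp: nb_def)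
  qed
  define C where "C = {s, p, u, x, y, z, w}"
  have rows: "D s \<subseteq> C" "D p \<subseteq> C" "D u \<subseteq> C" "D x \<subseteq> C" "D y \<subseteq> C" "D z \<subseteq> C" "D w \<subseteq> C"
    unfolding Ds Dp p Dz Dw C_def by auto
  have z0: "k \<notin> D k" if "k \<in> C" for k
    using that unfolding C_def
    by (elim insertE emptyE) (use s_notin Dp(1) pp p mem Dz Dw wp nb_neq in \<open>auto simp: nb_def\<close>)
  show False
  proof (rule closed_charged[of s C])
    show "s \<in> C" by (simp add: C_def)
    show "k < n" if "k \<in> C" for k
      using that unfolding C_def by (elim insertE emptyE) (use s pn lt wn in simp_all)
    show "a k k = 0" if "k \<in> C" for k
      using z0[OF that] \<open>k \<in> C \<Longrightarrow> k < n\<close> that D_zero by blast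
    fix k l assume "k \<in> C" "l < n" "a k l \<noteq> 0"
    then have "l \<in> D k" by (simp add: nb_def)
    then show "l \<in> C" using rows \<open>k \<in> C\<close> unfolding C_def by (elim insertE emptyE) blast+
  qed
qed

text \<open>The split is by the number of neighbours of s that share the second neighbour p of u.
  The column sum at p rules out u alone; two of them cancel and form \<open>opposite_pair\<close>;
  three give \<open>three_and_leaf\<close>; four give a closed uncharged graph on six vertices. If
  all neighbours are leaves, the star itself is closed.\<close>

lemma all_unsaturated:
  assumes all: "\<And>x. x \<in> D s \<Longrightarrow> card (D x) \<noteq> 4"
  shows False
proof (cases "\<forall>x\<in>D s. D x = {s}")
  case True
  show False
  proof (rule closed_charged[of s "insert s (D s)"])
    fix k assume k: "k \<in> insert s (D s)"
    then show "k < n" using s D_less by blast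
    show "a k k = 0" using k True nb_neq ss \<open>k < n\<close> D_zero[of k k] by auto
    fix l assume "l < n" "a k l \<noteq> 0"
    then have "l \<in> D k" by (simp add: nb_def)
    then show "l \<in> insert s (D s)" using k True by auto
  qed simp
next
  case False
  then obtain u where u: "u \<in> D s" "D u \<noteq> {s}" by blast
  obtain p where p: "p \<noteq> s" "p \<notin> D s" "p \<noteq> u" "p < n" "D u = {s, p}"
    using unsat_cases[OF u(1) all[OF u(1)]] u(2) by metis
  obtain x y z where Ds: "D s = {u, x, y, z}" "distinct [u, x, y, z]"
    using card4_cases[OF s(2) u(1)] .
  have mem: "u \<in> D s" "x \<in> D s" "y \<in> D s" "z \<in> D s" using Ds by auto
  have lt: "u < n" "x < n" "y < n" "z < n" using mem D_less by auto
  have sum: "a u p + a x p + a y p + a z p = 0"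
    using column_sum[OF p(4,1)] Ds by (simp add: add.assoc)
  have up: "a u p \<noteq> 0" using p(5) by (auto simp: nb_def)
  have Dk: "D k = {s, p}" if "k \<in> D s" "a k p \<noteq> 0" for k
  proof -
    have "p \<in> D k" using that(2) p(4) by (simp add: nb_def)
    then show ?thesis using unsat_cases[OF that(1) all[OF that(1)]] p(1) by (metis insertE singletonD)
  qed
  have pair: False if "k \<in> D s" "k \<noteq> u" "a k p = - a u p" for k
    using opposite_pair[OF u(1) that(1) _ p(5) Dk[OF that(1)] p(1) that(3)] that up by auto
  have three: False if "D s = {u, k, l, m}" "distinct [u, k, l, m]" "a k p \<noteq> 0" "a l p \<noteq> 0" "a m p = 0" for k l m
    by (rule three_and_leaf[OF that(1,2) all p(1,2,5) _ _ that(5)]) (use that Dk in auto)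
  show False
  proof (cases "a x p = 0"; cases "a y p = 0"; cases "a z p = 0")
    assume "a x p = 0" "a y p = 0" "a z p = 0" then show False using sum up by simp
  next
    assume "a x p = 0" "a y p = 0" "a z p \<noteq> 0"
    then show False using pair[of z] mem Ds(2) sum by (auto simp: eq_neg_iff_add_eq_0 add.commute)
  next
    assume "a x p = 0" "a y p \<noteq> 0" "a z p = 0"
    then show False using pair[of y] mem Ds(2) sum by (auto simp: eq_neg_iff_add_eq_0 add.commute)
  next
    assume "a x p \<noteq> 0" "a y p = 0" "a z p = 0"
    then show False using pair[of x] mem Ds(2) sum by (auto simp: eq_neg_iff_add_eq_0 add.commute)
  next
    assume "a x p = 0" "a y p \<noteq> 0" "a z p \<noteq> 0"
    then show False using three[of y z x] Ds by auto
  next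
    assume "a x p \<noteq> 0" "a y p = 0" "a z p \<noteq> 0"
    then show False using three[of x z y] Ds by auto
  next
    assume "a x p \<noteq> 0" "a y p \<noteq> 0" "a z p = 0"
    then show False using three[of x y z] Ds by auto
  next
    assume nz: "a x p \<noteq> 0" "a y p \<noteq> 0" "a z p \<noteq> 0"
    have D4: "D u = {s, p}" "D x = {s, p}" "D y = {s, p}" "D z = {s, p}" using Dk mem nz up by blast+
    then have sub: "{u, x, y, z} \<subseteq> D p" using D_sym lt by blast
    have "4 \<le> card (D p)" using card_mono[OF finite_nb sub] Ds(2) by simp
    then have p4: "card (D p) = 4" using card_D[OF p(4)] by auto
    then have Dp: "D p = {u, x, y, z}" by (rule card4_eq[OF _ sub Ds(2)])
    define C where "C = {s, p, u, x, y, z}"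
    have rows: "D s \<subseteq> C" "D p \<subseteq> C" "D u \<subseteq> C" "D x \<subseteq> C" "D y \<subseteq> C" "D z \<subseteq> C"
      unfolding Ds Dp D4 C_def by auto
    have z0: "k \<notin> D k" if "k \<in> C" for k
      using that unfolding C_def
      by (elim insertE emptyE) (use s_notin Dp Ds(1) p(2) D4 mem nb_neq in auto)
    show False
    proof (rule closed_charged[of s C])
      show "s \<in> C" by (simp add: C_def)
      show kn: "k < n" if "k \<in> C" for k
        using that unfolding C_def by (elim insertE emptyE) (use s p lt in simp_all)
      show "a k k = 0" if "k \<in> C" for k
        using z0[OF that] kn[OF that] D_zero by blast
      fix k l assume "k \<in> C" "l < n" "a k l \<noteq> 0"
      then have "l \<in> D k" by (simp add: nb_def)
      then show "l \<in> C" using rows \<open>k \<in> C\<close> unfolding C_def by (elim insertE emptyE) blast+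
    qed
  qed
qed

end

end

context unit_max
begin

text \<open>The conclusion of \<open>mixed_star\<close> speaks of neighbour sets only, so it
  survives undoing the switching.\<close>

lemma saturated_structure:
  assumes s: "s < n" "card (D s) = 4" and u: "u \<in> D s" "u \<noteq> s" "card (D u) \<noteq> 4"
    and x: "x \<in> D s" "card (D x) = 4"
  shows "(\<forall>y\<in>D s - {x}. card (D y) \<noteq> 4 \<and> (\<exists>p. p \<noteq> s \<and> p \<notin> D s \<and> D y = {s, p} \<and> p \<in> D x))
    \<and> (\<forall>p\<in>D x. p \<noteq> s \<longrightarrow> (\<exists>y\<in>D s - {x}. D y = {s, p}))"
proof -
  have ss: "a s s = 0" by (rule saturated_uncharged[OF s u])
  from star_switch[OF s] obtain h where "\<forall>i<n. unit (h i)" and st: "star n (\<lambda>i j. h i * a i j * cnj (h j)) s"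
    by (elim exE conjE)
  then have h: "unit (h i)" if "i < n" for i using that by simp
  have e: "nb n (\<lambda>i j. h i * a i j * cnj (h j)) i = D i" if "i < n" for i
    by (rule nb_switch[OF h that])
  have lt: "u < n" "x < n" using u x D_less by auto
  have ey: "nb n (\<lambda>i j. h i * a i j * cnj (h j)) y = D y" if "y \<in> D s - {x}" for y
  proof (rule e)
    show "y < n" using that D_less[of y s] by simp
  qed
  have ss': "h s * a s s * cnj (h s) = 0" using ss by simp
  note R = star.mixed_star[OF st ss', of u x, unfolded e[OF s(1)] e[OF lt(1)] e[OF lt(2)], OF u(1,3) x]
  show ?thesis
  proof (intro conjI ballI impI)
    fix y assume y: "y \<in> D s - {x}"
    note Ry = bspec[OF conjunct1[OF R] y, unfolded ey[OF y]]
    show "card (D y) \<noteq> 4" by (rule conjunct1[OF Ry])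
    show "\<exists>p. p \<noteq> s \<and> p \<notin> D s \<and> D y = {s, p} \<and> p \<in> D x" by (rule conjunct2[OF Ry])
  next
    fix p assume p: "p \<in> D x" "p \<noteq> s"
    obtain y where y: "y \<in> D s - {x}" "nb n (\<lambda>i j. h i * a i j * cnj (h j)) y = {s, p}"
      using mp[OF bspec[OF conjunct2[OF R] p(1)] p(2)] by (elim bexE)
    show "\<exists>y\<in>D s - {x}. D y = {s, p}" using y(2) unfolding ey[OF y(1)] by (rule bexI[OF _ y(1)])
  qed
qed

text \<open>The extensions leave only the matching between the neighbours of s and those of x. It
  recurs around every saturated neighbour of x, so x, its neighbours and the attached vertices of
  degree two exhaust the graph, and none of them carries a charge.\<close>

lemma saturated_neighbours:
  assumes s: "s < n" "card (D s) = 4" and u: "u \<in> D s"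
  shows "card (D u) = 4"
proof (rule ccontr)
  assume u4: "card (D u) \<noteq> 4"
  then have us: "u \<noteq> s" using s by auto
  have ss: "a s s = 0" by (rule saturated_uncharged[OF s u us u4])
  then have sDs: "s \<notin> D s" by (simp add: nb_def)
  have "\<exists>x\<in>D s. card (D x) = 4"
  proof (rule ccontr)
    assume no: "\<not> ?thesis"
    from star_switch[OF s] obtain h where "\<forall>i<n. unit (h i)" and st: "star n (\<lambda>i j. h i * a i j * cnj (h j)) s"
      by (elim exE conjE)
    then have h: "unit (h i)" if "i < n" for i using that by simp
    have e: "nb n (\<lambda>i j. h i * a i j * cnj (h j)) i = D i" if "i < n" for i
      by (rule nb_switch[OF h that])
    show False
      by (rule star.all_unsaturated[OF st]) (use ss no e s(1) D_less in auto)
  qed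
  then obtain x where x: "x \<in> D s" "card (D x) = 4" by blast
  have xn: "x < n" using x D_less by blast
  have sx: "s \<in> D x" using D_sym[OF s(1) x(1)] .
  note str = saturated_structure[OF s u us u4 x]
  have partner: "\<exists>y\<in>D s - {x}. D y = {s, t} \<and> card (D y) \<noteq> 4 \<and> t \<notin> D s \<and> y \<in> D t" if t: "t \<in> D x" "t \<noteq> s" for t
  proof -
    obtain y where y: "y \<in> D s - {x}" "D y = {s, t}" using str t by blast
    moreover have "card (D y) \<noteq> 4 \<and> t \<notin> D s" using str y t by (metis doubleton_eq_iff)
    moreover have "y \<in> D t" using y D_sym[of y t] D_less by blast
    ultimately show ?thesis by blast
  qed
  define M where "M = {m. m < n \<and> card (D m) \<noteq> 4 \<and> (\<exists>t\<in>D x. m \<in> D t)}"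
  define C where "C = insert x (D x \<union> M)"
  \<comment> \<open>The structure is applied with t as the centre in place of s; the unsaturated
    neighbour it requires is the partner of t.\<close>
  have sat_row: "m = x \<or> (m \<in> M \<and> (\<exists>p. D m = {t, p} \<and> p \<in> D x \<and> p \<notin> D t)) \<and> t \<notin> D t"
    if t: "t \<in> D x" "card (D t) = 4" and m: "m \<in> D t" for t m
  proof -
    have tn: "t < n" using t D_less by blast
    have xt: "x \<in> D t" using D_sym[OF xn t(1)] .
    obtain y where y: "y \<in> D t" "y \<noteq> t" "card (D y) \<noteq> 4"
    proof (cases "t = s")
      case True then show ?thesis using that u us u4 by blast
    next
      case False
      obtain y where "y \<in> D s - {x}" "t \<notin> D s" "card (D y) \<noteq> 4" "y \<in> D t" using partner[OF t(1) False] by blast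
      then show ?thesis using that t(2) by metis
    qed
    note st = saturated_structure[OF tn t(2) y xt x(2)]
    have "a t t = 0" by (rule saturated_uncharged[OF tn t(2) y])
    then have "t \<notin> D t" by (simp add: nb_def)
    moreover have "m \<in> M \<and> (\<exists>p. D m = {t, p} \<and> p \<in> D x \<and> p \<notin> D t)" if "m \<noteq> x"
    proof -
      have "m \<in> D t - {x}" using m that by simp
      with st have "card (D m) \<noteq> 4 \<and> (\<exists>p. p \<noteq> t \<and> p \<notin> D t \<and> D m = {t, p} \<and> p \<in> D x)" by simp
      moreover have "m < n" using m by (rule D_less)
      ultimately show ?thesis using m t(1) unfolding M_def by auto
    qed
    ultimately show ?thesis by blast
  qed
  \<comment> \<open>An unsaturated t has room for x and for its partner y only.\<close>
  have unsat_row: "\<exists>y. D t = {x, y} \<and> D y = {s, t} \<and> y \<in> M \<and> y \<in> D s \<and> t \<notin> D s \<and> y \<noteq> x" if t: "t \<in> D x" "card (D t) \<noteq> 4" for t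
  proof -
    have tn: "t < n" using t D_less by blast
    have ts: "t \<noteq> s" using t s by auto
    obtain y where y: "y \<in> D s - {x}" "D y = {s, t}" "card (D y) \<noteq> 4" "t \<notin> D s" "y \<in> D t"
      using partner[OF t(1) ts] by blast
    have xt: "x \<in> D t" using D_sym[OF xn t(1)] .
    have "2 \<le> card (D t)" using card_mono[of "D t" "{x, y}"] xt y by auto
    then have "card (D t) = 2" using card_D[OF tn] t(2) by auto
    then obtain k where "D t = {x, k}" "k \<noteq> x" using card2_cases[OF _ xt] by blast
    then have "D t = {x, y}" using y by auto
    moreover have "y \<in> M" unfolding M_def using y t D_less by blast
    ultimately show ?thesis using y by blast
  qed
  have in_M: "D m \<subseteq> D x \<and> m \<notin> D m" if m: "m \<in> M" for m
  proof -
    obtain t where t: "t \<in> D x" "m \<in> D t" and m4: "card (D m) \<noteq> 4" using m unfolding M_def by blast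
    have mx: "m \<noteq> x" using m4 x by auto
    show ?thesis
    proof (cases "card (D t) = 4")
      case True
      then obtain p where "D m = {t, p}" "p \<in> D x" "p \<notin> D t" using sat_row[OF t(1) True t(2)] mx by blast
      then show ?thesis using t True m4 by auto
    next
      case False
      obtain y where y: "D t = {x, y}" "D y = {s, t}" "y \<in> D s" "t \<notin> D s" using unsat_row[OF t(1) False] by blast
      then have "m = y" using t(2) mx by auto
      then show ?thesis using y sx t(1) sDs by auto
    qed
  qed
  have closed: "l \<in> C" if k: "k \<in> C" and l: "l \<in> D k" for k l
  proof -
    consider "k = x" | "k \<in> D x" "card (D k) = 4" | "k \<in> D x" "card (D k) \<noteq> 4" | "k \<in> M"
      using k unfolding C_def by blast
    then show ?thesis
    proof cases
      case 1 then show ?thesis using l unfolding C_def by blast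
    next
      case 2 then show ?thesis using sat_row[OF 2 l] unfolding C_def by blast
    next
      case 3 then show ?thesis using unsat_row[OF 3] l unfolding C_def by blast
    next
      case 4 then show ?thesis using in_M[OF 4] l unfolding C_def by blast
    qed
  qed
  have irr: "k \<notin> D k" if kC: "k \<in> C" for k
  proof
    assume kk: "k \<in> D k"
    consider "k = x" | "k \<in> D x" "card (D k) = 4" "k \<noteq> x" | "k \<in> D x" "card (D k) \<noteq> 4" | "k \<in> M"
      using kC unfolding C_def by blast
    then show False
    proof cases
      case 1
      then show False using partner[of x] kk x sDs by blast
    next
      case 2 then show False using sat_row[OF 2(1,2) kk] kk by blast
    next
      case 3
      obtain y where y: "D k = {x, y}" "y \<in> D s" "k \<notin> D s" using unsat_row[OF 3] by blast
      have "k = x \<or> k = y" using kk unfolding y(1) by simp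
      then show False using x y(2,3) by blast
    next
      case 4 then show False using in_M[OF 4] kk by simp
    qed
  qed
  show False
  proof (rule closed_charged[of x C])
    show "x \<in> C" by (simp add: C_def)
    show kn: "k < n" if "k \<in> C" for k
      using that xn D_less unfolding C_def M_def by blast
    show "a k k = 0" if "k \<in> C" for k
      using irr[OF that] kn[OF that] D_zero by blast
    show "l \<in> C" if "k \<in> C" "l < n" "a k l \<noteq> 0" for k l
      using closed that by (simp add: nb_def)
  qed
qed

text \<open>Saturation spreads along edges, so by connectedness it holds everywhere or nowhere. If
  nowhere, all absolute row sums are at most 2 and a charged vertex can be doubled, after a change
  of sign if its charge is -1.\<close>

theorem saturated:
  assumes "i < n" shows "card (D i) = 4"
proof (rule ccontr)
  assume i4: "card (D i) \<noteq> 4"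
  show False
  proof (cases "\<exists>s<n. card (D s) = 4")
    case True
    then obtain s where s: "s < n" "card (D s) = 4" by blast
    have "{k. k < n \<and> card (D k) = 4} = {..<n}"
    proof (rule connD[OF conn, of s])
      fix x y assume x: "x \<in> {k. k < n \<and> card (D k) = 4}" and y: "y < n" "a x y \<noteq> 0"
      then have "y \<in> D x" by (simp add: nb_def)
      then show "y \<in> {k. k < n \<and> card (D k) = 4}" using saturated_neighbours[of x y] x y by simp
    qed (use s in auto)
    then show False using assms i4 by auto
  next
    case False
    have le2: "card (D k) \<le> 2" if "k < n" for k using card_D[OF that] False that by auto
    have row: "(\<Sum>j<n. cmod (a k j)) \<le> 2" if "k < n" for k
    proof -
      have "(\<Sum>j<n. cmod (a k j)) = (\<Sum>j<n. if a k j \<noteq> 0 then 1 else 0)"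
        using entries[OF that] by (intro sum.cong) (auto simp: unit_def)
      also have "\<dots> = (\<Sum>j\<in>D k. 1)"
        unfolding nb_def by (subst sum.inter_filter[symmetric]) (auto intro!: sum.cong)
      finally show ?thesis using le2[OF that] by simp
    qed
    obtain v where v: "v < n" "a v v \<noteq> 0" using charged by blast
    then consider "a v v = 1" | "a v v = -1" using diag_cases[OF v(1)] by auto
    then show False
    proof cases
      case 1
      then show False using twin_extendable[OF cyc row v(1)] nonext by blast
    next
      case 2
      have "extendable n (\<lambda>i j. - a i j)"
        by (rule twin_extendable[OF cyc_neg[OF cyc] _ v(1)]) (use row 2 in auto)
      then show False using extendable_neg nonext by blast
    qed
  qed
qed

end

section \<open>Classification of the saturated matrices\<close>

lemma omega_simps:
  "omega * omega = omega - 1" "omega * (omega * z) = omega * z - z" "cnj omega = 1 - omega"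
  using omega_sq cnj_omega by (simp_all add: mult.assoc[symmetric]) (simp add: algebra_simps)

lemma unit_omega [simp]: "unit omega" "unit (- omega)" "unit (omega - 1)"
proof -
  show o: "unit omega" unfolding unit_def by (simp add: cmod_def power2_eq_square)
  then show "unit (- omega)" by (rule unit_uminus)
  show "unit (omega - 1)" using unit_mult[OF o o] by (simp add: omega_sq)
qed

lemma graph_isoI:
  assumes "bij_betw \<phi> (fst G) {..<n}" "\<And>v. unit (g v)" "s \<in> {1, - 1}"
    and "\<And>u v. u \<in> fst G \<Longrightarrow> v \<in> fst G \<Longrightarrow> a (\<phi> u) (\<phi> v) = s * (g u * snd G u v * cnj (g v))"
  shows "graph_iso n a G"
  unfolding graph_iso_def
  using assms by (intro exI[of _ \<phi>] exI[of _ g] exI[of _ s] exI[of _ id]) auto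

text \<open>Maximality is now replaced by its consequence A^2 = 4. Together with unit entries and
  connectedness this is stable under switching and negation, so every case may normalise weights
  first.\<close>

locale sat_mat =
  fixes n :: nat and a :: "nat \<Rightarrow> nat \<Rightarrow> complex"
  assumes herm: "\<And>i j. i < n \<Longrightarrow> j < n \<Longrightarrow> a j i = cnj (a i j)"
    and entries: "\<And>i j. i < n \<Longrightarrow> j < n \<Longrightarrow> a i j \<noteq> 0 \<Longrightarrow> unit (a i j)"
    and conn: "conn n a"
    and orth: "\<And>i j. i < n \<Longrightarrow> j < n \<Longrightarrow> i \<noteq> j \<Longrightarrow> sq n a i j = 0"
    and degree: "\<And>i. i < n \<Longrightarrow> card (nb n a i) = 4"
begin

abbreviation "D \<equiv> nb n a"

lemma D_less: "j \<in> D i \<Longrightarrow> j < n" by (simp add: nb_def)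

lemma D_iff: "j < n \<Longrightarrow> j \<in> D i \<longleftrightarrow> a i j \<noteq> 0" by (simp add: nb_def)

lemma D_sym: "i < n \<Longrightarrow> j \<in> D i \<Longrightarrow> i \<in> D j"
  using herm[of i j] by (simp add: nb_def)

lemma D_zero: "j < n \<Longrightarrow> j \<notin> D i \<Longrightarrow> a i j = 0" by (simp add: nb_def)

lemma unit_D: "i < n \<Longrightarrow> j \<in> D i \<Longrightarrow> unit (a i j)"
  using entries by (simp add: nb_def)

lemma orth4:
  assumes "D i = {p, q, r, t}" "distinct [p, q, r, t]" "i < n" "j < n" "i \<noteq> j"
  shows "a i p * a p j + a i q * a q j + a i r * a r j + a i t * a t j = 0"
proof -
  have "sq n a i j = (\<Sum>k\<in>D i. a i k * a k j)"
    unfolding sq_def by (rule sum.mono_neutral_right) (auto simp: nb_def)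
  then show ?thesis using orth[OF assms(3-5)] assms(1,2) by (simp add: add.assoc)
qed

lemma diag_cases: assumes "i < n" shows "a i i \<in> {0, 1, -1}"
proof (cases "a i i = 0")
  case False
  have u: "unit (a i i)" by (rule entries[OF assms assms False])
  have "Im (a i i) = 0" using herm[OF assms assms] by (simp add: complex_eq_iff)
  then obtain k where k: "a i i = of_int k" using u eis_real unfolding unit_def by blast
  have "\<bar>k\<bar> = 1" using u k by (simp add: unit_def norm_of_int)
  then have "k = 1 \<or> k = -1" by linarith
  then show ?thesis using k by auto
qed simp

lemma closed_all:
  assumes "v \<in> C" "\<And>x. x \<in> C \<Longrightarrow> D x \<subseteq> C" "\<And>x. x \<in> C \<Longrightarrow> x < n"
  shows "C = {..<n}"
  by (rule connD[OF conn assms(1,3)]) (use assms(2) in \<open>auto simp: nb_def\<close>)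

section \<open>Explicit isomorphisms with the sporadic graphs\<close>

text \<open>The orthogonality relations are solved with the star at v normalised to 1, while the
  listed graph has other weights; \<open>g\<close> is the switching between the two. The other
  sporadic graphs follow the same scheme.\<close>

lemma graph_iso_S5:
  assumes d: "distinct [v, x, y, z, w]"
    and D: "D v = {v, x, y, z}" "D x = {v, y, z, w}" "D y = {v, x, z, w}" "D z = {v, x, y, w}" "D w = {w, x, y, z}"
    and E: "a v v = 1" "a w w = 1" "a v x = 1" "a v y = 1" "a v z = 1" "a x y = - omega" "a x z = omega - 1" "a y z = - omega" "a w x = 1" "a w y = omega - 1" "a w z = - omega"
  shows "graph_iso n a graph_S5"
proof -
  have lt: "v < n" "x < n" "y < n" "z < n" "w < n"
    using D_less[of v x] D_less[of x v] D_less[of y v] D_less[of z v] D_less[of w x] unfolding D by simp_all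
  \<comment> \<open>The reversed list supplies the inequalities in the other orientation for
    rewriting.\<close>
  have d': "distinct [w, z, y, x, v]" using d by auto
  have all: "{v, x, y, z, w} = {..<n}"
    by (rule closed_all[of v]) (auto simp: D lt)
  note E' = herm[OF lt(1,2), unfolded E] herm[OF lt(1,3), unfolded E] herm[OF lt(1,4), unfolded E] herm[OF lt(2,3), unfolded E] herm[OF lt(2,4), unfolded E] herm[OF lt(3,4), unfolded E] herm[OF lt(5,2), unfolded E] herm[OF lt(5,3), unfolded E] herm[OF lt(5,4), unfolded E]
  define \<phi> where "\<phi> = (\<lambda>c. if c = VA then x else if c = VB then y else if c = VC then w else if c = VD then v else z)"
  define g :: "letter \<Rightarrow> complex" where "g = (\<lambda>c. if c = VA then 1 else if c = VB then omega - 1 else if c = VC then - omega else if c = VD then 1 else 1)"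
  have \<phi>: "\<phi> VA = x" "\<phi> VB = y" "\<phi> VC = w" "\<phi> VD = v" "\<phi> VE = z" by (simp_all add: \<phi>_def)
  have g: "g VA = 1" "g VB = omega - 1" "g VC = - omega" "g VD = 1" "g VE = 1" by (simp_all add: g_def)
  show ?thesis
  proof (rule graph_isoI[of \<phi> _ n g "1"])
    show "bij_betw \<phi> (fst graph_S5) {..<n}"
      unfolding all[symmetric] graph_S5_def fst_conv bij_betw_def using d by (simp add: \<phi>) blast
    show "unit (g c)" for c by (simp add: g_def)
    have "\<forall>b\<in>fst graph_S5. \<forall>c\<in>fst graph_S5. a (\<phi> b) (\<phi> c) = 1 * (g b * snd graph_S5 b c * cnj (g c))"
      unfolding graph_S5_def fst_conv snd_conv
      apply (simp only: ball_simps \<phi> g)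
      apply (simp add: weight_fun_def charges_def edges_def)
      using d d' apply (simp add: D E E' D_zero lt)
      apply (simp add: omega_simps algebra_simps)?
      done
    then show "b \<in> fst graph_S5 \<Longrightarrow> c \<in> fst graph_S5 \<Longrightarrow> a (\<phi> b) (\<phi> c) = 1 * (g b * snd graph_S5 b c * cnj (g c))" for b c
      by blast
  qed simp
qed

lemma graph_iso_S6:
  assumes d: "distinct [v, p, q, x, y, z]"
    and D: "D v = {v, x, y, z}" "D p = {p, x, y, z}" "D q = {q, x, y, z}" "D x = {x, v, p, q}" "D y = {y, v, p, q}" "D z = {z, v, p, q}"
    and E: "a v v = 1" "a p p = 1" "a q q = 1" "a x x = -1" "a y y = -1" "a z z = -1" "a v x = 1" "a v y = 1" "a v z = 1" "a p x = 1" "a p y = omega - 1" "a p z = - omega" "a q x = 1" "a q y = - omega" "a q z = omega - 1"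
  shows "graph_iso n a graph_S6"
proof -
  have lt: "v < n" "p < n" "q < n" "x < n" "y < n" "z < n"
    using D_less[of v x] D_less[of p x] D_less[of q x] D_less[of x v] D_less[of y v] D_less[of z v] unfolding D by simp_all
  have d': "distinct [z, y, x, q, p, v]" using d by auto
  have all: "{v, p, q, x, y, z} = {..<n}"
    by (rule closed_all[of v]) (auto simp: D lt)
  note E' = herm[OF lt(1,4), unfolded E] herm[OF lt(1,5), unfolded E] herm[OF lt(1,6), unfolded E] herm[OF lt(2,4), unfolded E] herm[OF lt(2,5), unfolded E] herm[OF lt(2,6), unfolded E] herm[OF lt(3,4), unfolded E] herm[OF lt(3,5), unfolded E] herm[OF lt(3,6), unfolded E]
  define \<phi> where "\<phi> = (\<lambda>c. if c = VA then x else if c = VB then v else if c = VC then y else if c = VD then p else if c = VE then z else q)"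
  define g :: "letter \<Rightarrow> complex" where "g = (\<lambda>c. if c = VA then 1 else if c = VB then omega - 1 else if c = VC then omega - 1 else if c = VD then - omega else if c = VE then omega - 1 else 1)"
  have \<phi>: "\<phi> VA = x" "\<phi> VB = v" "\<phi> VC = y" "\<phi> VD = p" "\<phi> VE = z" "\<phi> VF = q" by (simp_all add: \<phi>_def)
  have g: "g VA = 1" "g VB = omega - 1" "g VC = omega - 1" "g VD = - omega" "g VE = omega - 1" "g VF = 1" by (simp_all add: g_def)
  show ?thesis
  proof (rule graph_isoI[of \<phi> _ n g "1"])
    show "bij_betw \<phi> (fst graph_S6) {..<n}"
      unfolding all[symmetric] graph_S6_def fst_conv bij_betw_def using d by (simp add: \<phi>) blast
    show "unit (g c)" for c by (simp add: g_def)
    have "\<forall>b\<in>fst graph_S6. \<forall>c\<in>fst graph_S6. a (\<phi> b) (\<phi> c) = 1 * (g b * snd graph_S6 b c * cnj (g c))"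
      unfolding graph_S6_def fst_conv snd_conv
      apply (simp only: ball_simps \<phi> g)
      apply (simp add: weight_fun_def charges_def edges_def)
      using d d' apply (simp add: D E E' D_zero lt)
      apply (simp add: omega_simps algebra_simps)?
      done
    then show "b \<in> fst graph_S6 \<Longrightarrow> c \<in> fst graph_S6 \<Longrightarrow> a (\<phi> b) (\<phi> c) = 1 * (g b * snd graph_S6 b c * cnj (g c))" for b c
      by blast
  qed simp
qed

lemma graph_iso_S6_dagger:
  assumes d: "distinct [v, x, y, z, p, q]"
    and D: "D v = {v, x, y, z}" "D x = {x, v, p, q}" "D y = {v, z, p, q}" "D z = {v, y, p, q}" "D p = {x, q, y, z}" "D q = {x, p, y, z}"
    and E: "a v v = 1" "a x x = -1" "a v x = 1" "a v y = 1" "a v z = 1" "a y z = -1" "a x p = 1" "a x q = 1" "a p q = 1" "a y p = omega - 1" "a y q = - omega" "a z p = - omega" "a z q = omega - 1"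
  shows "graph_iso n a graph_S6_dagger"
proof -
  have lt: "v < n" "x < n" "y < n" "z < n" "p < n" "q < n"
    using D_less[of v x] D_less[of x v] D_less[of y v] D_less[of z v] D_less[of p x] D_less[of q x] unfolding D by simp_all
  have d': "distinct [q, p, z, y, x, v]" using d by auto
  have all: "{v, x, y, z, p, q} = {..<n}"
    by (rule closed_all[of v]) (auto simp: D lt)
  note E' = herm[OF lt(1,2), unfolded E] herm[OF lt(1,3), unfolded E] herm[OF lt(1,4), unfolded E] herm[OF lt(3,4), unfolded E] herm[OF lt(2,5), unfolded E] herm[OF lt(2,6), unfolded E] herm[OF lt(5,6), unfolded E] herm[OF lt(3,5), unfolded E] herm[OF lt(3,6), unfolded E] herm[OF lt(4,5), unfolded E] herm[OF lt(4,6), unfolded E]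
  define \<phi> where "\<phi> = (\<lambda>c. if c = VA then y else if c = VB then q else if c = VC then x else if c = VD then v else if c = VE then z else p)"
  define g :: "letter \<Rightarrow> complex" where "g = (\<lambda>c. if c = VA then 1 else if c = VB then - omega else if c = VC then - omega else if c = VD then - omega else if c = VE then 1 else - omega)"
  have \<phi>: "\<phi> VA = y" "\<phi> VB = q" "\<phi> VC = x" "\<phi> VD = v" "\<phi> VE = z" "\<phi> VF = p" by (simp_all add: \<phi>_def)
  have g: "g VA = 1" "g VB = - omega" "g VC = - omega" "g VD = - omega" "g VE = 1" "g VF = - omega" by (simp_all add: g_def)
  show ?thesis
  proof (rule graph_isoI[of \<phi> _ n g "1"])
    show "bij_betw \<phi> (fst graph_S6_dagger) {..<n}"
      unfolding all[symmetric] graph_S6_dagger_def fst_conv bij_betw_def using d by (simp add: \<phi>) blast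
    show "unit (g c)" for c by (simp add: g_def)
    have "\<forall>b\<in>fst graph_S6_dagger. \<forall>c\<in>fst graph_S6_dagger. a (\<phi> b) (\<phi> c) = 1 * (g b * snd graph_S6_dagger b c * cnj (g c))"
      unfolding graph_S6_dagger_def fst_conv snd_conv
      apply (simp only: ball_simps \<phi> g)
      apply (simp add: weight_fun_def charges_def edges_def)
      using d d' apply (simp add: D E E' D_zero lt)
      apply (simp add: omega_simps algebra_simps)?
      done
    then show "b \<in> fst graph_S6_dagger \<Longrightarrow> c \<in> fst graph_S6_dagger \<Longrightarrow> a (\<phi> b) (\<phi> c) = 1 * (g b * snd graph_S6_dagger b c * cnj (g c))" for b c
      by blast
  qed simp
qed

lemma graph_iso_S7:
  assumes d: "distinct [v, x, y, z, p, q, r]"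
    and D: "D v = {v, x, y, z}" "D x = {x, v, p, q}" "D y = {y, v, p, r}" "D z = {z, v, q, r}" "D p = {x, y, q, r}" "D q = {x, z, p, r}" "D r = {y, z, p, q}"
    and E: "a v v = 1" "a x x = -1" "a y y = -1" "a z z = -1" "a v x = 1" "a v y = 1" "a v z = 1" "a x p = 1" "a y p = -1" "a x q = 1" "a z q = -1" "a y r = 1" "a z r = -1" "a p q = 1" "a p r = -1" "a q r = 1"
  shows "graph_iso n a graph_S7"
proof -
  have lt: "v < n" "x < n" "y < n" "z < n" "p < n" "q < n" "r < n"
    using D_less[of v x] D_less[of x v] D_less[of y v] D_less[of z v] D_less[of p x] D_less[of q x] D_less[of r y] unfolding D by simp_all
  have d': "distinct [r, q, p, z, y, x, v]" using d by auto
  have all: "{v, x, y, z, p, q, r} = {..<n}"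
    by (rule closed_all[of v]) (auto simp: D lt)
  note E' = herm[OF lt(1,2), unfolded E] herm[OF lt(1,3), unfolded E] herm[OF lt(1,4), unfolded E] herm[OF lt(2,5), unfolded E] herm[OF lt(3,5), unfolded E] herm[OF lt(2,6), unfolded E] herm[OF lt(4,6), unfolded E] herm[OF lt(3,7), unfolded E] herm[OF lt(4,7), unfolded E] herm[OF lt(5,6), unfolded E] herm[OF lt(5,7), unfolded E] herm[OF lt(6,7), unfolded E]
  define \<phi> where "\<phi> = (\<lambda>c. if c = VA then x else if c = VB then p else if c = VC then q else if c = VD then v else if c = VE then y else if c = VF then z else r)"
  define g :: "letter \<Rightarrow> complex" where "g = (\<lambda>c. if c = VA then 1 else if c = VB then -1 else if c = VC then 1 else if c = VD then -1 else if c = VE then 1 else if c = VF then 1 else -1)"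
  have \<phi>: "\<phi> VA = x" "\<phi> VB = p" "\<phi> VC = q" "\<phi> VD = v" "\<phi> VE = y" "\<phi> VF = z" "\<phi> VG = r" by (simp_all add: \<phi>_def)
  have g: "g VA = 1" "g VB = -1" "g VC = 1" "g VD = -1" "g VE = 1" "g VF = 1" "g VG = -1" by (simp_all add: g_def)
  show ?thesis
  \<comment> \<open>S_7 has three charges 1 and one charge -1, the opposite of the charges assumed
    here; hence the sign.\<close>
  proof (rule graph_isoI[of \<phi> _ n g "- 1"])
    show "bij_betw \<phi> (fst graph_S7) {..<n}"
      unfolding all[symmetric] graph_S7_def fst_conv bij_betw_def using d by (simp add: \<phi>) blast
    show "unit (g c)" for c by (simp add: g_def)
    have "\<forall>b\<in>fst graph_S7. \<forall>c\<in>fst graph_S7. a (\<phi> b) (\<phi> c) = - 1 * (g b * snd graph_S7 b c * cnj (g c))"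
      unfolding graph_S7_def fst_conv snd_conv
      apply (simp only: ball_simps \<phi> g)
      apply (simp add: weight_fun_def charges_def edges_def)
      using d d' apply (simp add: D E E' D_zero lt)
      apply (simp add: omega_simps algebra_simps)?
      done
    then show "b \<in> fst graph_S7 \<Longrightarrow> c \<in> fst graph_S7 \<Longrightarrow> a (\<phi> b) (\<phi> c) = - 1 * (g b * snd graph_S7 b c * cnj (g c))" for b c
      by blast
  qed simp
qed

lemma graph_iso_S8:
  assumes d: "distinct [v, p, q, r, x, y, z, t]"
    and D: "D v = {v, x, y, z}" "D p = {p, x, y, t}" "D q = {q, x, z, t}" "D r = {r, y, z, t}" "D x = {x, v, p, q}" "D y = {y, v, p, r}" "D z = {z, v, q, r}" "D t = {t, p, q, r}"
    and E: "a v v = 1" "a p p = 1" "a q q = 1" "a r r = 1" "a x x = -1" "a y y = -1" "a z z = -1" "a t t = -1" "a v x = 1" "a v y = 1" "a v z = 1" "a x p = 1" "a y p = -1" "a x q = 1" "a z q = -1" "a y r = 1" "a z r = -1" "a p t = 1" "a q t = -1" "a r t = 1"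
  shows "graph_iso n a graph_S8"
proof -
  have lt: "v < n" "p < n" "q < n" "r < n" "x < n" "y < n" "z < n" "t < n"
    using D_less[of v x] D_less[of p x] D_less[of q x] D_less[of r y] D_less[of x v] D_less[of y v] D_less[of z v] D_less[of t p] unfolding D by simp_all
  have d': "distinct [t, z, y, x, r, q, p, v]" using d by auto
  have all: "{v, p, q, r, x, y, z, t} = {..<n}"
    by (rule closed_all[of v]) (auto simp: D lt)
  note E' = herm[OF lt(1,5), unfolded E] herm[OF lt(1,6), unfolded E] herm[OF lt(1,7), unfolded E] herm[OF lt(5,2), unfolded E] herm[OF lt(6,2), unfolded E] herm[OF lt(5,3), unfolded E] herm[OF lt(7,3), unfolded E] herm[OF lt(6,4), unfolded E] herm[OF lt(7,4), unfolded E] herm[OF lt(2,8), unfolded E] herm[OF lt(3,8), unfolded E] herm[OF lt(4,8), unfolded E]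
  define \<phi> where "\<phi> = (\<lambda>c. if c = VA then x else if c = VB then v else if c = VC then p else if c = VD then y else if c = VE then q else if c = VF then z else if c = VG then t else r)"
  define g :: "letter \<Rightarrow> complex" where "g = (\<lambda>c. if c = VA then 1 else if c = VB then 1 else if c = VC then -1 else if c = VD then 1 else if c = VE then 1 else if c = VF then -1 else if c = VG then -1 else 1)"
  have \<phi>: "\<phi> VA = x" "\<phi> VB = v" "\<phi> VC = p" "\<phi> VD = y" "\<phi> VE = q" "\<phi> VF = z" "\<phi> VG = t" "\<phi> VH = r" by (simp_all add: \<phi>_def)
  have g: "g VA = 1" "g VB = 1" "g VC = -1" "g VD = 1" "g VE = 1" "g VF = -1" "g VG = -1" "g VH = 1" by (simp_all add: g_def)
  show ?thesis
  proof (rule graph_isoI[of \<phi> _ n g "1"])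
    show "bij_betw \<phi> (fst graph_S8) {..<n}"
      unfolding all[symmetric] graph_S8_def fst_conv bij_betw_def using d by (simp add: \<phi>) blast
    show "unit (g c)" for c by (simp add: g_def)
    have "\<forall>b\<in>fst graph_S8. \<forall>c\<in>fst graph_S8. a (\<phi> b) (\<phi> c) = 1 * (g b * snd graph_S8 b c * cnj (g c))"
      unfolding graph_S8_def fst_conv snd_conv
      apply (simp only: ball_simps \<phi> g)
      apply (simp add: weight_fun_def charges_def edges_def)
      using d d' apply (simp add: D E E' D_zero lt)
      apply (simp add: omega_simps algebra_simps)?
      done
    then show "b \<in> fst graph_S8 \<Longrightarrow> c \<in> fst graph_S8 \<Longrightarrow> a (\<phi> b) (\<phi> c) = 1 * (g b * snd graph_S8 b c * cnj (g c))" for b c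
      by blast
  qed simp
qed

lemma graph_iso_S8_prime:
  assumes d: "distinct [v, x, y, z, p, q, w, t]"
    and D: "D v = {v, x, y, z}" "D x = {x, v, p, q}" "D y = {v, z, p, w}" "D z = {v, y, q, w}" "D p = {x, q, y, t}" "D q = {x, p, z, t}" "D w = {w, y, z, t}" "D t = {t, p, q, w}"
    and E: "a v v = 1" "a x x = -1" "a w w = -1" "a t t = 1" "a v x = 1" "a v y = 1" "a v z = 1" "a y z = -1" "a x p = 1" "a x q = 1" "a p q = 1" "a y p = -1" "a z q = -1" "a y w = 1" "a z w = -1" "a p t = 1" "a q t = -1" "a w t = 1"
  shows "graph_iso n a graph_S8_prime"
proof -
  have lt: "v < n" "x < n" "y < n" "z < n" "p < n" "q < n" "w < n" "t < n"
    using D_less[of v x] D_less[of x v] D_less[of y v] D_less[of z v] D_less[of p x] D_less[of q x] D_less[of w y] D_less[of t p] unfolding D by simp_all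
  have d': "distinct [t, w, q, p, z, y, x, v]" using d by auto
  have all: "{v, x, y, z, p, q, w, t} = {..<n}"
    by (rule closed_all[of v]) (auto simp: D lt)
  note E' = herm[OF lt(1,2), unfolded E] herm[OF lt(1,3), unfolded E] herm[OF lt(1,4), unfolded E] herm[OF lt(3,4), unfolded E] herm[OF lt(2,5), unfolded E] herm[OF lt(2,6), unfolded E] herm[OF lt(5,6), unfolded E] herm[OF lt(3,5), unfolded E] herm[OF lt(4,6), unfolded E] herm[OF lt(3,7), unfolded E] herm[OF lt(4,7), unfolded E] herm[OF lt(5,8), unfolded E] herm[OF lt(6,8), unfolded E] herm[OF lt(7,8), unfolded E]
  define \<phi> where "\<phi> = (\<lambda>c. if c = VA then x else if c = VB then v else if c = VC then p else if c = VD then y else if c = VE then q else if c = VF then z else if c = VG then t else w)"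
  define g :: "letter \<Rightarrow> complex" where "g = (\<lambda>c. if c = VA then 1 else if c = VB then 1 else if c = VC then 1 else if c = VD then 1 else if c = VE then 1 else if c = VF then -1 else if c = VG then 1 else 1)"
  have \<phi>: "\<phi> VA = x" "\<phi> VB = v" "\<phi> VC = p" "\<phi> VD = y" "\<phi> VE = q" "\<phi> VF = z" "\<phi> VG = t" "\<phi> VH = w" by (simp_all add: \<phi>_def)
  have g: "g VA = 1" "g VB = 1" "g VC = 1" "g VD = 1" "g VE = 1" "g VF = -1" "g VG = 1" "g VH = 1" by (simp_all add: g_def)
  show ?thesis
  proof (rule graph_isoI[of \<phi> _ n g "1"])
    show "bij_betw \<phi> (fst graph_S8_prime) {..<n}"
      unfolding all[symmetric] graph_S8_prime_def fst_conv bij_betw_def using d by (simp add: \<phi>) blast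
    show "unit (g c)" for c by (simp add: g_def)
    have "\<forall>b\<in>fst graph_S8_prime. \<forall>c\<in>fst graph_S8_prime. a (\<phi> b) (\<phi> c) = 1 * (g b * snd graph_S8_prime b c * cnj (g c))"
      unfolding graph_S8_prime_def fst_conv snd_conv
      apply (simp only: ball_simps \<phi> g)
      apply (simp add: weight_fun_def charges_def edges_def)
      using d d' apply (simp add: D E E' D_zero lt)
      apply (simp add: omega_simps algebra_simps)?
      done
    then show "b \<in> fst graph_S8_prime \<Longrightarrow> c \<in> fst graph_S8_prime \<Longrightarrow> a (\<phi> b) (\<phi> c) = 1 * (g b * snd graph_S8_prime b c * cnj (g c))" for b c
      by blast
  qed simp
qed
end

text \<open>Three numbers of modulus 1 with sum 0 form an equilateral triangle. As one of them is 1,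
  the others are the primitive cube roots of unity, omega - 1 = omega^2 and -omega =
  omega^4.\<close>

lemma cube_roots:
  assumes "cmod b = 1" "cmod c = 1" "1 + (b + c) = 0"
  shows "b = omega - 1 \<and> c = - omega \<or> b = - omega \<and> c = omega - 1"
proof -
  have c: "c = - 1 - b" using assms(3) by (simp add: eq_neg_iff_add_eq_0 algebra_simps)
  have 1: "(Re b)\<^sup>2 + (Im b)\<^sup>2 = 1" using assms(1) cmod_power2[of b] by simp
  have 2: "(1 + Re b)\<^sup>2 + (Im b)\<^sup>2 = 1" using assms(2) cmod_power2[of c] unfolding c by (simp add: power2_eq_square algebra_simps)
  from 1 2 have re: "Re b = - 1/2" by (simp add: power2_eq_square algebra_simps)
  with 1 have "(Im b)\<^sup>2 = (sqrt 3 / 2)\<^sup>2" by (simp add: power2_eq_square)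
  then have "Im b = sqrt 3 / 2 \<or> Im b = - (sqrt 3 / 2)" by (simp only: power2_eq_iff)
  then show ?thesis unfolding c using re by (auto simp: complex_eq_iff)
qed

lemma nb_neg: "nb n (\<lambda>i j. - a i j) = nb n a"
  by (auto simp: nb_def fun_eq_iff)

text \<open>Edge lists of forests, built from the end: the child of an entry does not occur in the
  rest of the list, so its unit can be chosen without disturbing the edges normalised
  before.\<close>

fun rooted :: "(nat \<times> nat) list \<Rightarrow> bool" where
  "rooted [] \<longleftrightarrow> True"
| "rooted ((p, c) # es) \<longleftrightarrow> p \<noteq> c \<and> (\<forall>(q, d)\<in>set es. c \<noteq> q \<and> c \<noteq> d) \<and> rooted es"

context sat_mat
begin

lemma negate: "sat_mat n (\<lambda>i j. - a i j)"
proof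
  show "conn n (\<lambda>i j. - a i j)" using conn unfolding conn_def by simp
  show "sq n (\<lambda>i j. - a i j) i j = 0" if "i < n" "j < n" "i \<noteq> j" for i j
    using orth[OF that] by (simp add: sq_def)
  show "card (nb n (\<lambda>i j. - a i j) i) = 4" if "i < n" for i
    using degree[OF that] by (simp add: nb_neg)
  show "- a j i = cnj (- a i j)" if "i < n" "j < n" for i j using herm[OF that] by simp
  show "unit (- a i j)" if "i < n" "j < n" "- a i j \<noteq> 0" for i j
    using entries[OF that(1,2)] that(3) by (intro unit_uminus) simp
qed

lemma switch:
  assumes h: "\<And>i. unit (h i)"
  shows "sat_mat n (\<lambda>i j. h i * a i j * cnj (h j))"
proof
  have z: "h i * a i j * cnj (h j) = 0 \<longleftrightarrow> a i j = 0" for i j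
    using unit_nz[OF h] by simp
  show "conn n (\<lambda>i j. h i * a i j * cnj (h j))" using conn unfolding conn_def z .
  show "sq n (\<lambda>i j. h i * a i j * cnj (h j)) i j = 0" if "i < n" "j < n" "i \<noteq> j" for i j
  proof -
    have "sq n (\<lambda>i j. h i * a i j * cnj (h j)) i j = (\<Sum>k<n. h i * (a i k * a k j) * cnj (h j))"
      unfolding sq_def
    proof (intro sum.cong refl)
      fix k
      have "h i * a i k * cnj (h k) * (h k * a k j * cnj (h j)) = h i * (a i k * a k j) * cnj (h j) * (cnj (h k) * h k)"
        by (simp add: mult_ac)
      then show "h i * a i k * cnj (h k) * (h k * a k j * cnj (h j)) = h i * (a i k * a k j) * cnj (h j)"
        using unit_cnj_mult[OF h[of k]] by simp
    qed
    also have "\<dots> = h i * sq n a i j * cnj (h j)"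
      by (simp add: sq_def sum_distrib_left sum_distrib_right)
    finally show ?thesis using orth[OF that] by simp
  qed
  show "card (nb n (\<lambda>i j. h i * a i j * cnj (h j)) i) = 4" if "i < n" for i
    using degree[OF that] nb_switch[OF h that] by simp
  show "h j * a j i * cnj (h i) = cnj (h i * a i j * cnj (h j))" if "i < n" "j < n" for i j
    using herm[OF that] by simp
  show "unit (h i * a i j * cnj (h j))" if "i < n" "j < n" "h i * a i j * cnj (h j) \<noteq> 0" for i j
    using entries[OF that(1,2)] that(3) h by (intro unit_mult unit_cnj) auto
qed

lemma tree_switch:
  assumes "rooted es" "\<forall>(p, c)\<in>set es. c \<in> D p \<and> p < n"
  shows "\<exists>h. (\<forall>i. unit (h i)) \<and> (\<forall>(p, c)\<in>set es. h p * a p c * cnj (h c) = 1)"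
  using assms
proof (induction es)
  case Nil
  show ?case by (intro exI[of _ "\<lambda>_. 1"]) simp
next
  case (Cons e es)
  obtain p c where e: "e = (p, c)" by (cases e)
  have pc: "p \<noteq> c" "\<forall>(q, d)\<in>set es. c \<noteq> q \<and> c \<noteq> d" "rooted es" and u: "c \<in> D p" "p < n"
    using Cons.prems unfolding e by auto
  obtain h where h: "\<forall>i. unit (h i)" "\<forall>(p, c)\<in>set es. h p * a p c * cnj (h c) = 1"
    using Cons.IH[OF pc(3)] Cons.prems(2) by auto
  define k where "k = h(c := h p * a p c)"
  have un: "unit (h p * a p c)" using h(1) unit_D[OF u(2,1)] by (intro unit_mult) auto
  have "\<forall>i. unit (k i)" using h(1) un by (simp add: k_def)
  moreover have "k p * a p c * cnj (k c) = 1" using pc(1) unit_cnj_mult(2)[OF un] by (simp add: k_def)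
  moreover have "\<forall>(q, d)\<in>set es. k q * a q d * cnj (k d) = 1"
    using h(2) pc(2) by (auto simp: k_def split: prod.splits)
  ultimately show ?case unfolding e by (intro exI[of _ k]) simp
qed

text \<open>Nested to the right, so that simplification leaves 1 + (b + c) = 0, the shape of the
  hypothesis of \<open>cube_roots\<close>.\<close>

lemma orth4':
  assumes "D i = {p, q, r, t}" "distinct [p, q, r, t]" "i < n" "j < n" "i \<noteq> j"
  shows "a i p * a p j + (a i q * a q j + (a i r * a r j + a i t * a t j)) = 0"
  using orth4[OF assms] by (simp add: add.assoc)

section \<open>Weights determined by a normalised spanning tree\<close>

text \<open>The graph is a cube with charges alternating in sign. \<open>N\<close> fixes a spanning
  tree of seven edges, and each remaining weight is the only unknown in a relation with two nonzero
  terms.\<close>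

lemma normal_S8:
  assumes d: "distinct [v, p, q, r, x, y, z, t]" "distinct [t, z, y, x, r, q, p, v]"
    and D: "D v = {v, x, y, z}" "D p = {p, x, y, t}" "D q = {q, x, z, t}" "D r = {r, y, z, t}"
      "D x = {x, v, p, q}" "D y = {y, v, p, r}" "D z = {z, v, q, r}" "D t = {t, p, q, r}"
    and C: "a v v = 1" "a p p = 1" "a q q = 1" "a r r = 1" "a x x = -1" "a y y = -1" "a z z = -1" "a t t = -1"
    and N: "a v x = 1" "a v y = 1" "a v z = 1" "a x p = 1" "a x q = 1" "a y r = 1" "a p t = 1"
  shows "graph_iso n a graph_S8"
proof -
  have lt: "v < n" "x < n" "y < n" "z < n" "p < n" "q < n" "r < n" "t < n"
    using D_less[of v x] D_less[of x v] D_less[of y v] D_less[of z v] D_less[of p x] D_less[of q x] D_less[of r y] D_less[of t p]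
    unfolding D by simp_all
  note N' = herm[OF lt(1,2), unfolded N] herm[OF lt(1,3), unfolded N] herm[OF lt(1,4), unfolded N]
    herm[OF lt(2,5), unfolded N] herm[OF lt(2,6), unfolded N] herm[OF lt(3,7), unfolded N] herm[OF lt(5,8), unfolded N]
  note S = C N N' D_zero lt D
  have py: "a p y = -1"
    using orth4'[OF D(5), of y] d by (simp add: S eq_neg_iff_add_eq_0 add.commute)
  have qz: "a q z = -1"
    using orth4'[OF D(5), of z] d by (simp add: S eq_neg_iff_add_eq_0 add.commute)
  have yp: "a y p = -1" and zq: "a z q = -1"
    using herm[OF lt(5,3)] herm[OF lt(6,4)] py qz by simp_all
  have rz: "a r z = -1"
    using orth4'[OF D(6), of z] d by (simp add: S eq_neg_iff_add_eq_0 add.commute)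
  have qt: "a q t = -1"
    using orth4'[OF D(5), of t] d by (simp add: S eq_neg_iff_add_eq_0 add.commute)
  have rt: "a r t = 1"
    using orth4'[OF D(6), of t] d yp by (simp add: S)
  show ?thesis
    by (rule graph_iso_S8[OF d(1) D C N(1-4) yp N(5) zq N(6) _ N(7) qt rt])
      (use herm[OF lt(7,4)] rz in simp)
qed

text \<open>A cube without one corner, whose three open ends p, q, r are joined to each other
  instead. Their mutual weights come from rows x, y, z, where only a charge term and one edge term
  are left.\<close>

lemma normal_S7:
  assumes d: "distinct [v, x, y, z, p, q, r]" "distinct [r, q, p, z, y, x, v]"
    and D: "D v = {v, x, y, z}" "D x = {x, v, p, q}" "D y = {y, v, p, r}" "D z = {z, v, q, r}"
      "D p = {x, y, q, r}" "D q = {x, z, p, r}" "D r = {y, z, p, q}"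
    and C: "a v v = 1" "a x x = -1" "a y y = -1" "a z z = -1"
    and N: "a v x = 1" "a v y = 1" "a v z = 1" "a x p = 1" "a x q = 1" "a y r = 1"
  shows "graph_iso n a graph_S7"
proof -
  have lt: "v < n" "x < n" "y < n" "z < n" "p < n" "q < n" "r < n"
    using D_less[of v x] D_less[of x v] D_less[of y v] D_less[of z v] D_less[of p x] D_less[of q x] D_less[of r y]
    unfolding D by simp_all
  note N' = herm[OF lt(1,2), unfolded N] herm[OF lt(1,3), unfolded N] herm[OF lt(1,4), unfolded N]
    herm[OF lt(2,5), unfolded N] herm[OF lt(2,6), unfolded N] herm[OF lt(3,7), unfolded N]
  note S = C N N' D_zero lt D
  have py: "a p y = -1"
    using orth4'[OF D(2), of y] d by (simp add: S eq_neg_iff_add_eq_0 add.commute)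
  have qz: "a q z = -1"
    using orth4'[OF D(2), of z] d by (simp add: S eq_neg_iff_add_eq_0 add.commute)
  have yp: "a y p = -1" and zq: "a z q = -1"
    using herm[OF lt(5,3)] herm[OF lt(6,4)] py qz by simp_all
  have rz: "a r z = -1"
    using orth4'[OF D(3), of z] d by (simp add: S eq_neg_iff_add_eq_0 add.commute)
  have zr: "a z r = -1" using herm[OF lt(7,4)] rz by simp
  have qp: "a q p = 1" using orth4'[OF D(2), of p] d by (simp add: S)
  have rp: "a r p = -1" using orth4'[OF D(3), of p] d yp by (simp add: S eq_neg_iff_add_eq_0 add.commute)
  have rq: "a r q = 1" using orth4'[OF D(4), of q] d zq zr by (simp add: S)
  have "a p q = 1" "a p r = -1" "a q r = 1"
    using herm[OF lt(6,5)] herm[OF lt(7,5)] herm[OF lt(7,6)] qp rp rq by simp_all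
  then show ?thesis
    by (intro graph_iso_S7[OF d(1) _ _ _ _ _ _ _ C N(1-4) yp N(5) zq N(6) zr]; simp add: D insert_commute)
qed

text \<open>All vertices of one sign are joined to all of the other, so the relations have three
  terms and the weights at y and at z are pairs of cube roots. Equal pairs contradict orthogonality
  of rows p and q, since 1 plus twice a unit is not 0; the two remaining choices differ by
  exchanging y and z.\<close>

lemma normal_S6:
  assumes d: "distinct [v, p, q, x, y, z]" "distinct [z, y, x, q, p, v]"
    and D: "D v = {v, x, y, z}" "D p = {p, x, y, z}" "D q = {q, x, y, z}"
      "D x = {x, v, p, q}" "D y = {y, v, p, q}" "D z = {z, v, p, q}"
    and C: "a v v = 1" "a p p = 1" "a q q = 1" "a x x = -1" "a y y = -1" "a z z = -1"
    and N: "a v x = 1" "a v y = 1" "a v z = 1" "a x p = 1" "a x q = 1"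
  shows "graph_iso n a graph_S6"
proof -
  have lt: "v < n" "x < n" "y < n" "z < n" "p < n" "q < n"
    using D_less[of v x] D_less[of x v] D_less[of y v] D_less[of z v] D_less[of p x] D_less[of q x]
    unfolding D by simp_all
  note N' = herm[OF lt(1,2), unfolded N] herm[OF lt(1,3), unfolded N] herm[OF lt(1,4), unfolded N]
    herm[OF lt(2,5), unfolded N] herm[OF lt(2,6), unfolded N]
  note S = C N N' D_zero lt D
  have N4: "a p x = 1" "a q x = 1" using N' by simp_all
  have u: "cmod (a p y) = 1" "cmod (a q y) = 1" "cmod (a p z) = 1" "cmod (a q z) = 1"
    using unit_D[OF lt(5), of y] unit_D[OF lt(5), of z] unit_D[OF lt(6), of y] unit_D[OF lt(6), of z]
    unfolding unit_def D by simp_all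
  have ey: "1 + (a p y + a q y) = 0" using orth4'[OF D(4), of y] d by (simp add: S)
  have ez: "1 + (a p z + a q z) = 0" using orth4'[OF D(4), of z] d by (simp add: S)
  have dp: "distinct [p, x, y, z]" "p \<noteq> q" using d(1) by auto
  have pq: "a p q = 0" by (rule D_zero[OF lt(6)]) (use D(2) d in auto)
  have "1 + (a p y * a y q + a p z * a z q) = 0"
    using orth4'[OF D(2) dp(1) lt(5,6) dp(2)] unfolding pq C N N4 mult_zero_right mult_1 add_0 .
  then have epq: "1 + (a p y * cnj (a q y) + a p z * cnj (a q z)) = 0"
    unfolding herm[OF lt(6,3)] herm[OF lt(6,4)] .
  have "\<not> (a p z = a p y \<and> a q z = a q y)"
  proof
    assume e: "a p z = a p y \<and> a q z = a q y"
    then have e2: "1 + (a p y * cnj (a q y) + a p y * cnj (a q y)) = 0" using epq by simp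
    from cube_roots[OF u(1,2) ey] show False
    proof (elim disjE conjE)
      assume "a p y = omega - 1" "a q y = - omega"
      with e2 show False by (simp add: complex_eq_iff)
    next
      assume "a p y = - omega" "a q y = omega - 1"
      with e2 show False by (simp add: complex_eq_iff)
    qed
  qed
  then consider "a p y = omega - 1" "a q y = - omega" "a p z = - omega" "a q z = omega - 1"
    | "a p y = - omega" "a q y = omega - 1" "a p z = omega - 1" "a q z = - omega"
    using cube_roots[OF u(1,2) ey] cube_roots[OF u(3,4) ez] by (elim disjE conjE) simp_all
  then show ?thesis
  proof cases
    case 1
    show ?thesis
      by (rule graph_iso_S6[OF d(1) D C N(1-3) N4(1) 1(1,3) N4(2) 1(2,4)])
  next
    case 2
    show ?thesis
      by (rule graph_iso_S6[of v p q x z y]; (simp add: 2 D C N N4 insert_commute; fail | use d in \<open>auto; fail\<close>))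
  qed
qed

text \<open>One choice of cube roots stays free, and its two values are exchanged by swapping p and
  q.\<close>

lemma normal_S6_dagger:
  assumes d: "distinct [v, x, y, z, p, q]" "distinct [q, p, z, y, x, v]"
    and D: "D v = {v, x, y, z}" "D x = {x, v, p, q}" "D y = {v, z, p, q}" "D z = {v, y, p, q}"
      "D p = {x, q, y, z}" "D q = {x, p, y, z}"
    and C: "a v v = 1" "a x x = -1"
    and N: "a v x = 1" "a v y = 1" "a v z = 1" "a x p = 1" "a x q = 1"
  shows "graph_iso n a graph_S6_dagger"
proof -
  have lt: "v < n" "x < n" "y < n" "z < n" "p < n" "q < n"
    using D_less[of v x] D_less[of x v] D_less[of y v] D_less[of z v] D_less[of p x] D_less[of q x]
    unfolding D by simp_all
  note N' = herm[OF lt(1,2), unfolded N] herm[OF lt(1,3), unfolded N] herm[OF lt(1,4), unfolded N]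
    herm[OF lt(2,5), unfolded N] herm[OF lt(2,6), unfolded N]
  note S = C N N' D_zero lt D
  have u: "cmod (a y p) = 1" "cmod (a z p) = 1"
    using unit_D[OF lt(3), of p] unit_D[OF lt(4), of p] unfolding unit_def D by simp_all
  have zy: "a z y = -1" using orth4'[OF D(1), of y] d by (simp add: S eq_neg_iff_add_eq_0 add.commute)
  have yz: "a y z = -1" using herm[OF lt(4,3)] zy by simp
  have qp: "a q p = 1" using orth4'[OF D(2), of p] d by (simp add: S)
  have pq: "a p q = 1" using herm[OF lt(6,5)] qp by simp
  have ep: "1 + (a y p + a z p) = 0" using orth4'[OF D(1), of p] d by (simp add: S)
  have eq: "1 + (a y q + a z q) = 0" using orth4'[OF D(1), of q] d by (simp add: S)
  have "1 + (a p y + a q y) = 0"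
    using orth4'[OF D(2), of y] d by (simp add: S)
  then have "1 + (cnj (a y p) + cnj (a y q)) = 0"
    unfolding herm[OF lt(3,5)] herm[OF lt(3,6)] .
  then have "cnj (1 + (cnj (a y p) + cnj (a y q))) = 0" by (simp only: complex_cnj_zero)
  then have yq: "a y q = - 1 - a y p" by (simp add: eq_neg_iff_add_eq_0 algebra_simps)
  have zq: "a z q = - 1 - a y q" using eq by (simp add: eq_neg_iff_add_eq_0 algebra_simps)
  from cube_roots[OF u ep] show ?thesis
  proof
    assume "a y p = omega - 1 \<and> a z p = - omega"
    then have e: "a y p = omega - 1" "a z p = - omega" by simp_all
    show ?thesis
      by (rule graph_iso_S6_dagger[of v x y z p q]; (simp add: e D C N yz pq yq zq insert_commute; fail | use d in \<open>auto; fail\<close>))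
  next
    assume "a y p = - omega \<and> a z p = omega - 1"
    then have e: "a y p = - omega" "a z p = omega - 1" by simp_all
    show ?thesis
      by (rule graph_iso_S6_dagger[of v x y z q p]; (simp add: e D C N yz qp yq zq insert_commute; fail | use d in \<open>auto; fail\<close>))
  qed
qed

text \<open>The neighbour sets of w and t say only that these vertices are charged. Orthogonality of
  y with w and of p with t determines the charges as -1 and 1.\<close>

lemma normal_S8_prime:
  assumes d: "distinct [v, x, y, z, p, q, w, t]" "distinct [t, w, q, p, z, y, x, v]"
    and D: "D v = {v, x, y, z}" "D x = {x, v, p, q}" "D y = {v, z, p, w}" "D z = {v, y, q, w}"
      "D p = {x, q, y, t}" "D q = {x, p, z, t}" "D w = {w, y, z, t}" "D t = {t, p, q, w}"
    and C: "a v v = 1" "a x x = -1"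
    and N: "a v x = 1" "a v y = 1" "a v z = 1" "a x p = 1" "a x q = 1" "a y w = 1" "a p t = 1"
  shows "graph_iso n a graph_S8_prime"
proof -
  have lt: "v < n" "x < n" "y < n" "z < n" "p < n" "q < n" "w < n" "t < n"
    using D_less[of v x] D_less[of x v] D_less[of y v] D_less[of z v] D_less[of p x] D_less[of q x] D_less[of w y] D_less[of t p]
    unfolding D by simp_all
  note N' = herm[OF lt(1,2), unfolded N] herm[OF lt(1,3), unfolded N] herm[OF lt(1,4), unfolded N]
    herm[OF lt(2,5), unfolded N] herm[OF lt(2,6), unfolded N] herm[OF lt(3,7), unfolded N] herm[OF lt(5,8), unfolded N]
  note S = C N N' D_zero lt D
  have zy: "a z y = -1" using orth4'[OF D(1), of y] d by (simp add: S eq_neg_iff_add_eq_0 add.commute)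
  have qp: "a q p = 1" using orth4'[OF D(2), of p] d by (simp add: S)
  have py: "a p y = -1" using orth4'[OF D(2), of y] d by (simp add: S eq_neg_iff_add_eq_0 add.commute)
  have qz: "a q z = -1" using orth4'[OF D(2), of z] d by (simp add: S eq_neg_iff_add_eq_0 add.commute)
  have sym: "a y z = -1" "a p q = 1" "a y p = -1" "a z q = -1"
    using herm[OF lt(4,3)] herm[OF lt(6,5)] herm[OF lt(5,3)] herm[OF lt(6,4)] zy qp py qz by simp_all
  have wz: "a w z = -1" using orth4'[OF D(3), of z] d by (simp add: S eq_neg_iff_add_eq_0 add.commute)
  have tq: "a t q = -1" using orth4'[OF D(5), of q] d by (simp add: S eq_neg_iff_add_eq_0 add.commute)
  have wt: "a w t = 1" using orth4'[OF D(3), of t] d sym by (simp add: S)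
  have sym': "a z w = -1" "a q t = -1" using herm[OF lt(7,4)] herm[OF lt(8,6)] wz tq by simp_all
  have ww: "a w w = -1" using orth4'[OF D(3), of w] d sym sym' by (simp add: S eq_neg_iff_add_eq_0 add.commute)
  have tt: "a t t = 1" using orth4'[OF D(5), of t] d sym sym' by (simp add: S)
  show ?thesis
    by (rule graph_iso_S8_prime[of v x y z p q w t]; (simp add: D C N sym sym' ww tt wt insert_commute; fail | use d in \<open>auto; fail\<close>))
qed

text \<open>The one free choice of cube roots is exchanged by swapping y and z; hence
  \<open>main\<close> is stated for variable y and z.\<close>

lemma normal_S5:
  assumes d: "distinct [v, x, y, z, w]" "distinct [w, z, y, x, v]"
    and D: "D v = {v, x, y, z}" "D x = {v, y, z, w}" "D y = {v, x, z, w}" "D z = {v, x, y, w}" "D w = {w, x, y, z}"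
    and C: "a v v = 1"
    and N: "a v x = 1" "a v y = 1" "a v z = 1" "a x w = 1"
  shows "graph_iso n a graph_S5"
proof -
  have lt: "v < n" "x < n" "y < n" "z < n" "w < n"
    using D_less[of v x] D_less[of x v] D_less[of y v] D_less[of z v] D_less[of w x] unfolding D by simp_all
  note N' = herm[OF lt(1,2), unfolded N] herm[OF lt(1,3), unfolded N] herm[OF lt(1,4), unfolded N] herm[OF lt(2,5), unfolded N]
  note S = C N N' D_zero lt D
  have main: "graph_iso n a graph_S5"
    if d: "distinct [v, x, y, z, w]" "distinct [w, z, y, x, v]"
      and D: "D v = {v, x, y, z}" "D x = {v, y, z, w}" "D y = {v, x, z, w}" "D z = {v, x, y, w}" "D w = {w, x, y, z}"
      and N: "a v x = 1" "a v y = 1" "a v z = 1" "a x w = 1"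
      and lt: "v < n" "x < n" "y < n" "z < n" "w < n"
      and yx: "a y x = omega - 1" and zx: "a z x = - omega" for y z
  proof -
    note N' = herm[OF lt(1,2), unfolded N] herm[OF lt(1,3), unfolded N] herm[OF lt(1,4), unfolded N] herm[OF lt(2,5), unfolded N]
    note S = C N N' D_zero lt D
    have xy: "a x y = - omega" "a x z = omega - 1"
      using herm[OF lt(3,2)] herm[OF lt(4,2)] yx zx by (simp_all add: omega_simps)
    have "1 + (a x y + a z y) = 0" using orth4'[OF D(1), of y] d by (simp add: S)
    then have zy: "a z y = omega - 1" using xy by (simp add: algebra_simps eq_neg_iff_add_eq_0)
    then have yz: "a y z = - omega" using herm[OF lt(4,3)] by (simp add: omega_simps)
    have wy: "a w y = omega - 1"
      using orth4'[OF D(2), of y] d xy zy by (simp add: S omega_simps algebra_simps)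
    have wz: "a w z = - omega"
      using orth4'[OF D(2), of z] d xy yz by (simp add: S omega_simps algebra_simps eq_neg_iff_add_eq_0)
    have yw: "a y w = - omega" "a z w = omega - 1"
      using herm[OF lt(5,3)] herm[OF lt(5,4)] wy wz by (simp_all add: omega_simps)
    have ww: "a w w = 1" using orth4'[OF D(2), of w] d xy yw by (simp add: S omega_simps algebra_simps)
    show ?thesis
      by (rule graph_iso_S5[OF d(1) D]) (use C ww N xy yz wy wz N' in simp_all)
  qed
  have u: "cmod (a y x) = 1" "cmod (a z x) = 1"
    using unit_D[OF lt(3), of x] unit_D[OF lt(4), of x] unfolding unit_def D by simp_all
  have e: "1 + (a y x + a z x) = 0" using orth4'[OF D(1), of x] d by (simp add: S)
  from cube_roots[OF u e] show ?thesis
  proof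
    assume "a y x = omega - 1 \<and> a z x = - omega"
    then show ?thesis using main[OF d D N lt] by simp
  next
    assume *: "a y x = - omega \<and> a z x = omega - 1"
    show ?thesis
      by (rule main[of z y]; (simp add: * D N lt insert_commute; fail | use d in \<open>auto; fail\<close>))
  qed
qed

end

definition listed :: "nat \<Rightarrow> (nat \<Rightarrow> nat \<Rightarrow> complex) \<Rightarrow> bool" where
  "listed n a \<longleftrightarrow> graph_iso n a graph_S1 \<or> graph_iso n a graph_S2_dagger \<or>
    (\<exists>k\<ge>2. graph_iso n a (graph_Cpp k)) \<or> (\<exists>k\<ge>2. graph_iso n a (graph_Cpm k)) \<or>
    graph_iso n a graph_S5 \<or> graph_iso n a graph_S6 \<or> graph_iso n a graph_S6_dagger \<or>
    graph_iso n a graph_S7 \<or> graph_iso n a graph_S8 \<or> graph_iso n a graph_S8_prime"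

lemma listed_switch:
  assumes "\<And>i. unit (h i)" "listed n (\<lambda>i j. h i * a i j * cnj (h j))"
  shows "listed n a"
proof -
  have s: "graph_iso n (\<lambda>i j. h i * a i j * cnj (h j)) G \<Longrightarrow> graph_iso n a G" for G :: "letter rgraph"
    by (rule graph_iso_switch[OF assms(1)])
  have t: "graph_iso n (\<lambda>i j. h i * a i j * cnj (h j)) G \<Longrightarrow> graph_iso n a G" for G :: "ladder_vertex rgraph"
    by (rule graph_iso_switch[OF assms(1)])
  show ?thesis using assms(2) unfolding listed_def by (elim disjE exE conjE) (auto dest!: s t)
qed

lemma listed_neg:
  assumes "listed n (\<lambda>i j. - a i j)" shows "listed n a"
proof -
  have s: "graph_iso n (\<lambda>i j. - a i j) G \<Longrightarrow> graph_iso n a G" for G :: "letter rgraph"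
    by (rule graph_iso_neg)
  have t: "graph_iso n (\<lambda>i j. - a i j) G \<Longrightarrow> graph_iso n a G" for G :: "ladder_vertex rgraph"
    by (rule graph_iso_neg)
  show ?thesis using assms unfolding listed_def by (elim disjE exE conjE) (auto dest!: s t)
qed

section \<open>Neighbourhood types of a charged vertex\<close>

text \<open>The types mention only relative charges and zero entries, so they are unchanged by
  switching and negation. The missing second type, two opposite charges and one uncharged vertex, is
  impossible by \<open>star_type2\<close>.\<close>

definition type1 :: "(nat \<Rightarrow> nat \<Rightarrow> complex) \<Rightarrow> nat \<Rightarrow> nat \<Rightarrow> nat \<Rightarrow> nat \<Rightarrow> bool" where
  "type1 a v x y z \<longleftrightarrow> a x x = - a v v \<and> a y y = - a v v \<and> a z z = - a v v \<and> a x y = 0 \<and> a x z = 0 \<and> a y z = 0"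

definition type3 :: "(nat \<Rightarrow> nat \<Rightarrow> complex) \<Rightarrow> nat \<Rightarrow> nat \<Rightarrow> nat \<Rightarrow> nat \<Rightarrow> bool" where
  "type3 a v x y z \<longleftrightarrow> a x x = - a v v \<and> a y y = 0 \<and> a z z = 0 \<and> a x y = 0 \<and> a x z = 0 \<and> a y z \<noteq> 0"

definition type4 :: "(nat \<Rightarrow> nat \<Rightarrow> complex) \<Rightarrow> nat \<Rightarrow> nat \<Rightarrow> nat \<Rightarrow> nat \<Rightarrow> bool" where
  "type4 a v x y z \<longleftrightarrow> a x x = 0 \<and> a y y = 0 \<and> a z z = 0 \<and> a x y \<noteq> 0 \<and> a x z \<noteq> 0 \<and> a y z \<noteq> 0"

context sat_mat
begin

lemma eis: "i < n \<Longrightarrow> j < n \<Longrightarrow> a i j \<in> eisenstein_ints"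
  using entries[of i j] by (cases "a i j = 0") (auto simp: unit_def)

lemma zero_sym: "i < n \<Longrightarrow> j < n \<Longrightarrow> a j i = 0 \<longleftrightarrow> a i j = 0"
  using herm[of i j] by simp

lemma cmod_le_1: "i < n \<Longrightarrow> j < n \<Longrightarrow> cmod (a i j) \<le> 1"
  using entries[of i j] by (cases "a i j = 0") (auto simp: unit_def)

text \<open>The normalised matrix is handed over as an abstract \<open>b\<close> together with its
  zeros, charges and neighbour sets, so that later computations never see the switching
  factors.\<close>

lemma tree_switch_cases:
  assumes es: "rooted es" "\<forall>(p, c)\<in>set es. c \<in> D p \<and> p < n"
    and step: "\<And>b. sat_mat n b \<Longrightarrow> (\<And>i. i < n \<Longrightarrow> nb n b i = D i) \<Longrightarrow> (\<And>i. b i i = a i i) \<Longrightarrow>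
      (\<And>i j. b i j = 0 \<longleftrightarrow> a i j = 0) \<Longrightarrow> (\<forall>(p, c)\<in>set es. b p c = 1) \<Longrightarrow> P b"
  shows "\<exists>h. (\<forall>i. unit (h i)) \<and> P (\<lambda>i j. h i * a i j * cnj (h j))"
proof -
  from tree_switch[OF es] obtain h where h: "\<forall>i. unit (h i)"
    and e: "\<forall>(p, c)\<in>set es. h p * a p c * cnj (h c) = 1"
    by (elim exE conjE)
  have un: "unit (h i)" for i using h by simp
  have "P (\<lambda>i j. h i * a i j * cnj (h j))"
  proof (rule step)
    show "sat_mat n (\<lambda>i j. h i * a i j * cnj (h j))" by (rule switch[OF un])
    show "nb n (\<lambda>i j. h i * a i j * cnj (h j)) i = D i" if "i < n" for i
      by (rule nb_switch[OF un that])
    show "h i * a i i * cnj (h i) = a i i" for i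
      using unit_cnj_mult(2)[OF un, of i] by (simp add: mult.commute[of "h i * a i i"] mult.assoc[symmetric] mult.commute[of "cnj (h i)"])
    show "h i * a i j * cnj (h j) = 0 \<longleftrightarrow> a i j = 0" for i j using unit_nz[OF un] by simp
  qed fact
  then show ?thesis using h by blast
qed

lemma listed_tree:
  assumes es: "rooted es" "\<forall>(p, c)\<in>set es. c \<in> D p \<and> p < n"
    and step: "\<And>b. sat_mat n b \<Longrightarrow> (\<And>i. i < n \<Longrightarrow> nb n b i = D i) \<Longrightarrow> (\<And>i. b i i = a i i) \<Longrightarrow>
      (\<And>i j. b i j = 0 \<longleftrightarrow> a i j = 0) \<Longrightarrow> (\<forall>(p, c)\<in>set es. b p c = 1) \<Longrightarrow> listed n b"
  shows "listed n a"
proof -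
  have "\<exists>h. (\<forall>i. unit (h i)) \<and> listed n (\<lambda>i j. h i * a i j * cnj (h j))"
  proof (rule tree_switch_cases[OF es])
    fix b
    assume A: "sat_mat n b" "\<And>i. i < n \<Longrightarrow> nb n b i = D i" "\<And>i. b i i = a i i"
      "\<And>i j. b i j = 0 \<longleftrightarrow> a i j = 0" "\<forall>(p, c)\<in>set es. b p c = 1"
    show "listed n b" by (rule step[OF A])
  qed
  then obtain h where h: "\<forall>i. unit (h i)" and l: "listed n (\<lambda>i j. h i * a i j * cnj (h j))"
    by (elim exE conjE)
  show ?thesis by (rule listed_switch[OF _ l]) (rule h[rule_format])
qed

lemma star_equations:
  assumes v: "v < n" "D v = {v, x, y, z}" "distinct [v, x, y, z]"
    and N: "a v v = 1" "a v x = 1" "a v y = 1" "a v z = 1"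
  shows "1 + a x x + cnj (a x y) + cnj (a x z) = 0" "1 + a y y + a x y + cnj (a y z) = 0"
    "1 + a z z + a x z + a y z = 0"
proof -
  have lt: "x < n" "y < n" "z < n" using D_less[of x v] D_less[of y v] D_less[of z v] v(2) by simp_all
  note o = orth4[OF v(2,3,1)]
  show "1 + a x x + cnj (a x y) + cnj (a x z) = 0"
    using o[OF lt(1)] v(3) unfolding N herm[OF lt(1,2)] herm[OF lt(1,3)] by simp
  show "1 + a y y + a x y + cnj (a y z) = 0"
    using o[OF lt(2)] v(3) unfolding N herm[OF lt(2,3)] by (simp add: algebra_simps)
  show "1 + a z z + a x z + a y z = 0"
    using o[OF lt(3)] v(3) unfolding N by (simp add: algebra_simps)
qed

text \<open>The extreme case of the triangle inequality; it fixes the weights next to two equal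
  charges and those of each new level of a ladder.\<close>

lemma minus_two:
  assumes "cmod \<alpha> \<le> 1" "cmod \<beta> \<le> 1" "\<alpha> + \<beta> = -2"
  shows "\<alpha> = -1 \<and> \<beta> = -1"
proof -
  have r: "Re \<alpha> + Re \<beta> = -2" using assms(3) by (simp add: complex_eq_iff)
  have "Re \<alpha> \<ge> -1" "Re \<beta> \<ge> -1" using abs_Re_le_cmod[of \<alpha>] abs_Re_le_cmod[of \<beta>] assms(1,2) by linarith+
  then have re: "Re \<alpha> = -1" "Re \<beta> = -1" using r by linarith+
  have "Im w = 0" if "cmod w \<le> 1" "Re w = -1" for w
  proof -
    have "(cmod w)\<^sup>2 \<le> 1" using that(1) by (simp add: power_le_one)
    then show ?thesis using that(2) unfolding cmod_power2 by simp
  qed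
  then show ?thesis using re assms(1,2) by (simp add: complex_eq_iff)
qed

text \<open>In the orthogonality of v and x the two equal charges contribute 2, so the two remaining
  terms, of modulus at most 1, must both be -1.\<close>

lemma twin_star:
  assumes v: "v < n" "D v = {v, x, y, z}" "distinct [v, x, y, z]"
    and N: "a v v = 1" "a v x = 1" "a v y = 1" "a v z = 1" and x: "a x x = 1"
  shows "a x y = -1" "a x z = -1"
proof -
  have lt: "x < n" "y < n" "z < n" using D_less[of x v] D_less[of y v] D_less[of z v] v(2) by simp_all
  have "cnj (a x y) + cnj (a x z) = -2"
    using star_equations(1)[OF v N] x by (simp add: eq_neg_iff_add_eq_0 algebra_simps)
  then have "cnj (a x y) = -1 \<and> cnj (a x z) = -1"
    by (intro minus_two) (use cmod_le_1[OF lt(1,2)] cmod_le_1[OF lt(1,3)] in simp_all)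
  then show "a x y = -1" "a x z = -1" by (simp_all add: complex_eq_iff)
qed

text \<open>The equations leave a single weight of real part 0, and no Eisenstein unit is purely
  imaginary.\<close>

lemma star_type1:
  assumes v: "v < n" "D v = {v, x, y, z}" "distinct [v, x, y, z]"
    and N: "a v v = 1" "a v x = 1" "a v y = 1" "a v z = 1"
    and c: "a x x = -1" "a y y = -1" "a z z = -1"
  shows "type1 a v x y z"
proof -
  have lt: "x < n" "y < n" "z < n" using D_less[of x v] D_less[of y v] D_less[of z v] v(2) by simp_all
  note e = star_equations[OF v N]
  have 1: "cnj (a x z) = - cnj (a x y)" using e(1) c by (simp add: eq_neg_iff_add_eq_0 algebra_simps)
  then have xz: "a x z = - a x y" by (simp add: complex_eq_iff)
  have yz: "a y z = a x y" using e(3) c xz by simp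
  have "a x y + cnj (a x y) = 0" using e(2) c yz by simp
  then have re: "Re (a x y) = 0" by (simp add: complex_eq_iff)
  have "a x y = 0"
    using eis_pure_imaginary[OF eis[OF lt(1,2)] re] entries[OF lt(1,2)] unfolding unit_def by blast
  then show ?thesis using xz yz c N by (simp add: type1_def)
qed

text \<open>The equations force \<open>Re (a x y) = 1/2\<close>, so x is adjacent to v, y, z and
  itself and to nothing else. Orthogonality of rows x and y then becomes (1 - a x y)^2 = 0.\<close>

lemma star_type2:
  assumes v: "v < n" "D v = {v, x, y, z}" "distinct [v, x, y, z]"
    and N: "a v v = 1" "a v x = 1" "a v y = 1" "a v z = 1"
    and c: "a x x = -1" "a y y = -1" "a z z = 0"
  shows False
proof -
  have lt: "x < n" "y < n" "z < n" using D_less[of x v] D_less[of y v] D_less[of z v] v(2) by simp_all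
  note e = star_equations[OF v N]
  have "cnj (a x z) = - cnj (a x y)" using e(1) c by (simp add: eq_neg_iff_add_eq_0 algebra_simps)
  then have xz: "a x z = - a x y" by (simp add: complex_eq_iff)
  have zy: "cnj (a y z) = - a x y" using e(2) c by (simp add: eq_neg_iff_add_eq_0 algebra_simps)
  then have "a y z = - cnj (a x y)" by (simp add: complex_eq_iff)
  then have re: "Re (a x y) = 1/2" using e(3) c xz by (simp add: complex_eq_iff)
  then have nz: "a x y \<noteq> 0" by auto
  have xv: "a x v = 1" using herm[OF v(1) lt(1)] N by simp
  have sub: "{x, v, y, z} \<subseteq> D x" using nz xz xv c lt v(1) by (simp add: nb_def)
  have dx: "distinct [x, v, y, z]" using v(3) by auto
  have Dx: "D x = {x, v, y, z}" by (rule card4_eq[OF degree[OF lt(1)] sub dx])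
  have xy: "x \<noteq> y" using v(3) by simp
  have "- a x y + 1 + a x y * - 1 + - a x y * cnj (a y z) = 0"
    using orth4[OF Dx dx lt(1,2) xy] unfolding herm[OF lt(2,3)] c N xv xz by simp
  then have "(1 - a x y) * (1 - a x y) = 0" unfolding zy by (simp add: algebra_simps)
  then have "a x y = 1" by simp
  then show False using re by simp
qed

lemma star_type3:
  assumes v: "v < n" "D v = {v, x, y, z}" "distinct [v, x, y, z]"
    and N: "a v v = 1" "a v x = 1" "a v y = 1" "a v z = 1"
    and c: "a x x = -1" "a y y = 0" "a z z = 0"
  shows "type3 a v x y z"
proof -
  note e = star_equations[OF v N]
  have "cnj (a x z) = - cnj (a x y)" using e(1) c by (simp add: eq_neg_iff_add_eq_0 algebra_simps)
  then have xz: "a x z = - a x y" by (simp add: complex_eq_iff)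
  have yz: "a y z = a x y - 1" using e(3) c xz by (simp add: algebra_simps)
  have "a x y + cnj (a x y) = 0" using e(2) c unfolding yz by (simp add: algebra_simps)
  then have re: "Re (a x y) = 0" by (simp add: complex_eq_iff)
  have lt: "x < n" "y < n" "z < n" using D_less[of x v] D_less[of y v] D_less[of z v] v(2) by simp_all
  have "a x y = 0"
    using eis_pure_imaginary[OF eis[OF lt(1,2)] re] entries[OF lt(1,2)] unfolding unit_def by blast
  then show ?thesis using xz yz c N by (simp add: type3_def)
qed

text \<open>The equations give \<open>a x z\<close> the real part -1/2 and make the other two
  weights its conjugate. The two inequalities will force the fourth neighbour of x to be adjacent to
  y and z as well.\<close>

lemma star_type4:
  assumes v: "v < n" "D v = {v, x, y, z}" "distinct [v, x, y, z]"
    and N: "a v v = 1" "a v x = 1" "a v y = 1" "a v z = 1"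
    and c: "a x x = 0" "a y y = 0" "a z z = 0"
  shows "type4 a v x y z" "1 + a x z * a z y \<noteq> 0" "1 + a x y * a y z \<noteq> 0"
proof -
  have lt: "x < n" "y < n" "z < n" using D_less[of x v] D_less[of y v] D_less[of z v] v(2) by simp_all
  note e = star_equations[OF v N]
  have e2: "cnj (a y z) = -1 - a x y" using e(2) c by (simp add: eq_neg_iff_add_eq_0 algebra_simps)
  have "cnj (1 + cnj (a x y) + cnj (a x z)) = 0" using e(1) c by simp
  then have xz: "a x z = -1 - a x y" by (simp add: eq_neg_iff_add_eq_0 algebra_simps)
  have yz: "a y z = cnj (a x z)" using e2 xz by (metis complex_cnj_cnj)
  have "a x z + cnj (a x z) = -1" using e(3) c yz by (simp add: eq_neg_iff_add_eq_0 algebra_simps)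
  then have re: "Re (a x z) = -1/2" by (simp add: complex_eq_iff)
  have nz: "a x z \<noteq> 0" using re by auto
  have xy: "a x y = cnj (a x z)" using xz re by (simp add: complex_eq_iff)
  show "type4 a v x y z" using nz yz xy c by (simp add: type4_def)
  have zy: "a z y = a x z" using herm[OF lt(2,3)] yz by simp
  show "1 + a x z * a z y \<noteq> 0" unfolding zy
  proof
    assume "1 + a x z * a x z = 0"
    then show False using re by (auto simp: complex_eq_iff)
  qed
  show "1 + a x y * a y z \<noteq> 0" unfolding xy yz
  proof
    assume "1 + cnj (a x z) * cnj (a x z) = 0"
    then show False using re by (auto simp: complex_eq_iff)
  qed
qed

definition no_twins :: bool where
  "no_twins \<longleftrightarrow> (\<forall>x<n. \<forall>y<n. x \<noteq> y \<longrightarrow> a x y \<noteq> 0 \<longrightarrow> a x x \<noteq> 0 \<longrightarrow> a y y \<noteq> a x x)"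

text \<open>Without equal charges on an edge, every neighbour of v has charge 0 or -1. Of the eight
  patterns those with two charged neighbours are impossible, and the others have one of the types up
  to order.\<close>

lemma star_typed:
  assumes nt: no_twins and v: "v < n" and vv: "a v v = 1"
  shows "\<exists>x y z. D v = {v, x, y, z} \<and> distinct [v, x, y, z] \<and> (type1 a v x y z \<or> type3 a v x y z \<or> type4 a v x y z)"
proof -
  have vD: "v \<in> D v" using v vv by (simp add: nb_def)
  obtain x y z where Dv: "D v = {v, x, y, z}" and d: "distinct [v, x, y, z]" using card4_cases[OF degree[OF v] vD] .
  let ?es = "[(v, z), (v, y), (v, x)]"
  let ?P = "\<lambda>b. \<exists>x y z. D v = {v, x, y, z} \<and> distinct [v, x, y, z] \<and> (type1 b v x y z \<or> type3 b v x y z \<or> type4 b v x y z)"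
  have r: "rooted ?es" using d by auto
  have m: "\<forall>(p, c)\<in>set ?es. c \<in> D p \<and> p < n" using Dv v by simp
  have "\<exists>h. (\<forall>i. unit (h i)) \<and> ?P (\<lambda>i j. h i * a i j * cnj (h j))"
  proof (rule tree_switch_cases[OF r m])
    fix b assume "sat_mat n b" and nb: "\<And>i. i < n \<Longrightarrow> nb n b i = D i" and dg: "\<And>i. b i i = a i i"
      and z0: "\<And>i j. b i j = 0 \<longleftrightarrow> a i j = 0" and e: "\<forall>(p, c)\<in>set ?es. b p c = 1"
    interpret b: sat_mat n b by fact
    have ne: "b w w \<noteq> 1" if "w \<in> D v" "w \<noteq> v" for w
    proof -
      have "w < n" "a v w \<noteq> 0" using that by (auto simp: nb_def)
      then show ?thesis using nt that(2) v vv unfolding no_twins_def dg by auto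
    qed
    have N: "b v v = 1" "b v x = 1" "b v y = 1" "b v z = 1" using e vv dg by simp_all
    have lt: "x < n" "y < n" "z < n" using D_less[of x v] D_less[of y v] D_less[of z v] Dv by simp_all
    have ch: "b x x = 0 \<or> b x x = -1" "b y y = 0 \<or> b y y = -1" "b z z = 0 \<or> b z z = -1"
      using b.diag_cases[OF lt(1)] b.diag_cases[OF lt(2)] b.diag_cases[OF lt(3)] ne[of x] ne[of y] ne[of z] Dv d by auto
    have D1: "nb n b v = {v, x, y, z}" using nb[OF v] Dv by simp
    have perm: "nb n b v = {v, y, x, z}" "nb n b v = {v, z, x, y}" "nb n b v = {v, x, z, y}" "nb n b v = {v, y, z, x}"
      "distinct [v, y, x, z]" "distinct [v, z, x, y]" "distinct [v, x, z, y]" "distinct [v, y, z, x]"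
      using D1 d by (auto simp: insert_commute)
    from ch show "?P b"
    proof (elim disjE)
      assume c: "b x x = 0" "b y y = 0" "b z z = 0"
      show ?thesis using b.star_type4(1)[OF v D1 d N c] Dv d by blast
    next
      assume c: "b x x = -1" "b y y = -1" "b z z = -1"
      show ?thesis using b.star_type1[OF v D1 d N c] Dv d by blast
    next
      assume c: "b x x = -1" "b y y = 0" "b z z = 0"
      show ?thesis using b.star_type3[OF v D1 d N c] Dv d by blast
    next
      assume c: "b x x = 0" "b y y = -1" "b z z = 0"
      show ?thesis using b.star_type3[OF v perm(1,5) N(1,3,2,4) c(2,1,3)] perm(1,5) nb[OF v] by blast
    next
      assume c: "b x x = 0" "b y y = 0" "b z z = -1"
      show ?thesis using b.star_type3[OF v perm(2,6) N(1,4,2,3) c(3,1,2)] perm(2,6) nb[OF v] by blast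
    next
      assume c: "b x x = -1" "b y y = -1" "b z z = 0"
      show ?thesis using b.star_type2[OF v D1 d N c] by blast
    next
      assume c: "b x x = -1" "b y y = 0" "b z z = -1"
      show ?thesis using b.star_type2[OF v perm(3,7) N(1,2,4,3) c(1,3,2)] by blast
    next
      assume c: "b x x = 0" "b y y = -1" "b z z = -1"
      show ?thesis using b.star_type2[OF v perm(4,8) N(1,3,4,2) c(2,3,1)] by blast
    qed
  qed
  then obtain h x y z where h: "\<forall>i. unit (h i)" and xyz: "D v = {v, x, y, z}" "distinct [v, x, y, z]"
    and t: "type1 (\<lambda>i j. h i * a i j * cnj (h j)) v x y z \<or> type3 (\<lambda>i j. h i * a i j * cnj (h j)) v x y z \<or> type4 (\<lambda>i j. h i * a i j * cnj (h j)) v x y z"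
    by (elim exE conjE)
  have dg: "h i * a i i * cnj (h i) = a i i" for i
    using unit_cnj_mult(2)[of "h i"] h by (simp add: mult.commute[of "h i * a i i"] mult.assoc[symmetric] mult.commute[of "cnj (h i)"])
  have z0: "h i * a i j * cnj (h j) = 0 \<longleftrightarrow> a i j = 0" for i j using unit_nz h by simp
  have "type1 a v x y z \<or> type3 a v x y z \<or> type4 a v x y z"
    using t unfolding type1_def type3_def type4_def dg z0 .
  then show ?thesis using xyz by blast
qed

lemma no_twins_neg: "no_twins \<Longrightarrow> sat_mat.no_twins n (\<lambda>i j. - a i j)"
  unfolding no_twins_def sat_mat.no_twins_def[OF negate] by simp

lemma star_typed':
  assumes nt: no_twins and v: "v < n" and vv: "a v v \<noteq> 0"
  shows "\<exists>x y z. D v = {v, x, y, z} \<and> distinct [v, x, y, z] \<and> (type1 a v x y z \<or> type3 a v x y z \<or> type4 a v x y z)"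
proof (cases "a v v = 1")
  case True then show ?thesis using star_typed nt v by blast
next
  case False
  then have "- a v v = 1" using diag_cases[OF v] vv by auto
  note typed = sat_mat.star_typed[OF negate no_twins_neg[OF nt] v this]
  have neg: "- p = q \<longleftrightarrow> p = - q" for p q :: complex by auto
  show ?thesis using typed
    unfolding nb_neg type1_def type3_def type4_def by (simp add: neg)
qed

text \<open>The classification of stars seen from a chosen neighbour w of opposite charge; type 4
  drops out because it has no such neighbour. This is what carries information outwards from v to
  the vertices at distance two.\<close>

lemma opposite_neighbour:
  assumes nt: no_twins and u: "u < n" "a u u \<noteq> 0" and w: "w \<in> D u" "a w w = - a u u"
  shows "\<exists>p q. D u = {u, w, p, q} \<and> distinct [u, w, p, q] \<and> a w p = 0 \<and> a w q = 0 \<and>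
    (a p p = - a u u \<and> a q q = - a u u \<and> a p q = 0 \<or> a p p = 0 \<and> a q q = 0 \<and> a p q \<noteq> 0)"
proof -
  have wu: "w \<noteq> u" using w u by auto
  obtain x y z where Du: "D u = {u, x, y, z}" "distinct [u, x, y, z]"
    and t: "type1 a u x y z \<or> type3 a u x y z \<or> type4 a u x y z"
    using star_typed'[OF nt u] by blast
  have lt: "x < n" "y < n" "z < n" using D_less[of x u] D_less[of y u] D_less[of z u] Du(1) by simp_all
  have ww: "a w w \<noteq> 0" using w(2) u(2) by simp
  have wc: "w = x \<or> w = y \<or> w = z" using w(1) wu Du(1) by auto
  have perm: "D u = {u, y, x, z}" "D u = {u, z, x, y}" "distinct [u, y, x, z]" "distinct [u, z, x, y]"
    using Du by (auto simp: insert_commute)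
  from t show ?thesis
  proof (elim disjE)
    assume t: "type1 a u x y z"
    have s: "a y x = 0" "a z x = 0" "a z y = 0"
      using t zero_sym[OF lt(1,2)] zero_sym[OF lt(1,3)] zero_sym[OF lt(2,3)] by (simp_all add: type1_def)
    from wc show ?thesis
    proof (elim disjE)
      assume "w = x" then show ?thesis using Du t unfolding type1_def by (intro exI[of _ y] exI[of _ z]) simp
    next
      assume "w = y" then show ?thesis using perm(1,3) t s unfolding type1_def by (intro exI[of _ x] exI[of _ z]) simp
    next
      assume "w = z" then show ?thesis using perm(2,4) t s unfolding type1_def by (intro exI[of _ x] exI[of _ y]) simp
    qed
  next
    assume t: "type3 a u x y z"
    then have "w = x" using wc ww by (auto simp: type3_def)
    then show ?thesis using Du t unfolding type3_def by (intro exI[of _ y] exI[of _ z]) simp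
  next
    assume "type4 a u x y z"
    then show ?thesis using wc ww by (auto simp: type4_def)
  qed
qed

end

lemma card4_cases3:
  assumes "card X = 4" "u \<in> X" "x \<in> X" "y \<in> X" "distinct [u, x, y]"
  obtains t where "X = {u, x, y, t}" "distinct [u, x, y, t]"
proof -
  have "x \<noteq> u" using assms(5) by auto
  obtain p q where X: "X = {u, x, p, q}" and d: "distinct [u, x, p, q]"
    using card4_cases2[OF assms(1-3) \<open>x \<noteq> u\<close>] .
  have "y = p \<or> y = q" using assms(4,5) X by auto
  then show ?thesis
  proof
    assume "y = p" then show ?thesis using that[of q] X d by simp
  next
    assume "y = q"
    then have "X = {u, x, y, p}" "distinct [u, x, y, p]" using X d by auto
    then show ?thesis by (rule that)
  qed
qed

context sat_mat
begin

section \<open>From neighbour sets and charges to the listed graphs\<close>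

text \<open>Only neighbour sets and charges are assumed; switching along a spanning tree produces
  the weights of the normal form. The star at v stands last in the list because
  \<open>rooted\<close> builds from the end.\<close>

lemma case_S8:
  assumes d: "distinct [v, p, q, r, x, y, z, t]"
    and D: "D v = {v, x, y, z}" "D p = {p, x, y, t}" "D q = {q, x, z, t}" "D r = {r, y, z, t}"
      "D x = {x, v, p, q}" "D y = {y, v, p, r}" "D z = {z, v, q, r}" "D t = {t, p, q, r}"
    and C: "a v v = 1" "a p p = 1" "a q q = 1" "a r r = 1" "a x x = -1" "a y y = -1" "a z z = -1" "a t t = -1"
  shows "listed n a"
proof -
  have lt: "v < n" "x < n" "y < n" "z < n" "p < n" "q < n" "r < n" "t < n"
    using D_less[of v x] D_less[of x v] D_less[of y v] D_less[of z v] D_less[of p x] D_less[of q x] D_less[of r y] D_less[of t p]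
    unfolding D by simp_all
  show ?thesis
  proof (rule listed_tree[of "[(p, t), (y, r), (x, q), (x, p), (v, z), (v, y), (v, x)]"])
    fix b assume "sat_mat n b" and nb: "\<And>i. i < n \<Longrightarrow> nb n b i = D i" and dg: "\<And>i. b i i = a i i"
      and e: "\<forall>(p, c)\<in>set [(p, t), (y, r), (x, q), (x, p), (v, z), (v, y), (v, x)]. b p c = 1"
    interpret b: sat_mat n b by fact
    have "graph_iso n b graph_S8"
      by (rule b.normal_S8[of v p q r x y z t]; (use d in \<open>auto; fail\<close> | use e in \<open>simp add: nb lt D dg C; fail\<close>))
    then show "listed n b" by (simp add: listed_def)
  qed (use d D lt in auto)
qed

lemma case_S7:
  assumes d: "distinct [v, x, y, z, p, q, r]"
    and D: "D v = {v, x, y, z}" "D x = {x, v, p, q}" "D y = {y, v, p, r}" "D z = {z, v, q, r}"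
      "D p = {x, y, q, r}" "D q = {x, z, p, r}" "D r = {y, z, p, q}"
    and C: "a v v = 1" "a x x = -1" "a y y = -1" "a z z = -1"
  shows "listed n a"
proof -
  have lt: "v < n" "x < n" "y < n" "z < n" "p < n" "q < n" "r < n"
    using D_less[of v x] D_less[of x v] D_less[of y v] D_less[of z v] D_less[of p x] D_less[of q x] D_less[of r y]
    unfolding D by simp_all
  show ?thesis
  proof (rule listed_tree[of "[(y, r), (x, q), (x, p), (v, z), (v, y), (v, x)]"])
    fix b assume "sat_mat n b" and nb: "\<And>i. i < n \<Longrightarrow> nb n b i = D i" and dg: "\<And>i. b i i = a i i"
      and e: "\<forall>(p, c)\<in>set [(y, r), (x, q), (x, p), (v, z), (v, y), (v, x)]. b p c = 1"
    interpret b: sat_mat n b by fact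
    have "graph_iso n b graph_S7"
      by (rule b.normal_S7[of v x y z p q r]; (use d in \<open>auto; fail\<close> | use e in \<open>simp add: nb lt D dg C; fail\<close>))
    then show "listed n b" by (simp add: listed_def)
  qed (use d D lt in auto)
qed

lemma case_S6:
  assumes d: "distinct [v, p, q, x, y, z]"
    and D: "D v = {v, x, y, z}" "D p = {p, x, y, z}" "D q = {q, x, y, z}"
      "D x = {x, v, p, q}" "D y = {y, v, p, q}" "D z = {z, v, p, q}"
    and C: "a v v = 1" "a p p = 1" "a q q = 1" "a x x = -1" "a y y = -1" "a z z = -1"
  shows "listed n a"
proof -
  have lt: "v < n" "x < n" "y < n" "z < n" "p < n" "q < n"
    using D_less[of v x] D_less[of x v] D_less[of y v] D_less[of z v] D_less[of p x] D_less[of q x]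
    unfolding D by simp_all
  show ?thesis
  proof (rule listed_tree[of "[(x, q), (x, p), (v, z), (v, y), (v, x)]"])
    fix b assume "sat_mat n b" and nb: "\<And>i. i < n \<Longrightarrow> nb n b i = D i" and dg: "\<And>i. b i i = a i i"
      and e: "\<forall>(p, c)\<in>set [(x, q), (x, p), (v, z), (v, y), (v, x)]. b p c = 1"
    interpret b: sat_mat n b by fact
    have "graph_iso n b graph_S6"
      by (rule b.normal_S6[of v p q x y z]; (use d in \<open>auto; fail\<close> | use e in \<open>simp add: nb lt D dg C; fail\<close>))
    then show "listed n b" by (simp add: listed_def)
  qed (use d D lt in auto)
qed

lemma case_S6_dagger:
  assumes d: "distinct [v, x, y, z, p, q]"
    and D: "D v = {v, x, y, z}" "D x = {x, v, p, q}" "D y = {v, z, p, q}" "D z = {v, y, p, q}"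
      "D p = {x, q, y, z}" "D q = {x, p, y, z}"
    and C: "a v v = 1" "a x x = -1"
  shows "listed n a"
proof -
  have lt: "v < n" "x < n" "y < n" "z < n" "p < n" "q < n"
    using D_less[of v x] D_less[of x v] D_less[of y v] D_less[of z v] D_less[of p x] D_less[of q x]
    unfolding D by simp_all
  show ?thesis
  proof (rule listed_tree[of "[(x, q), (x, p), (v, z), (v, y), (v, x)]"])
    fix b assume "sat_mat n b" and nb: "\<And>i. i < n \<Longrightarrow> nb n b i = D i" and dg: "\<And>i. b i i = a i i"
      and e: "\<forall>(p, c)\<in>set [(x, q), (x, p), (v, z), (v, y), (v, x)]. b p c = 1"
    interpret b: sat_mat n b by fact
    have "graph_iso n b graph_S6_dagger"
      by (rule b.normal_S6_dagger[of v x y z p q]; (use d in \<open>auto; fail\<close> | use e in \<open>simp add: nb lt D dg C; fail\<close>))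
    then show "listed n b" by (simp add: listed_def)
  qed (use d D lt in auto)
qed

lemma case_S8_prime:
  assumes d: "distinct [v, x, y, z, p, q, w, t]"
    and D: "D v = {v, x, y, z}" "D x = {x, v, p, q}" "D y = {v, z, p, w}" "D z = {v, y, q, w}"
      "D p = {x, q, y, t}" "D q = {x, p, z, t}" "D w = {w, y, z, t}" "D t = {t, p, q, w}"
    and C: "a v v = 1" "a x x = -1"
  shows "listed n a"
proof -
  have lt: "v < n" "x < n" "y < n" "z < n" "p < n" "q < n" "w < n" "t < n"
    using D_less[of v x] D_less[of x v] D_less[of y v] D_less[of z v] D_less[of p x] D_less[of q x] D_less[of w y] D_less[of t p]
    unfolding D by simp_all
  show ?thesis
  proof (rule listed_tree[of "[(p, t), (y, w), (x, q), (x, p), (v, z), (v, y), (v, x)]"])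
    fix b assume "sat_mat n b" and nb: "\<And>i. i < n \<Longrightarrow> nb n b i = D i" and dg: "\<And>i. b i i = a i i"
      and e: "\<forall>(p, c)\<in>set [(p, t), (y, w), (x, q), (x, p), (v, z), (v, y), (v, x)]. b p c = 1"
    interpret b: sat_mat n b by fact
    have "graph_iso n b graph_S8_prime"
      by (rule b.normal_S8_prime[of v x y z p q w t]; (use d in \<open>auto; fail\<close> | use e in \<open>simp add: nb lt D dg C; fail\<close>))
    then show "listed n b" by (simp add: listed_def)
  qed (use d D lt in auto)
qed

lemma case_S5:
  assumes d: "distinct [v, x, y, z, w]"
    and D: "D v = {v, x, y, z}" "D x = {v, y, z, w}" "D y = {v, x, z, w}" "D z = {v, x, y, w}" "D w = {w, x, y, z}"
    and C: "a v v = 1"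
  shows "listed n a"
proof -
  have lt: "v < n" "x < n" "y < n" "z < n" "w < n"
    using D_less[of v x] D_less[of x v] D_less[of y v] D_less[of z v] D_less[of w x] unfolding D by simp_all
  show ?thesis
  proof (rule listed_tree[of "[(x, w), (v, z), (v, y), (v, x)]"])
    fix b assume "sat_mat n b" and nb: "\<And>i. i < n \<Longrightarrow> nb n b i = D i" and dg: "\<And>i. b i i = a i i"
      and e: "\<forall>(p, c)\<in>set [(x, w), (v, z), (v, y), (v, x)]. b p c = 1"
    interpret b: sat_mat n b by fact
    have "graph_iso n b graph_S5"
      by (rule b.normal_S5[of v x y z w]; (use d in \<open>auto; fail\<close> | use e in \<open>simp add: nb lt D dg C; fail\<close>))
    then show "listed n b" by (simp add: listed_def)
  qed (use d D lt in auto)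
qed

lemma opposite_neighbour':
  assumes nt: no_twins and u: "u < n" "a u u \<noteq> 0" and w: "w \<in> D u" "a w w = - a u u"
    and p: "p \<in> D u" "p \<noteq> u" "p \<noteq> w"
  obtains q where "D u = {u, w, p, q}" "distinct [u, w, p, q]" "a w p = 0" "a w q = 0"
    "a p p = - a u u \<and> a q q = - a u u \<and> a p q = 0 \<or> a p p = 0 \<and> a q q = 0 \<and> a p q \<noteq> 0"
proof -
  obtain r s where rs: "D u = {u, w, r, s}" "distinct [u, w, r, s]" "a w r = 0" "a w s = 0"
    "a r r = - a u u \<and> a s s = - a u u \<and> a r s = 0 \<or> a r r = 0 \<and> a s s = 0 \<and> a r s \<noteq> 0"
    using opposite_neighbour[OF nt u w] by blast
  have lt: "r < n" "s < n" using D_less[of r u] D_less[of s u] rs(1) by simp_all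
  have "p = r \<or> p = s" using p rs(1) by auto
  then show ?thesis
  proof
    assume "p = r" then show ?thesis using that[of s] rs by simp
  next
    assume ps: "p = s"
    show ?thesis
      by (rule that[of r]) (use rs ps zero_sym[OF lt] in \<open>auto simp: insert_commute\<close>)
  qed
qed

section \<open>A charged vertex with three neighbours of opposite charge\<close>

lemma pair_equation:
  assumes "D x = {x, v, p, q}" "distinct [x, v, p, q]" "x < n" "y < n" "x \<noteq> y"
    and "a x y = 0" "a x v = 1" "a v y = 1"
  shows "1 + a x p * a p y + a x q * a q y = 0"
  using orth4[OF assms(1-5)] assms(6-8) by simp

lemma add_two: "cmod w \<le> 1 \<Longrightarrow> 2 + w \<noteq> 0"
proof
  assume w: "cmod w \<le> 1" and "2 + w = 0"
  then have "w = -2" by (simp add: eq_neg_iff_add_eq_0 add.commute)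
  then show False using w by simp
qed

lemma prod_le_1: "i < n \<Longrightarrow> j < n \<Longrightarrow> k < n \<Longrightarrow> l < n \<Longrightarrow> cmod (a i j * a k l) \<le> 1"
  using cmod_le_1[of i j] cmod_le_1[of k l] by (simp add: norm_mult mult_le_one)

text \<open>If p and q are uncharged, rows x and y against p make the two terms joining x to y
  equal, so 1 + 2X = 0 with |X| = 1, which is impossible. Hence p and q are charged, both are
  adjacent to z by \<open>third\<close>, and six vertices close up to S_6.\<close>

lemma type1_both:
  assumes nt: no_twins and v: "v < n" "D v = {v, x, y, z}" "distinct [v, x, y, z]"
    and N: "a v v = 1" "a v x = 1" "a v y = 1" "a v z = 1" and t: "type1 a v x y z"
    and Dx: "D x = {x, v, p, q}" "distinct [x, v, p, q]" and Dy: "D y = {y, v, p, q}" "distinct [y, v, p, q]"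
    and vp: "a v p = 0" "a v q = 0"
    and alt: "a p p = 1 \<and> a q q = 1 \<and> a p q = 0 \<or> a p p = 0 \<and> a q q = 0 \<and> a p q \<noteq> 0"
  shows "listed n a"
proof -
  have lt: "x < n" "y < n" "z < n" "p < n" "q < n"
    using D_less[of x v] D_less[of y v] D_less[of z v] D_less[of p x] D_less[of q x] v(2) Dx(1) by simp_all
  have c: "a x x = -1" "a y y = -1" "a z z = -1" "a x y = 0" "a x z = 0" "a y z = 0"
    using t N by (simp_all add: type1_def)
  have N': "a x v = 1" "a y v = 1" "a z v = 1"
    using herm[OF v(1) lt(1)] herm[OF v(1) lt(2)] herm[OF v(1) lt(3)] N by simp_all
  have ne: "x \<noteq> y" "x \<noteq> z" "y \<noteq> z" using v(3) by auto
  have exy: "1 + a x p * a p y + a x q * a q y = 0"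
    by (rule pair_equation[OF Dx lt(1,2) ne(1) c(4) N'(1) N(3)])
  have exz: "1 + a x p * a p z + a x q * a q z = 0"
    by (rule pair_equation[OF Dx lt(1,3) ne(2) c(5) N'(1) N(4)])
  have eyz: "1 + a y p * a p z + a y q * a q z = 0"
    by (rule pair_equation[OF Dy lt(2,3) ne(3) c(6) N'(2) N(4)])
  have u: "unit (a x p)" "unit (a x q)" "unit (a y p)" "unit (a y q)"
    using unit_D[OF lt(1)] unit_D[OF lt(2)] Dx(1) Dy(1) by simp_all
  show ?thesis
  proof (cases "a p p = 0")
    case True
    then have qq: "a q q = 0" using alt by auto
    have xp: "x \<noteq> p" "y \<noteq> p" using Dx(2) Dy(2) by auto
    have x1: "a x p = a x q * a q p" using orth4[OF Dx lt(1,4) xp(1)] c vp True N' by simp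
    have y1: "a y p = a y q * a q p" using orth4[OF Dy lt(2,4) xp(2)] c vp True N' by simp
    have "a q p \<noteq> 0"
    proof
      assume "a q p = 0"
      then have "a x p = 0" using x1 by simp
      then show False using unit_nz[OF u(1)] by simp
    qed
    then have uq: "unit (a q p)" by (rule entries[OF lt(5,4)])
    have "a p y = cnj (a y q) * cnj (a q p)" using herm[OF lt(2,4)] y1 by simp
    then have "a x p * a p y = a x q * a q y * (a q p * cnj (a q p))"
      unfolding x1 herm[OF lt(2,5)] by (simp add: mult_ac)
    then have "a x p * a p y = a x q * a q y" using unit_cnj_mult(2)[OF uq] by simp
    moreover define X where "X = a x q * a q y"
    ultimately have "1 + X + X = 0" using exy by simp
    then have "2 * X = -1" by (simp add: eq_neg_iff_add_eq_0 algebra_simps)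
    then have "cmod (2 * X) = 1" by simp
    moreover have "cmod (a x q) = 1" "cmod (a q y) = 1"
      using u(2,4) herm[OF lt(2,5)] by (simp_all add: unit_def)
    ultimately have False by (simp add: norm_mult X_def)
    then show ?thesis ..
  next
    case False
    then have ch: "a p p = 1" "a q q = 1" "a p q = 0" using alt by auto
    \<comment> \<open>If s missed z, then x and y would have equal weights at r, and the relation
      between x and y would read 2 + w = 0 with |w| <= 1.\<close>
    have third: "a s z \<noteq> 0" if "1 + a x s * a s y + a x r * a r y = 0" "1 + a x s * a s z + a x r * a r z = 0"
      "1 + a y s * a s z + a y r * a r z = 0" "unit (a x r)" "r < n" "s < n" for r s
    proof
      assume z: "a s z = 0"
      then have 1: "a x r * a r z = -1" "a y r * a r z = -1"
        using that(2,3) by (simp_all add: eq_neg_iff_add_eq_0 add.commute)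
      then have "(a x r - a y r) * a r z = 0" by (simp add: algebra_simps)
      moreover have "a r z \<noteq> 0" using 1 by auto
      ultimately have "a x r = a y r" by simp
      then have "a x r * a r y = 1" using herm[OF lt(2) that(5)] unit_cnj_mult(2)[OF that(4)] by simp
      then have "2 + a x s * a s y = 0" using that(1) by (simp add: algebra_simps)
      then show False using add_two prod_le_1[OF lt(1) that(6) that(6) lt(2)] by blast
    qed
    have pz: "a p z \<noteq> 0" using third[OF exy exz eyz u(2) lt(5,4)] .
    have qz: "a q z \<noteq> 0"
      by (rule third[of q p]) (use exy exz eyz u(1) lt in \<open>simp_all add: add_ac\<close>)
    have pq: "p \<noteq> q" "z \<noteq> p" "z \<noteq> q" "v \<noteq> p" "v \<noteq> q" using Dx(2) ch c by auto
    have zD: "{z, v, p, q} \<subseteq> D z"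
      using pz qz zero_sym[OF lt(4,3)] zero_sym[OF lt(5,3)] N' c lt v(1) by (simp add: nb_def)
    have Dz: "D z = {z, v, p, q}"
      by (rule card4_eq[OF degree[OF lt(3)] zD]) (use v(3) pq in auto)
    have dd: "distinct [v, p, q, x, y, z]" using v(3) Dx(2) Dy(2) pq by auto
    have nz: "a p x \<noteq> 0" "a p y \<noteq> 0" "a q x \<noteq> 0" "a q y \<noteq> 0"
      using u[THEN unit_nz] zero_sym[OF lt(1,4)] zero_sym[OF lt(2,4)] zero_sym[OF lt(1,5)] zero_sym[OF lt(2,5)] by simp_all
    have Dp: "D p = {p, x, y, z}"
      by (rule card4_eq[OF degree[OF lt(4)]]) (use nz pz ch lt dd in \<open>auto simp: nb_def\<close>)
    have Dq: "D q = {q, x, y, z}"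
      by (rule card4_eq[OF degree[OF lt(5)]]) (use nz qz ch lt dd in \<open>auto simp: nb_def\<close>)
    show ?thesis by (rule case_S6[OF dd v(2) Dp Dq Dx(1) Dy(1) Dz N(1) ch(1,2) c(1-3)])
  qed
qed

text \<open>A cube grows from v: p lies over x and y, q over x and z, and the fourth neighbour r of
  y turns out to lie over y and z. Uncharged p, q, r form a triangle, giving S_7; charged ones share
  an eighth vertex, giving S_8.\<close>

lemma type1_single:
  assumes nt: no_twins and v: "v < n" "D v = {v, x, y, z}" "distinct [v, x, y, z]"
    and N: "a v v = 1" "a v x = 1" "a v y = 1" "a v z = 1" and t: "type1 a v x y z"
    and Dx: "D x = {x, v, p, q}" "distinct [x, v, p, q]"
    and vp: "a v p = 0" "a v q = 0"
    and alt: "a p p = 1 \<and> a q q = 1 \<and> a p q = 0 \<or> a p p = 0 \<and> a q q = 0 \<and> a p q \<noteq> 0"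
    and y: "a p y \<noteq> 0" "a q y = 0" and z: "a p z = 0 \<or> a q z = 0"
  shows "listed n a"
proof -
  have lt: "x < n" "y < n" "z < n" "p < n" "q < n"
    using D_less[of x v] D_less[of y v] D_less[of z v] D_less[of p x] D_less[of q x] v(2) Dx(1) by simp_all
  have c: "a x x = -1" "a y y = -1" "a z z = -1" "a x y = 0" "a x z = 0" "a y z = 0"
    using t N by (simp_all add: type1_def)
  have N': "a x v = 1" "a y v = 1" "a z v = 1"
    using herm[OF v(1) lt(1)] herm[OF v(1) lt(2)] herm[OF v(1) lt(3)] N by simp_all
  have ne: "x \<noteq> y" "x \<noteq> z" "y \<noteq> z" using v(3) by auto
  have exy: "1 + a x p * a p y + a x q * a q y = 0"
    by (rule pair_equation[OF Dx lt(1,2) ne(1) c(4) N'(1) N(3)])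
  have exz: "1 + a x p * a p z + a x q * a q z = 0"
    by (rule pair_equation[OF Dx lt(1,3) ne(2) c(5) N'(1) N(4)])
  have yp: "a y p \<noteq> 0" using y(1) zero_sym[OF lt(4,2)] by simp
  have xp0: "a x p \<noteq> 0" "a x q \<noteq> 0" using Dx(1) by (auto simp: nb_def)
  have vD: "v \<in> D y" "v \<in> D z" using N' v(1) by (simp_all add: nb_def)
  have vv: "a v v = - a y y" "a v v = - a z z" using c N by simp_all
  have yz0: "a y y \<noteq> 0" "a z z \<noteq> 0" using c by simp_all
  have py: "p \<in> D y" "p \<noteq> y" "p \<noteq> v"
    using yp lt Dx(2) xp0 c by (auto simp: nb_def)
  obtain r where Dy: "D y = {y, v, p, r}" "distinct [y, v, p, r]" "a v p = 0" "a v r = 0"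
    and alty: "a p p = - a y y \<and> a r r = - a y y \<and> a p r = 0 \<or> a p p = 0 \<and> a r r = 0 \<and> a p r \<noteq> 0"
    using opposite_neighbour'[OF nt lt(2) yz0(1) vD(1) vv(1) py] .
  have rn: "r < n" using D_less[of r y] Dy(1) by simp
  have eyz: "1 + a y p * a p z + a y r * a r z = 0"
    by (rule pair_equation[OF Dy(1,2) lt(2,3) ne(3) c(6) N'(2) N(4)])
  have xpy: "a x p * a p y = -1" using exy y(2) by (simp add: eq_neg_iff_add_eq_0 add.commute)
  \<comment> \<open>If p were adjacent to z, multiplying the relations of x with y and of x with z
    would give \<open>a y p * a p z = 1\<close>, and rows y and z would give 2 + w = 0 with |w| <=
    1.\<close>
  have pz: "a p z = 0"
  proof (rule ccontr)
    assume "a p z \<noteq> 0"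
    then have "a q z = 0" using z by simp
    then have xpz: "a x p * a p z = -1" using exz by (simp add: eq_neg_iff_add_eq_0 add.commute)
    have ypx: "a y p * a p x = -1"
      using arg_cong[OF xpy, of cnj] herm[OF lt(1,4)] herm[OF lt(4,2)] by (simp add: mult.commute)
    have ux: "a p x * a x p = 1" using unit_cnj_mult(1)[OF entries[OF lt(1,4) xp0(1)]] herm[OF lt(1,4)] by simp
    have "a y p * a p z = a y p * (a p x * a x p) * a p z" using ux by simp
    also have "\<dots> = (a y p * a p x) * (a x p * a p z)" by (simp add: mult_ac)
    also have "\<dots> = 1" using ypx xpz by simp
    finally have "2 + a y r * a r z = 0" using eyz by simp
    then show False using add_two prod_le_1[OF lt(2) rn rn lt(3)] by blast
  qed
  have qz: "a q z \<noteq> 0" using exz pz by auto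
  have zq: "a z q \<noteq> 0" using qz zero_sym[OF lt(5,3)] by simp
  have qq: "q \<in> D z" "q \<noteq> z" "q \<noteq> v"
    using zq lt Dx(2) xp0 c by (auto simp: nb_def)
  obtain r' where Dz': "D z = {z, v, q, r'}" "distinct [z, v, q, r']" "a v q = 0" "a v r' = 0"
    and altz': "a q q = - a z z \<and> a r' r' = - a z z \<and> a q r' = 0 \<or> a q q = 0 \<and> a r' r' = 0 \<and> a q r' \<noteq> 0"
    using opposite_neighbour'[OF nt lt(3) yz0(2) vD(2) vv(2) qq] .
  have rz: "a r z \<noteq> 0" using eyz pz by auto
  then have "r \<in> D z" using zero_sym[OF rn lt(3)] rn by (simp add: nb_def)
  moreover have r_ne: "r \<noteq> z" "r \<noteq> v" "r \<noteq> q" "r \<noteq> x" "r \<noteq> p" "r \<noteq> y"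
  proof -
    have "a y r \<noteq> 0" using Dy(1) by (auto simp: nb_def)
    then show "r \<noteq> z" "r \<noteq> q" "r \<noteq> x" using c(4,6) y(2) zero_sym[OF lt(5,2)] zero_sym[OF lt(1,2)] by auto
  qed (use Dy(2) in auto)
  ultimately have rr: "r' = r" using Dz'(1) by auto
  note Dz = Dz'[unfolded rr] and altz = altz'[unfolded rr]
  have q_ne: "q \<noteq> y" using xp0 c by auto
  have p_ne: "p \<noteq> z" using xp0 c by auto
  have d7: "distinct [v, x, y, z, p, q, r]"
    using v(3) Dx(2) Dy(2) Dz(2) r_ne q_ne p_ne qq(2) py(2) by auto
  have sym: "a p x \<noteq> 0" "a q x \<noteq> 0" "a r y \<noteq> 0"
    using xp0 zero_sym[OF lt(1,4)] zero_sym[OF lt(1,5)] zero_sym[OF lt(2) rn] Dy(1) by (auto simp: nb_def)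
  show ?thesis
  proof (cases "a p p = 0")
    case True
    then have pq: "a q q = 0" "a p q \<noteq> 0" using alt by auto
    have pr: "a r r = 0" "a p r \<noteq> 0" using alty True c by auto
    have qr: "a q r \<noteq> 0" using altz pq c by auto
    have s: "a q p \<noteq> 0" "a r p \<noteq> 0" "a r q \<noteq> 0"
      using pq pr qr zero_sym[OF lt(4,5)] zero_sym[OF lt(4) rn] zero_sym[OF lt(5) rn] by simp_all
    have Dp: "D p = {x, y, q, r}"
      by (rule card4_eq[OF degree[OF lt(4)]]) (use sym y pq pr lt rn d7 in \<open>auto simp: nb_def\<close>)
    have Dq: "D q = {x, z, p, r}"
      by (rule card4_eq[OF degree[OF lt(5)]]) (use sym qz s qr lt rn d7 in \<open>auto simp: nb_def\<close>)
    have Dr: "D r = {y, z, p, q}"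
      by (rule card4_eq[OF degree[OF rn]]) (use sym rz s lt rn d7 in \<open>auto simp: nb_def\<close>)
    show ?thesis by (rule case_S7[OF d7 v(2) Dx(1) Dy(1) Dz(1) Dp Dq Dr N(1) c(1-3)])
  next
    case False
    then have ch: "a p p = 1" "a q q = 1" "a p q = 0" using alt by auto
    have ch2: "a r r = 1" "a p r = 0" using alty False c by auto
    have mp: "p \<in> D p" "x \<in> D p" "y \<in> D p" "distinct [p, x, y]"
      using ch sym y lt d7 by (auto simp: nb_def)
    \<comment> \<open>The far corner of the cube: the fourth neighbour of p, which orthogonality
      with rows x and y attaches to q and r as well.\<close>
    obtain w where Dp: "D p = {p, x, y, w}" "distinct [p, x, y, w]"
      using card4_cases3[OF degree[OF lt(4)] mp] .
    have pw: "a p w \<noteq> 0" "w < n" using Dp(1) by (auto simp: nb_def)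
    have w_ne: "w \<noteq> v" "w \<noteq> z" "w \<noteq> q" "w \<noteq> r"
      using pw pz ch ch2 vp(1) zero_sym[OF v(1) lt(4)] by auto
    have d8: "distinct [v, p, q, r, x, y, z, w]" using d7 Dp(2) w_ne by auto
    have z0: "a v w = 0" "a x w = 0" "a y w = 0"
      using D_zero[OF pw(2)] v(2) Dx(1) Dy(1) d8 by auto
    have ne2: "x \<noteq> w" "y \<noteq> w" "p \<noteq> w" using Dp(2) by auto
    have qw: "a q w \<noteq> 0" using orth4[OF Dx lt(1) pw(2) ne2(1)] z0 xp0 pw(1) by auto
    have rw: "a r w \<noteq> 0" using orth4[OF Dy(1,2) lt(2) pw(2) ne2(2)] z0 yp pw(1) by auto
    have "a p w * (1 + a w w) = 0"
      using orth4[OF Dp lt(4) pw(2) ne2(3)] z0 ch by (simp add: algebra_simps)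
    then have ww: "a w w = -1" using pw(1) by (simp add: eq_neg_iff_add_eq_0 add.commute)
    have Dq: "D q = {q, x, z, w}"
      by (rule card4_eq[OF degree[OF lt(5)]]) (use sym qz qw ch lt pw d8 in \<open>auto simp: nb_def\<close>)
    have Dr: "D r = {r, y, z, w}"
      by (rule card4_eq[OF degree[OF rn]]) (use sym rz rw ch2 lt rn pw d8 in \<open>auto simp: nb_def\<close>)
    have Dw: "D w = {w, p, q, r}"
      by (rule card4_eq[OF degree[OF pw(2)]])
        (use pw qw rw ww lt rn d8 zero_sym[OF lt(4) pw(2)] zero_sym[OF lt(5) pw(2)] zero_sym[OF rn pw(2)] in \<open>auto simp: nb_def\<close>)
    show ?thesis
      by (rule case_S8[OF d8 v(2) Dp(1) Dq Dr Dx(1) Dy(1) Dz(1) Dw N(1) ch(1,2) ch2(1) c(1-3) ww])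
  qed
qed

text \<open>Rows x, y and x, z give each of y and z a neighbour among p and q. Up to exchanging y
  with z and p with q, either y is adjacent to both, or y is adjacent to p alone and z is not
  adjacent to both.\<close>

lemma type1_normal:
  assumes nt: no_twins and v: "v < n" "D v = {v, x, y, z}" "distinct [v, x, y, z]"
    and N: "a v v = 1" "a v x = 1" "a v y = 1" "a v z = 1" and t: "type1 a v x y z"
  shows "listed n a"
proof -
  have lt: "x < n" "y < n" "z < n" using D_less[of x v] D_less[of y v] D_less[of z v] v(2) by simp_all
  have c: "a x x = -1" "a y y = -1" "a z z = -1" "a x y = 0" "a x z = 0" "a y z = 0"
    using t N by (simp_all add: type1_def)
  have N': "a x v = 1" "a y v = 1" "a z v = 1"
    using herm[OF v(1) lt(1)] herm[OF v(1) lt(2)] herm[OF v(1) lt(3)] N by simp_all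
  have ne: "x \<noteq> y" "x \<noteq> z" "y \<noteq> z" using v(3) by auto
  have x0: "a x x \<noteq> 0" "v \<in> D x" "a v v = - a x x" using c N N' v(1) by (simp_all add: nb_def)
  obtain p q where Dx: "D x = {x, v, p, q}" "distinct [x, v, p, q]" and vp: "a v p = 0" "a v q = 0"
    and alt': "a p p = - a x x \<and> a q q = - a x x \<and> a p q = 0 \<or> a p p = 0 \<and> a q q = 0 \<and> a p q \<noteq> 0"
    using opposite_neighbour[OF nt lt(1) x0] by blast
  have ltp: "p < n" "q < n" using D_less[of p x] D_less[of q x] Dx(1) by simp_all
  have alt: "a p p = 1 \<and> a q q = 1 \<and> a p q = 0 \<or> a p p = 0 \<and> a q q = 0 \<and> a p q \<noteq> 0"
    using alt' c by simp
  have alts: "a q q = 1 \<and> a p p = 1 \<and> a q p = 0 \<or> a q q = 0 \<and> a p p = 0 \<and> a q p \<noteq> 0"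
    using alt zero_sym[OF ltp] by auto
  have Dxs: "D x = {x, v, q, p}" "distinct [x, v, q, p]" using Dx by auto
  have vs: "D v = {v, x, z, y}" "distinct [v, x, z, y]" "type1 a v x z y"
    using v(2,3) t zero_sym[OF lt(2,3)] by (auto simp: type1_def)
  have xpq: "a x p \<noteq> 0" "a x q \<noteq> 0" using Dx(1) by (auto simp: nb_def)
  have full: "D w = {w, v, p, q} \<and> distinct [w, v, p, q]"
    if "a p w \<noteq> 0" "a q w \<noteq> 0" "w < n" "a w w = -1" "a w v = 1" "w \<noteq> v" "a x w = 0" for w
  proof -
    have "w \<noteq> p" "w \<noteq> q" using xpq that(7) by auto
    then have d: "distinct [w, v, p, q]" using that(6) Dx(2) by auto
    have "{w, v, p, q} \<subseteq> D w"
      using that ltp v(1) zero_sym[OF ltp(1) that(3)] zero_sym[OF ltp(2) that(3)] by (simp add: nb_def)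
    then show ?thesis using card4_eq[OF degree[OF that(3)] _ d] d by simp
  qed
  have exy: "1 + a x p * a p y + a x q * a q y = 0"
    by (rule pair_equation[OF Dx lt(1,2) ne(1) c(4) N'(1) N(3)])
  show ?thesis
  proof (cases "a p y \<noteq> 0 \<and> a q y \<noteq> 0")
    case True
    have "D y = {y, v, p, q} \<and> distinct [y, v, p, q]" using full[of y] True lt c N' v(3) by auto
    then show ?thesis using type1_both[OF nt v N t Dx _ _ vp alt] by simp
  next
    case y: False
    show ?thesis
    proof (cases "a p z \<noteq> 0 \<and> a q z \<noteq> 0")
      case True
      have "D z = {z, v, p, q} \<and> distinct [z, v, p, q]" using full[of z] True lt c N' v(3) by auto
      then show ?thesis using type1_both[OF nt v(1) vs(1,2) N(1,2,4,3) vs(3) Dx _ _ vp alt] by simp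
    next
      case z: False
      show ?thesis
      proof (cases "a p y = 0")
        case True
        then have "a q y \<noteq> 0" using exy by auto
        then show ?thesis
          using type1_single[OF nt v N t Dxs vp(2,1) alts] True z by blast
      next
        case False
        then show ?thesis using type1_single[OF nt v N t Dx vp alt] y z by blast
      qed
    qed
  qed
qed

end

context sat_mat
begin

lemma case_type1:
  assumes nt: no_twins and v: "v < n" "D v = {v, x, y, z}" "distinct [v, x, y, z]"
    and vv: "a v v = 1" and t: "type1 a v x y z"
  shows "listed n a"
proof (rule listed_tree[of "[(v, z), (v, y), (v, x)]"])
  fix b assume "sat_mat n b" and nb: "\<And>i. i < n \<Longrightarrow> nb n b i = D i" and dg: "\<And>i. b i i = a i i"
    and z0: "\<And>i j. b i j = 0 \<longleftrightarrow> a i j = 0" and e: "\<forall>(p, c)\<in>set [(v, z), (v, y), (v, x)]. b p c = 1"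
  interpret b: sat_mat n b by fact
  have "b.no_twins" using nt unfolding b.no_twins_def no_twins_def dg z0 .
  moreover have "nb n b v = {v, x, y, z}" using nb[OF v(1)] v(2) by simp
  moreover have "b v v = 1" "b v x = 1" "b v y = 1" "b v z = 1" using e vv dg by simp_all
  moreover have "type1 b v x y z" using t unfolding type1_def dg z0 .
  ultimately show "listed n b" using b.type1_normal[OF _ v(1) _ v(3)] by blast
qed (use v in auto)

text \<open>Used when v has a single neighbour x of opposite charge, but x, of charge -1, has
  three.\<close>

lemma neg_type1:
  assumes nt: no_twins and v: "v < n" "D v = {v, x, y, z}" "distinct [v, x, y, z]"
    and vv: "a v v = -1" and t: "type1 a v x y z"
  shows "listed n a"
proof (rule listed_neg)
  have "type1 (\<lambda>i j. - a i j) v x y z" using t by (simp add: type1_def)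
  then show "listed n (\<lambda>i j. - a i j)"
    using sat_mat.case_type1[OF negate no_twins_neg[OF nt] v(1) _ v(3)] v(2) vv unfolding nb_neg by simp
qed

section \<open>A charged vertex with one neighbour of opposite charge\<close>

text \<open>The missing fourth neighbours come in pairs: y and z share one, w, and p and q share
  another, t. Orthogonality then makes w and t adjacent and both charged, and eight vertices close
  up to S_8'.\<close>

lemma type3_single:
  assumes nt: no_twins and v: "v < n" "D v = {v, x, y, z}" "distinct [v, x, y, z]"
    and N: "a v v = 1" "a v x = 1" "a v y = 1" "a v z = 1" and t: "type3 a v x y z"
    and Dx: "D x = {x, v, p, q}" "distinct [x, v, p, q]" and vp: "a v p = 0" "a v q = 0"
    and alt: "a p p = 0" "a q q = 0" "a p q \<noteq> 0"
    and y: "a p y \<noteq> 0" "a q y = 0" and z: "a p z = 0" "a q z \<noteq> 0"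
  shows "listed n a"
proof -
  have lt: "x < n" "y < n" "z < n" "p < n" "q < n"
    using D_less[of x v] D_less[of y v] D_less[of z v] D_less[of p x] D_less[of q x] v(2) Dx(1) by simp_all
  have c: "a x x = -1" "a y y = 0" "a z z = 0" "a x y = 0" "a x z = 0" "a y z \<noteq> 0"
    using t N by (simp_all add: type3_def)
  have N': "a x v = 1" "a y v = 1" "a z v = 1"
    using herm[OF v(1) lt(1)] herm[OF v(1) lt(2)] herm[OF v(1) lt(3)] N by simp_all
  have xp: "a x p \<noteq> 0" "a x q \<noteq> 0" using Dx(1) by (auto simp: nb_def)
  have s: "a y x = 0" "a z x = 0" "a z y \<noteq> 0" "a y p \<noteq> 0" "a z q \<noteq> 0" "a p x \<noteq> 0" "a q x \<noteq> 0" "a q p \<noteq> 0"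
    using c y z xp alt zero_sym[OF lt(1,2)] zero_sym[OF lt(1,3)] zero_sym[OF lt(2,3)] zero_sym[OF lt(4,2)]
      zero_sym[OF lt(5,3)] zero_sym[OF lt(1,4)] zero_sym[OF lt(1,5)] zero_sym[OF lt(4,5)] by simp_all
  have d6: "distinct [v, x, y, z, p, q]"
    using v(3) Dx(2) y z alt xp c by auto
  have "v \<in> D y" "z \<in> D y" "p \<in> D y" "distinct [v, z, p]" "v \<in> D z" "y \<in> D z" "q \<in> D z" "distinct [v, y, q]"
    using N' c s v(1) lt d6 by (simp_all add: nb_def)
  note m = this
  obtain w where Dy: "D y = {v, z, p, w}" "distinct [v, z, p, w]" using card4_cases3[OF degree[OF lt(2)] m(1-4)] .
  obtain w' where Dz: "D z = {v, y, q, w'}" "distinct [v, y, q, w']" using card4_cases3[OF degree[OF lt(3)] m(5-8)] .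
  have w: "a y w \<noteq> 0" "w < n" using Dy(1) by (auto simp: nb_def)
  have w': "a z w' \<noteq> 0" "w' < n" using Dz(1) by (auto simp: nb_def)
  have wne: "w \<noteq> x" "w \<noteq> y" "w \<noteq> q" using w s c y zero_sym[OF lt(5,2)] by auto
  have ne: "y \<noteq> z" "p \<noteq> q" "y \<noteq> p" "y \<noteq> x" using d6 by auto
  \<comment> \<open>Rows y and z meet at v with product 1, and w is the only vertex left through
    which this can cancel.\<close>
  have wz: "a w z \<noteq> 0"
  proof
    assume "a w z = 0"
    then show False using orth4[OF Dy lt(2,3) ne(1)] N N' c z by simp
  qed
  then have "w \<in> D z" using zero_sym[OF w(2) lt(3)] w(2) by (simp add: nb_def)
  then have "w \<in> {v, y, q, w'}" unfolding Dz(1) .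
  then have "w' = w" using Dy(2) wne by auto
  note Dz = Dz[unfolded this]
  have "x \<in> D p" "q \<in> D p" "y \<in> D p" "distinct [x, q, y]" "x \<in> D q" "p \<in> D q" "z \<in> D q" "distinct [x, p, z]"
    using s y z alt lt d6 by (auto simp: nb_def)
  note m = this
  obtain t where Dp: "D p = {x, q, y, t}" "distinct [x, q, y, t]" using card4_cases3[OF degree[OF lt(4)] m(1-4)] .
  obtain t' where Dq: "D q = {x, p, z, t'}" "distinct [x, p, z, t']" using card4_cases3[OF degree[OF lt(5)] m(5-8)] .
  have t: "a p t \<noteq> 0" "t < n" using Dp(1) by (auto simp: nb_def)
  have t': "a q t' \<noteq> 0" "t' < n" using Dq(1) by (auto simp: nb_def)
  have tne: "t \<noteq> v" "t \<noteq> p" "t \<noteq> z" "t \<noteq> q" "t \<noteq> x" "t \<noteq> y"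
    using t zero_sym[OF v(1) lt(4)] vp alt z Dp(2) by auto
  have d7: "distinct [v, x, y, z, p, q, w]" using d6 Dy(2) Dz(2) wne by auto
  have pw: "a p w = 0"
  proof -
    have "a w p = 0" using orth4[OF Dy lt(2,4) ne(3)] vp zero_sym[OF lt(4,3)] z alt w by simp
    then show ?thesis using zero_sym[OF lt(4) w(2)] by simp
  qed
  then have tw: "t \<noteq> w" using t by auto
  have tq: "a t q \<noteq> 0"
  proof
    assume "a t q = 0"
    then have "a p x * a x q = 0" using orth4[OF Dp lt(4,5) ne(2)] alt zero_sym[OF lt(5,2)] y by simp
    then show False using s xp by simp
  qed
  then have "t \<in> D q" using zero_sym[OF t(2) lt(5)] t(2) by (simp add: nb_def)
  then have "t \<in> {x, p, z, t'}" unfolding Dq(1) .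
  then have "t' = t" using tne by auto
  note Dq = Dq[unfolded this]
  have d8: "distinct [v, x, y, z, p, q, w, t]" using d7 tne tw by auto
  have z0: "a v t = 0" "a y t = 0" "a z t = 0" "a x t = 0" "a v w = 0" "a x w = 0" "a q w = 0"
    using D_zero[OF t(2)] D_zero[OF w(2)] v(2) Dx(1) Dy(1) Dz(1) Dq(1) d8 by auto
  have yt: "y \<noteq> t" "y \<noteq> w" "p \<noteq> t" using d8 by auto
  have wt: "a w t \<noteq> 0"
  proof
    assume "a w t = 0"
    then have "a y p * a p t = 0" using orth4[OF Dy lt(2) t(2) yt(1)] z0 by simp
    then show False using s t by simp
  qed
  have zw: "a z w \<noteq> 0" using zero_sym[OF w(2) lt(3)] wz by simp
  have ww: "a w w \<noteq> 0"
  proof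
    assume "a w w = 0"
    then have "a y z * a z w = 0" using orth4[OF Dy lt(2) w(2) yt(2)] z0 pw by simp
    then show False using c zw by simp
  qed
  have qt: "a q t \<noteq> 0" using zero_sym[OF t(2) lt(5)] tq by simp
  have tt: "a t t \<noteq> 0"
  proof
    assume "a t t = 0"
    then have "a p q * a q t = 0" using orth4[OF Dp lt(4) t(2) yt(3)] z0 by simp
    then show False using alt qt by simp
  qed
  have r: "a w y \<noteq> 0" "a t p \<noteq> 0" "a t w \<noteq> 0"
    using w t wt zero_sym[OF lt(2) w(2)] zero_sym[OF lt(4) t(2)] zero_sym[OF w(2) t(2)] by simp_all
  have Dw: "D w = {w, y, z, t}"
    by (rule card4_eq[OF degree[OF w(2)]]) (use r wz wt ww lt w t d8 in \<open>auto simp: nb_def\<close>)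
  have Dt: "D t = {t, p, q, w}"
    by (rule card4_eq[OF degree[OF t(2)]]) (use r tq tt lt w t d8 in \<open>auto simp: nb_def\<close>)
  show ?thesis by (rule case_S8_prime[OF d8 v(2) Dx(1) Dy(1) Dz(1) Dp(1) Dq(1) Dw Dt N(1) c(1)])
qed

text \<open>Row y is full with v, z, p, q, and its orthogonality to p and to q forces z to be
  adjacent to both; six vertices close up.\<close>

lemma type3_both:
  assumes v: "v < n" "D v = {v, x, y, z}" "distinct [v, x, y, z]"
    and N: "a v v = 1" "a v x = 1" "a v y = 1" "a v z = 1" and t: "type3 a v x y z"
    and Dx: "D x = {x, v, p, q}" "distinct [x, v, p, q]" and vp: "a v p = 0" "a v q = 0"
    and alt: "a p p = 0" "a q q = 0" "a p q \<noteq> 0"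
    and y: "a p y \<noteq> 0" "a q y \<noteq> 0"
  shows "listed n a"
proof -
  have lt: "x < n" "y < n" "z < n" "p < n" "q < n"
    using D_less[of x v] D_less[of y v] D_less[of z v] D_less[of p x] D_less[of q x] v(2) Dx(1) by simp_all
  have c: "a x x = -1" "a y y = 0" "a z z = 0" "a x y = 0" "a x z = 0" "a y z \<noteq> 0"
    using t N by (simp_all add: type3_def)
  have N': "a x v = 1" "a y v = 1" "a z v = 1"
    using herm[OF v(1) lt(1)] herm[OF v(1) lt(2)] herm[OF v(1) lt(3)] N by simp_all
  have xp: "a x p \<noteq> 0" "a x q \<noteq> 0" using Dx(1) by (auto simp: nb_def)
  have s: "a z y \<noteq> 0" "a y p \<noteq> 0" "a y q \<noteq> 0" "a p x \<noteq> 0" "a q x \<noteq> 0" "a q p \<noteq> 0"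
    using c y xp alt zero_sym[OF lt(2,3)] zero_sym[OF lt(4,2)]
      zero_sym[OF lt(5,2)] zero_sym[OF lt(1,4)] zero_sym[OF lt(1,5)] zero_sym[OF lt(4,5)] by simp_all
  have d6: "distinct [v, x, y, z, p, q]"
    using v(3) Dx(2) alt xp c by auto
  have dy: "distinct [v, z, p, q]" "y \<noteq> p" "y \<noteq> q" using d6 by auto
  have Dy: "D y = {v, z, p, q}"
    by (rule card4_eq[OF degree[OF lt(2)]]) (use N' s c v(1) lt d6 in \<open>auto simp: nb_def\<close>)
  have zp: "a z p \<noteq> 0"
  proof
    assume "a z p = 0"
    then have "a y q * a q p = 0" using orth4[OF Dy dy(1) lt(2,4) dy(2)] vp alt by simp
    then show False using s by simp
  qed
  have zq: "a z q \<noteq> 0"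
  proof
    assume "a z q = 0"
    then have "a y p * a p q = 0" using orth4[OF Dy dy(1) lt(2,5) dy(3)] vp alt by simp
    then show False using s alt by simp
  qed
  have pz: "a p z \<noteq> 0" "a q z \<noteq> 0" using zp zq zero_sym[OF lt(4,3)] zero_sym[OF lt(5,3)] by simp_all
  have Dz: "D z = {v, y, p, q}"
    by (rule card4_eq[OF degree[OF lt(3)]]) (use N' s zp zq c v(1) lt d6 in \<open>auto simp: nb_def\<close>)
  have Dp: "D p = {x, q, y, z}"
    by (rule card4_eq[OF degree[OF lt(4)]]) (use s y pz alt lt d6 in \<open>auto simp: nb_def\<close>)
  have Dq: "D q = {x, p, y, z}"
    by (rule card4_eq[OF degree[OF lt(5)]]) (use s y pz alt lt d6 in \<open>auto simp: nb_def\<close>)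
  show ?thesis by (rule case_S6_dagger[OF d6 v(2) Dx(1) Dy Dz Dp Dq N(1) c(1)])
qed

lemma type3_normal:
  assumes nt: no_twins and v: "v < n" "D v = {v, x, y, z}" "distinct [v, x, y, z]"
    and N: "a v v = 1" "a v x = 1" "a v y = 1" "a v z = 1" and t: "type3 a v x y z"
  shows "listed n a"
proof -
  have lt: "x < n" "y < n" "z < n" using D_less[of x v] D_less[of y v] D_less[of z v] v(2) by simp_all
  have c: "a x x = -1" "a y y = 0" "a z z = 0" "a x y = 0" "a x z = 0" "a y z \<noteq> 0"
    using t N by (simp_all add: type3_def)
  have N': "a x v = 1" "a y v = 1" "a z v = 1"
    using herm[OF v(1) lt(1)] herm[OF v(1) lt(2)] herm[OF v(1) lt(3)] N by simp_all
  have ne: "x \<noteq> y" "x \<noteq> z" using v(3) by auto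
  have x0: "a x x \<noteq> 0" "v \<in> D x" "a v v = - a x x" using c N N' v(1) by (simp_all add: nb_def)
  obtain p q where Dx: "D x = {x, v, p, q}" "distinct [x, v, p, q]" and vp: "a v p = 0" "a v q = 0"
    and alt: "a p p = - a x x \<and> a q q = - a x x \<and> a p q = 0 \<or> a p p = 0 \<and> a q q = 0 \<and> a p q \<noteq> 0"
    using opposite_neighbour[OF nt lt(1) x0] by blast
  have ltp: "p < n" "q < n" using D_less[of p x] D_less[of q x] Dx(1) by simp_all
  have xp: "a x p \<noteq> 0" "a x q \<noteq> 0" using Dx(1) by (auto simp: nb_def)
  from alt show ?thesis
  proof (elim disjE conjE)
    assume "a p p = - a x x" "a q q = - a x x" "a p q = 0"
    \<comment> \<open>Seen from x this is the settled case of three opposite charges, up to a global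
      sign.\<close>
    then have "type1 a x v p q" using c N vp by (simp add: type1_def)
    then show ?thesis using neg_type1[OF nt lt(1) Dx c(1)] by simp
  next
    assume pq: "a p p = 0" "a q q = 0" "a p q \<noteq> 0"
    have qp: "a q p \<noteq> 0" using pq zero_sym[OF ltp] by simp
    have Dxs: "D x = {x, v, q, p}" "distinct [x, v, q, p]" using Dx by auto
    have vs: "D v = {v, x, z, y}" "distinct [v, x, z, y]" "type3 a v x z y"
      using v(2,3) t zero_sym[OF lt(2,3)] by (auto simp: type3_def)
    have exy: "1 + a x p * a p y + a x q * a q y = 0"
      by (rule pair_equation[OF Dx lt(1,2) ne(1) c(4) N'(1) N(3)])
    have exz: "1 + a x p * a p z + a x q * a q z = 0"
      by (rule pair_equation[OF Dx lt(1,3) ne(2) c(5) N'(1) N(4)])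
    have vne: "v \<noteq> p" "v \<noteq> q" using Dx(2) by auto
    have ep: "a x p + a y p + a z p = 0" using orth4[OF v(2,3,1) ltp(1) vne(1)] N vp by simp
    have eq: "a x q + a y q + a z q = 0" using orth4[OF v(2,3,1) ltp(2) vne(2)] N vp by simp
    have sy: "a y p = 0 \<longleftrightarrow> a p y = 0" "a y q = 0 \<longleftrightarrow> a q y = 0" "a z p = 0 \<longleftrightarrow> a p z = 0" "a z q = 0 \<longleftrightarrow> a q z = 0"
      using zero_sym ltp lt by simp_all
    \<comment> \<open>Rows x, y and x, z give y and z a neighbour among p and q; rows v, p and v, q
      give p and q a neighbour among y and z.\<close>
    have 1: "a p y \<noteq> 0 \<or> a q y \<noteq> 0" "a p z \<noteq> 0 \<or> a q z \<noteq> 0" "a p y \<noteq> 0 \<or> a p z \<noteq> 0" "a q y \<noteq> 0 \<or> a q z \<noteq> 0"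
      using exy exz ep eq xp sy by auto
    consider "a p y \<noteq> 0 \<and> a q y \<noteq> 0" | "a p z \<noteq> 0 \<and> a q z \<noteq> 0"
      | "a p y \<noteq> 0 \<and> a q y = 0 \<and> a p z = 0 \<and> a q z \<noteq> 0" | "a q y \<noteq> 0 \<and> a p y = 0 \<and> a q z = 0 \<and> a p z \<noteq> 0"
      using 1 by argo
    then show ?thesis
    proof cases
      case 1 then show ?thesis using type3_both[OF v N t Dx vp pq] by simp
    next
      case 2 then show ?thesis using type3_both[OF v(1) vs(1,2) N(1,2,4,3) vs(3) Dx vp pq] by simp
    next
      case 3 then show ?thesis using type3_single[OF nt v N t Dx vp pq] by simp
    next
      case 4 then show ?thesis using type3_single[OF nt v N t Dxs vp(2,1) pq(2,1) qp] by simp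
    qed
  qed
qed

section \<open>A charged vertex with an uncharged triangle\<close>

text \<open>The fourth neighbour w of x is forced onto y and z by the inequalities of
  \<open>star_type4\<close>, and the last entry of row w can only be a loop.\<close>

lemma type4_normal:
  assumes v: "v < n" "D v = {v, x, y, z}" "distinct [v, x, y, z]"
    and N: "a v v = 1" "a v x = 1" "a v y = 1" "a v z = 1" and t: "type4 a v x y z"
  shows "listed n a"
proof -
  have lt: "x < n" "y < n" "z < n" using D_less[of x v] D_less[of y v] D_less[of z v] v(2) by simp_all
  have c: "a x x = 0" "a y y = 0" "a z z = 0" "a x y \<noteq> 0" "a x z \<noteq> 0" "a y z \<noteq> 0"
    using t N by (simp_all add: type4_def)
  have nz: "1 + a x z * a z y \<noteq> 0" "1 + a x y * a y z \<noteq> 0" using star_type4[OF v N c(1-3)] by simp_all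
  have N': "a x v = 1" "a y v = 1" "a z v = 1"
    using herm[OF v(1) lt(1)] herm[OF v(1) lt(2)] herm[OF v(1) lt(3)] N by simp_all
  have s: "a y x \<noteq> 0" "a z x \<noteq> 0" "a z y \<noteq> 0"
    using c zero_sym[OF lt(1,2)] zero_sym[OF lt(1,3)] zero_sym[OF lt(2,3)] by simp_all
  have "v \<in> D x" "y \<in> D x" "z \<in> D x" "distinct [v, y, z]" using N' c v lt by (auto simp: nb_def)
  from card4_cases3[OF degree[OF lt(1)] this] obtain w where Dx: "D x = {v, y, z, w}" "distinct [v, y, z, w]" .
  have w: "a x w \<noteq> 0" "w < n" using Dx(1) by (auto simp: nb_def)
  have wx: "w \<noteq> x" using w c by auto
  have ne: "x \<noteq> y" "x \<noteq> z" using v(3) by auto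
  have wy: "a w y \<noteq> 0" using orth4[OF Dx lt(1,2) ne(1)] N N' c nz by auto
  have wz: "a w z \<noteq> 0" using orth4[OF Dx lt(1,3) ne(2)] N N' c nz by auto
  have ws: "a y w \<noteq> 0" "a z w \<noteq> 0" "a w x \<noteq> 0"
    using w wy wz zero_sym[OF w(2) lt(2)] zero_sym[OF w(2) lt(3)] zero_sym[OF lt(1) w(2)] by simp_all
  have d5: "distinct [v, x, y, z, w]" using v(3) Dx(2) wx by auto
  have Dy: "D y = {v, x, z, w}"
    by (rule card4_eq[OF degree[OF lt(2)]]) (use N' s c ws v(1) lt w d5 in \<open>auto simp: nb_def\<close>)
  have Dz: "D z = {v, x, y, w}"
    by (rule card4_eq[OF degree[OF lt(3)]]) (use N' s c ws v(1) lt w d5 in \<open>auto simp: nb_def\<close>)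
  have "x \<in> D w" "y \<in> D w" "z \<in> D w" "distinct [x, y, z]" using ws wy wz lt d5 by (auto simp: nb_def)
  from card4_cases3[OF degree[OF w(2)] this] obtain u where Dw: "D w = {x, y, z, u}" "distinct [x, y, z, u]" .
  have u: "a w u \<noteq> 0" "u < n" using Dw(1) by (auto simp: nb_def)
  \<comment> \<open>Any other u would leave the single nonzero term \<open>a x w * a w u\<close> in
    the orthogonality of x and u.\<close>
  have "u = w"
  proof (rule ccontr)
    assume "u \<noteq> w"
    have uv: "u \<noteq> v"
    proof
      assume "u = v"
      then have "a v w \<noteq> 0" using u zero_sym[OF w(2) v(1)] by simp
      then have "w \<in> D v" using w(2) by (simp add: nb_def)
      then show False using v(2) d5 by auto
    qed
    have "a v u = 0" "a y u = 0" "a z u = 0"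
      using D_zero[OF u(2)] v(2) Dy Dz uv Dw(2) \<open>u \<noteq> w\<close> by auto
    moreover have "x \<noteq> u" using Dw(2) by auto
    ultimately have "a x w * a w u = 0" using orth4[OF Dx lt(1) u(2)] by simp
    then show False using w u by simp
  qed
  then have Dw': "D w = {w, x, y, z}" using Dw(1) by auto
  show ?thesis by (rule case_S5[OF d5 v(2) Dx(1) Dy Dz Dw' N(1)])
qed

lemma case_no_twins:
  assumes nt: no_twins and v: "v < n" and vv: "a v v = 1"
  shows "listed n a"
proof -
  obtain x y z where D1: "D v = {v, x, y, z}" "distinct [v, x, y, z]"
    and t: "type1 a v x y z \<or> type3 a v x y z \<or> type4 a v x y z"
    using star_typed[OF nt v vv] by (elim exE conjE)
  show ?thesis
  proof (rule listed_tree[of "[(v, z), (v, y), (v, x)]"])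
    fix b assume "sat_mat n b" and nb: "\<And>i. i < n \<Longrightarrow> nb n b i = D i" and dg: "\<And>i. b i i = a i i"
      and z0: "\<And>i j. b i j = 0 \<longleftrightarrow> a i j = 0" and e: "\<forall>(p, c)\<in>set [(v, z), (v, y), (v, x)]. b p c = 1"
    interpret b: sat_mat n b by fact
    have nt': "b.no_twins" using nt unfolding b.no_twins_def no_twins_def dg z0 .
    have D2: "nb n b v = {v, x, y, z}" using nb[OF v] D1 by simp
    have N: "b v v = 1" "b v x = 1" "b v y = 1" "b v z = 1" using e vv dg by simp_all
    have "type1 b v x y z \<or> type3 b v x y z \<or> type4 b v x y z"
      using t unfolding type1_def type3_def type4_def dg z0 .
    then show "listed n b"
    proof (elim disjE)
      assume "type1 b v x y z" then show ?thesis by (rule b.type1_normal[OF nt' v D2 D1(2) N])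
    next
      assume "type3 b v x y z" then show ?thesis by (rule b.type3_normal[OF nt' v D2 D1(2) N])
    next
      assume "type4 b v x y z" then show ?thesis by (rule b.type4_normal[OF v D2 D1(2) N])
    qed
  qed (use v D1 in auto)
qed

end

section \<open>The two infinite families\<close>

fun lvl :: "ladder_vertex \<Rightarrow> nat" where
  "lvl (Top j) = j" | "lvl (Bot j) = j"

fun sg :: "ladder_vertex \<Rightarrow> complex" where
  "sg (Top j) = 1" | "sg (Bot j) = -1"

text \<open>The ladder with its first end already closed: inside level 1 all entries, charges
  included, are 1. Inside later levels they are 0, so each of the two families is this function with
  a modified last level.\<close>

definition ladder_weight :: "ladder_vertex \<Rightarrow> ladder_vertex \<Rightarrow> complex" where
  "ladder_weight u v = (if lvl v = Suc (lvl u) then sg u else if lvl u = Suc (lvl v) then sg v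
     else if lvl u = 1 \<and> lvl v = 1 then 1 else 0)"

lemma lvl_iff: "lvl u = k \<longleftrightarrow> u = Top k \<or> u = Bot k"
  by (cases u) auto

lemma ladder_vertices_iff: "u \<in> ladder_vertices k \<longleftrightarrow> 1 \<le> lvl u \<and> lvl u \<le> k"
  by (cases u) (auto simp: ladder_vertices_def)

lemma ladder_vertices_Suc:
  "ladder_vertices (Suc k) = insert (Top (Suc k)) (insert (Bot (Suc k)) (ladder_vertices k))"
proof -
  have "{1..Suc k} = insert (Suc k) {1..k}" by auto
  then show ?thesis unfolding ladder_vertices_def by auto
qed

lemma card_ladder_vertices: "card (ladder_vertices k) = 2 * k"
proof -
  have "card (ladder_vertices k) = card (Top ` {1..k}) + card (Bot ` {1..k})"
    unfolding ladder_vertices_def by (rule card_Un_disjoint) auto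
  then show ?thesis by (simp add: card_image inj_on_def)
qed

lemma ladder_weight_sym: "ladder_weight u v = ladder_weight v u"
  by (simp add: ladder_weight_def)

lemma cnj_ladder_weight [simp]: "cnj (ladder_weight u v) = ladder_weight u v"
proof -
  have "cnj (sg w) = sg w" for w by (cases w) simp_all
  then show ?thesis by (simp add: ladder_weight_def)
qed

lemma ladder_edges_Suc:
  "ladder_edges (Suc k) = ladder_edges k @ (if 1 \<le> k then
    [((Top k, Top (Suc k)), 1), ((Top k, Bot (Suc k)), 1), ((Bot k, Top (Suc k)), -1), ((Bot k, Bot (Suc k)), -1)] else [])"
  by (simp add: ladder_edges_def edges_def)

lemma map_of_ladder_edges:
  "map_of (ladder_edges k) (u, v) = (if 1 \<le> lvl u \<and> lvl v = Suc (lvl u) \<and> lvl v \<le> k then Some (sg u) else None)"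
proof (induction k)
  case 0
  then show ?case by (simp add: ladder_edges_def)
next
  case (Suc k)
  then show ?case
    by (cases u; cases v) (auto simp: ladder_edges_Suc map_add_def)
qed

lemma weight_Cpp:
  assumes "u \<in> ladder_vertices k" "v \<in> ladder_vertices k" "2 \<le> k"
  shows "snd (graph_Cpp k) u v = (if lvl u = k \<and> lvl v = k then if u = v then 1 else -1 else ladder_weight u v)"
  using assms
  by (cases u; cases v) (auto simp: graph_Cpp_def weight_fun_def map_add_def map_of_ladder_edges
      ladder_vertices_iff charges_def edges_def ladder_weight_def split: option.splits if_splits)

lemma weight_Cpm:
  assumes "u \<in> ladder_vertices k" "v \<in> ladder_vertices k" "2 \<le> k"
  shows "snd (graph_Cpm k) u v = (if lvl u = k \<and> lvl v = k then if u = v then -1 else 1 else ladder_weight u v)"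
  using assms
  by (cases u; cases v) (auto simp: graph_Cpm_def weight_fun_def map_add_def map_of_ladder_edges
      ladder_vertices_iff charges_def edges_def ladder_weight_def split: option.splits if_splits)

text \<open>The induction invariant. Rows up to level \<open>m\<close> are completely known; level
  \<open>Suc m\<close> is located by \<open>\<phi>\<close>, but the entries inside it are still
  open.\<close>

definition ladder :: "nat \<Rightarrow> (nat \<Rightarrow> nat \<Rightarrow> complex) \<Rightarrow> nat \<Rightarrow> (ladder_vertex \<Rightarrow> nat) \<Rightarrow> bool" where
  "ladder n a m \<phi> \<longleftrightarrow> 1 \<le> m \<and> inj_on \<phi> (ladder_vertices (Suc m)) \<and> \<phi> ` ladder_vertices (Suc m) \<subseteq> {..<n} \<and>
    (\<forall>u\<in>ladder_vertices m. \<forall>v\<in>ladder_vertices (Suc m). a (\<phi> u) (\<phi> v) = ladder_weight u v) \<and>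
    (\<forall>u\<in>ladder_vertices m. nb n a (\<phi> u) \<subseteq> \<phi> ` ladder_vertices (Suc m))"

context sat_mat
begin

text \<open>The two equal charges form level 1 and their common neighbours level 2;
  \<open>twin_star\<close> already gives the bottom vertex its weights -1.\<close>

lemma ladder_start:
  assumes v: "v < n" "D v = {v, x, y, z}" "distinct [v, x, y, z]"
    and N: "a v v = 1" "a v x = 1" "a v y = 1" "a v z = 1" and x: "a x x = 1"
  shows "\<exists>\<phi>. ladder n a 1 \<phi>"
proof -
  let ?\<phi> = "\<lambda>u. if u = Top 1 then v else if u = Bot 1 then x else if u = Top 2 then y else z"
  have lt: "x < n" "y < n" "z < n" using D_less[of x v] D_less[of y v] D_less[of z v] v(2) by simp_all
  note tw = twin_star[OF v N x]
  have xv: "a x v = 1" using herm[OF v(1) lt(1)] N by simp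
  have Dx: "D x = {x, v, y, z}"
    by (rule card4_eq[OF degree[OF lt(1)]]) (use tw xv x v lt in \<open>auto simp: nb_def\<close>)
  have L1: "ladder_vertices 1 = {Top 1, Bot 1}" by (auto simp: ladder_vertices_def)
  have "{1..2} = {1, 2::nat}" by auto
  then have L2: "ladder_vertices (Suc 1) = {Top 1, Bot 1, Top 2, Bot 2}"
    by (auto simp: ladder_vertices_def numeral_2_eq_2)
  have i: "?\<phi> ` {Top 1, Bot 1, Top 2, Bot 2} = {v, x, y, z}" by auto
  have inj: "inj_on ?\<phi> {Top 1, Bot 1, Top 2, Bot 2}" using v(3) by (auto simp: inj_on_def)
  have "ladder n a 1 ?\<phi>"
    unfolding ladder_def L1 L2 i
  proof (intro conjI inj)
    show "{v, x, y, z} \<subseteq> {..<n}" using v lt by simp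
    show "\<forall>u\<in>{Top 1, Bot 1}. \<forall>w\<in>{Top 1, Bot 1, Top 2, Bot 2}. a (?\<phi> u) (?\<phi> w) = ladder_weight u w"
      using N x xv tw by (simp add: ladder_weight_def)
    show "\<forall>u\<in>{Top 1, Bot 1}. D (?\<phi> u) \<subseteq> {v, x, y, z}" using v(2) Dx by auto
  qed simp
  then show ?thesis by (intro exI[of _ ?\<phi>])
qed

lemma ladder_weight_sides:
  assumes L: "ladder n a m \<phi>"
  shows "u \<in> ladder_vertices m \<Longrightarrow> v \<in> ladder_vertices (Suc m) \<Longrightarrow> a (\<phi> u) (\<phi> v) = ladder_weight u v"
    and "u \<in> ladder_vertices (Suc m) \<Longrightarrow> v \<in> ladder_vertices m \<Longrightarrow> a (\<phi> u) (\<phi> v) = ladder_weight u v"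
proof -
  show 1: "a (\<phi> u) (\<phi> v) = ladder_weight u v" if "u \<in> ladder_vertices m" "v \<in> ladder_vertices (Suc m)" for u v
    using L that by (simp add: ladder_def)
  assume u: "u \<in> ladder_vertices (Suc m)" and v: "v \<in> ladder_vertices m"
  then have "v \<in> ladder_vertices (Suc m)" by (simp add: ladder_vertices_iff)
  moreover have "\<phi> ` ladder_vertices (Suc m) \<subseteq> {..<n}" using L by (simp add: ladder_def)
  ultimately have "\<phi> u < n" "\<phi> v < n" using u by auto
  then have "a (\<phi> u) (\<phi> v) = cnj (a (\<phi> v) (\<phi> u))" using herm[of "\<phi> v" "\<phi> u"] by simp
  then show "a (\<phi> u) (\<phi> v) = ladder_weight u v" using 1[OF v u] by (simp add: ladder_weight_sym)
qed

text \<open>\<open>Top m\<close> has weight 1 to both vertices of the last level, and its other two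
  neighbours contribute 0 to the orthogonality with \<open>r\<close>, so the two remaining entries
  cancel.\<close>

lemma ladder_end:
  assumes L: "ladder n a m \<phi>" and r: "r = \<phi> (Top (Suc m)) \<or> r = \<phi> (Bot (Suc m))"
  shows "a (\<phi> (Top (Suc m))) r + a (\<phi> (Bot (Suc m))) r = 0"
proof -
  have m: "1 \<le> m" and inj: "inj_on \<phi> (ladder_vertices (Suc m))" and rn: "\<phi> ` ladder_vertices (Suc m) \<subseteq> {..<n}"
    using L by (auto simp: ladder_def)
  note w = ladder_weight_sides(1)[OF L]
  obtain w where wr: "r = \<phi> w" and lw: "lvl w = Suc m" using r by auto
  have S: "Top m \<in> ladder_vertices m" "Top (Suc m) \<in> ladder_vertices (Suc m)" "Bot (Suc m) \<in> ladder_vertices (Suc m)"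
     "w \<in> ladder_vertices (Suc m)" "Top m \<in> ladder_vertices (Suc m)" "Bot m \<in> ladder_vertices (Suc m)" "Bot m \<in> ladder_vertices m"
    using m lw by (auto simp: ladder_vertices_iff)
  have lt: "\<phi> u < n" if "u \<in> ladder_vertices (Suc m)" for u using rn that by auto
  have inj': "\<phi> u = \<phi> v \<longleftrightarrow> u = v" if "u \<in> ladder_vertices (Suc m)" "v \<in> ladder_vertices (Suc m)" for u v
    using inj that by (auto simp: inj_on_def)
  obtain s t where st: "s \<in> ladder_vertices m" "t \<in> ladder_vertices m" "s \<noteq> t" "ladder_weight (Top m) s = 1"
    "ladder_weight (Top m) t \<noteq> 0" "ladder_weight (Top m) s * ladder_weight s w + ladder_weight (Top m) t * ladder_weight t w = 0"
  proof (cases "m = 1")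
    case True
    then show ?thesis using that[of "Top 1" "Bot 1"] lw by (simp add: ladder_vertices_iff ladder_weight_def)
  next
    case False
    then obtain k where k: "m = Suc k" "1 \<le> k" using m by (cases m) auto
    then show ?thesis using that[of "Top k" "Bot k"] lw by (simp add: ladder_vertices_iff ladder_weight_def)
  qed
  have st': "s \<in> ladder_vertices (Suc m)" "t \<in> ladder_vertices (Suc m)" "lvl s \<le> m" "lvl t \<le> m"
    using st by (auto simp: ladder_vertices_iff)
  have d: "distinct [\<phi> s, \<phi> t, \<phi> (Top (Suc m)), \<phi> (Bot (Suc m))]"
    using st st' S by (auto simp: inj')
  have wT: "a (\<phi> (Top m)) (\<phi> u) = ladder_weight (Top m) u" if "u \<in> ladder_vertices (Suc m)" for u
    using w[OF S(1) that] .
  have end1: "ladder_weight (Top m) (Top (Suc m)) = 1" "ladder_weight (Top m) (Bot (Suc m)) = 1"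
    by (simp_all add: ladder_weight_def)
  have DT: "D (\<phi> (Top m)) = {\<phi> s, \<phi> t, \<phi> (Top (Suc m)), \<phi> (Bot (Suc m))}"
    by (rule card4_eq[OF degree[OF lt[OF S(5)]] _ d])
      (use st st' S lt wT end1 in \<open>auto simp: nb_def\<close>)
  have ne: "\<phi> (Top m) \<noteq> \<phi> w" using inj'[OF S(5,4)] lw by auto
  have "ladder_weight (Top m) s * ladder_weight s w + ladder_weight (Top m) t * ladder_weight t w
      + a (\<phi> (Top (Suc m))) (\<phi> w) + a (\<phi> (Bot (Suc m))) (\<phi> w) = 0"
    using orth4[OF DT d lt[OF S(5)] lt[OF S(4)] ne] wT st' S end1 w[OF st(1) S(4)] w[OF st(2) S(4)] by simp
  then show ?thesis using st(6) wr by simp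
qed

text \<open>One charge c in the last level determines its block as c on and -c off the diagonal.
  Both end rows are then full, and c = 1 or c = -1 decides between the two families.\<close>

lemma ladder_closed:
  assumes L: "ladder n a m \<phi>" and p: "a (\<phi> (Top (Suc m))) (\<phi> (Top (Suc m))) \<noteq> 0"
  shows "listed n a"
proof -
  let ?p = "\<phi> (Top (Suc m))" and ?q = "\<phi> (Bot (Suc m))" and ?V = "ladder_vertices (Suc m)"
  have m: "1 \<le> m" and inj: "inj_on \<phi> ?V" and rn: "\<phi> ` ?V \<subseteq> {..<n}"
    and nbs: "\<And>u. u \<in> ladder_vertices m \<Longrightarrow> D (\<phi> u) \<subseteq> \<phi> ` ?V"
    using L by (auto simp: ladder_def)
  have S: "Top (Suc m) \<in> ?V" "Bot (Suc m) \<in> ?V" "Top m \<in> ladder_vertices m" "Bot m \<in> ladder_vertices m"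
    "Top m \<in> ?V" "Bot m \<in> ?V"
    using m by (auto simp: ladder_vertices_iff)
  have lt: "\<phi> u < n" if "u \<in> ?V" for u using rn that by auto
  have inj': "\<phi> u = \<phi> v \<longleftrightarrow> u = v" if "u \<in> ?V" "v \<in> ?V" for u v
    using inj that by (auto simp: inj_on_def)
  note w = ladder_weight_sides[OF L]
  have E: "a ?p ?p + a ?q ?p = 0" "a ?p ?q + a ?q ?q = 0"
    using ladder_end[OF L] by simp_all
  obtain c where c: "a ?p ?p = c" "c = 1 \<or> c = -1" using diag_cases[OF lt[OF S(1)]] p by auto
  have qp: "a ?q ?p = - c" using E(1) c(1) by (simp add: eq_neg_iff_add_eq_0 add.commute)
  have pq: "a ?p ?q = - c" using herm[OF lt[OF S(2)] lt[OF S(1)]] qp c(2) by auto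
  have qq: "a ?q ?q = c" using E(2) pq by simp
  have d: "distinct [\<phi> (Top m), \<phi> (Bot m), ?p, ?q]" using S by (simp add: inj')
  have end1: "ladder_weight (Top (Suc m)) (Top m) = 1" "ladder_weight (Top (Suc m)) (Bot m) = -1"
    "ladder_weight (Bot (Suc m)) (Top m) = 1" "ladder_weight (Bot (Suc m)) (Bot m) = -1"
    by (simp_all add: ladder_weight_def)
  have c0: "c \<noteq> 0" using c by auto
  have Dp: "D ?p = {\<phi> (Top m), \<phi> (Bot m), ?p, ?q}"
    by (rule card4_eq[OF degree[OF lt[OF S(1)]] _ d])
      (use S lt w(2)[OF S(1,3)] w(2)[OF S(1,4)] end1 c(1) c0 pq in \<open>simp add: nb_def\<close>)
  have Dq: "D ?q = {\<phi> (Top m), \<phi> (Bot m), ?p, ?q}"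
    by (rule card4_eq[OF degree[OF lt[OF S(2)]] _ d])
      (use S lt w(2)[OF S(2,3)] w(2)[OF S(2,4)] end1 qp c0 qq in \<open>simp add: nb_def\<close>)
  have Dsub: "D (\<phi> u) \<subseteq> \<phi> ` ?V" if "u \<in> ?V" for u
  proof -
    have "u \<in> ladder_vertices m \<or> u = Top (Suc m) \<or> u = Bot (Suc m)"
      using that lvl_iff[of u "Suc m"] by (auto simp: ladder_vertices_iff le_Suc_eq)
    then show ?thesis
    proof (elim disjE)
      assume "u \<in> ladder_vertices m" then show ?thesis by (rule nbs)
    next
      assume "u = Top (Suc m)" then show ?thesis unfolding \<open>u = _\<close> Dp using S by simp
    next
      assume "u = Bot (Suc m)" then show ?thesis unfolding \<open>u = _\<close> Dq using S by simp
    qed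
  qed
  have all: "\<phi> ` ?V = {..<n}"
  proof (rule connD[OF conn])
    show "?p \<in> \<phi> ` ?V" using S by simp
    fix x y assume x: "x \<in> \<phi> ` ?V" and y: "y < n" "a x y \<noteq> 0"
    show "y \<in> \<phi> ` ?V"
    proof -
      obtain u where u: "u \<in> ?V" "x = \<phi> u" using x by blast
      have "y \<in> D (\<phi> u)" using y u by (simp add: nb_def)
      then show ?thesis using Dsub[OF u(1)] by blast
    qed
  qed (use rn in auto)
  have b: "bij_betw \<phi> ?V {..<n}" using inj all by (simp add: bij_betw_def)
  have wt: "a (\<phi> u) (\<phi> v) = (if lvl u = Suc m \<and> lvl v = Suc m then if u = v then c else - c else ladder_weight u v)"
    if uv: "u \<in> ?V" "v \<in> ?V" for u v
  proof (cases "lvl u = Suc m \<and> lvl v = Suc m")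
    case True
    then have "u = Top (Suc m) \<or> u = Bot (Suc m)" "v = Top (Suc m) \<or> v = Bot (Suc m)" by (auto simp: lvl_iff)
    then show ?thesis using c(1) pq qp qq by (elim disjE) simp_all
  next
    case False
    then have "u \<in> ladder_vertices m \<or> v \<in> ladder_vertices m" using uv by (auto simp: ladder_vertices_iff)
    then show ?thesis using w uv False by auto
  qed
  have m2: "2 \<le> Suc m" using m by simp
  from c(2) show ?thesis
  proof
    assume c1: "c = 1"
    have "graph_iso n a (graph_Cpp (Suc m))"
    proof (rule graph_isoI[of \<phi> _ _ "\<lambda>_. 1" 1])
      show "bij_betw \<phi> (fst (graph_Cpp (Suc m))) {..<n}" using b by (simp add: graph_Cpp_def)
      show "a (\<phi> u) (\<phi> v) = 1 * (1 * snd (graph_Cpp (Suc m)) u v * cnj 1)"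
        if "u \<in> fst (graph_Cpp (Suc m))" "v \<in> fst (graph_Cpp (Suc m))" for u v
      proof -
        have uv: "u \<in> ?V" "v \<in> ?V" using that by (simp_all add: graph_Cpp_def)
        show ?thesis unfolding wt[OF uv] weight_Cpp[OF uv m2] c1 by simp
      qed
    qed simp_all
    then show ?thesis using m2 unfolding listed_def by blast
  next
    assume c1: "c = -1"
    have "graph_iso n a (graph_Cpm (Suc m))"
    proof (rule graph_isoI[of \<phi> _ _ "\<lambda>_. 1" 1])
      show "bij_betw \<phi> (fst (graph_Cpm (Suc m))) {..<n}" using b by (simp add: graph_Cpm_def)
      show "a (\<phi> u) (\<phi> v) = 1 * (1 * snd (graph_Cpm (Suc m)) u v * cnj 1)"
        if "u \<in> fst (graph_Cpm (Suc m))" "v \<in> fst (graph_Cpm (Suc m))" for u v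
      proof -
        have uv: "u \<in> ?V" "v \<in> ?V" using that by (simp_all add: graph_Cpm_def)
        show ?thesis unfolding wt[OF uv] weight_Cpm[OF uv m2] c1 by simp
      qed
    qed simp_all
    then show ?thesis using m2 unfolding listed_def by blast
  qed
qed

text \<open>An uncharged end makes the whole last block 0, so the top end has two new neighbours.
  Against the bottom end the previous level contributes 2, hence both new products are -1: the
  bottom end sees the same two vertices with opposite signs.\<close>

lemma ladder_step:
  assumes L: "ladder n a m \<phi>" and p0: "a (\<phi> (Top (Suc m))) (\<phi> (Top (Suc m))) = 0"
  shows "\<exists>h \<psi>. (\<forall>i. unit (h i)) \<and> ladder n (\<lambda>i j. h i * a i j * cnj (h j)) (Suc m) \<psi>"
proof -
  let ?p = "\<phi> (Top (Suc m))" and ?q = "\<phi> (Bot (Suc m))" and ?V = "ladder_vertices (Suc m)"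
  have m: "1 \<le> m" and inj: "inj_on \<phi> ?V" and rn: "\<phi> ` ?V \<subseteq> {..<n}"
    and nbs: "\<And>u. u \<in> ladder_vertices m \<Longrightarrow> D (\<phi> u) \<subseteq> \<phi> ` ?V"
    using L by (auto simp: ladder_def)
  have S: "Top (Suc m) \<in> ?V" "Bot (Suc m) \<in> ?V" "Top m \<in> ladder_vertices m" "Bot m \<in> ladder_vertices m"
    "Top m \<in> ?V" "Bot m \<in> ?V"
    using m by (auto simp: ladder_vertices_iff)
  have lt: "\<phi> u < n" if "u \<in> ?V" for u using rn that by auto
  have inj': "\<phi> u = \<phi> v \<longleftrightarrow> u = v" if "u \<in> ?V" "v \<in> ?V" for u v
    using inj that by (auto simp: inj_on_def)
  note w = ladder_weight_sides[OF L]
  have qp: "a ?q ?p = 0" using ladder_end[OF L, of ?p] p0 by simp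
  have pq: "a ?p ?q = 0" using zero_sym[OF lt[OF S(2)] lt[OF S(1)]] qp by simp
  have qq: "a ?q ?q = 0" using ladder_end[OF L, of ?q] pq by simp
  have end1: "ladder_weight (Top (Suc m)) (Top m) = 1" "ladder_weight (Top (Suc m)) (Bot m) = -1"
    "ladder_weight (Bot (Suc m)) (Top m) = 1" "ladder_weight (Bot (Suc m)) (Bot m) = -1"
    "ladder_weight (Top m) (Bot (Suc m)) = 1" "ladder_weight (Bot m) (Bot (Suc m)) = -1"
    by (simp_all add: ladder_weight_def)
  have aw: "a ?p (\<phi> (Top m)) = 1" "a ?p (\<phi> (Bot m)) = -1" "a ?q (\<phi> (Top m)) = 1" "a ?q (\<phi> (Bot m)) = -1"
    "a (\<phi> (Top m)) ?q = 1" "a (\<phi> (Bot m)) ?q = -1"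
    using w(2)[OF S(1,3)] w(2)[OF S(1,4)] w(2)[OF S(2,3)] w(2)[OF S(2,4)] w(1)[OF S(3,2)] w(1)[OF S(4,2)] end1 by simp_all
  have "\<phi> (Top m) \<in> D ?p" "\<phi> (Bot m) \<in> D ?p" "\<phi> (Bot m) \<noteq> \<phi> (Top m)"
    using aw lt S by (simp_all add: nb_def inj')
  from card4_cases2[OF degree[OF lt[OF S(1)]] this] obtain x y where
    Dp: "D ?p = {\<phi> (Top m), \<phi> (Bot m), x, y}" and d: "distinct [\<phi> (Top m), \<phi> (Bot m), x, y]" .
  have xy: "x < n" "y < n" "a ?p x \<noteq> 0" "a ?p y \<noteq> 0" using Dp by (auto simp: nb_def)
  \<comment> \<open>A ladder vertex adjacent to the top end lies on level m, so any further
    neighbour is outside the ladder.\<close>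
  have new: "\<phi> u \<noteq> t" if "u \<in> ?V" "t \<noteq> \<phi> (Top m)" "t \<noteq> \<phi> (Bot m)" "a ?p t \<noteq> 0" for u t
  proof
    assume t: "\<phi> u = t"
    have "lvl u \<noteq> Suc m" using that(4) p0 pq t unfolding lvl_iff by auto
    then have um: "u \<in> ladder_vertices m" using that(1) by (auto simp: ladder_vertices_iff)
    have "ladder_weight (Top (Suc m)) u \<noteq> 0" using w(2)[OF S(1) um] that(4) t by simp
    then have "lvl u = m" using um m by (auto simp: ladder_weight_def ladder_vertices_iff split: if_splits)
    then show False using that(2,3) t by (auto simp: lvl_iff)
  qed
  have nx: "\<phi> u \<noteq> x" "\<phi> u \<noteq> y" if "u \<in> ?V" for u using new[OF that] d xy by auto
  have "\<phi> (Top (Suc m)) \<noteq> \<phi> (Bot (Suc m))" using S by (simp add: inj')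
  note o = orth4[OF Dp d lt[OF S(1)] lt[OF S(2)] this]
  have "a ?p x * a x ?q + a ?p y * a y ?q = -2"
    using o aw by (simp add: eq_neg_iff_add_eq_0 algebra_simps)
  then have neg: "a ?p x * a x ?q = -1 \<and> a ?p y * a y ?q = -1"
    by (intro minus_two prod_le_1) (use xy lt S in auto)
  have ux: "unit (a ?p x)" "unit (a ?p y)" using entries xy lt[OF S(1)] by auto
  have Dq: "D ?q = {\<phi> (Top m), \<phi> (Bot m), x, y}"
  proof (rule card4_eq[OF degree[OF lt[OF S(2)]] _ d])
    have "a x ?q \<noteq> 0" "a y ?q \<noteq> 0" using neg by auto
    then have "a ?q x \<noteq> 0" "a ?q y \<noteq> 0"
      using zero_sym[OF xy(1) lt[OF S(2)]] zero_sym[OF xy(2) lt[OF S(2)]] by simp_all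
    then show "{\<phi> (Top m), \<phi> (Bot m), x, y} \<subseteq> D ?q" using aw lt S xy by (simp add: nb_def)
  qed
  \<comment> \<open>Only the two new vertices are switched, so that the top end gets weight 1 to
    both; the weights of the old ladder stay as they are.\<close>
  define h where "h = (\<lambda>i. if i = x then a ?p x else if i = y then a ?p y else 1)"
  define \<psi> where "\<psi> = \<phi>(Top (Suc (Suc m)) := x, Bot (Suc (Suc m)) := y)"
  let ?b = "\<lambda>i j. h i * a i j * cnj (h j)" and ?W = "ladder_vertices (Suc (Suc m))"
  have h: "unit (h i)" for i using ux by (simp add: h_def)
  have h1: "h (\<phi> u) = 1" if "u \<in> ?V" for u using nx[OF that] by (simp add: h_def)
  have hxy: "h x = a ?p x" "h y = a ?p y" using d by (auto simp: h_def)
  have \<psi>: "\<psi> u = \<phi> u" if "u \<in> ?V" for u using that by (auto simp: \<psi>_def ladder_vertices_iff)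
  have \<psi>xy: "\<psi> (Top (Suc (Suc m))) = x" "\<psi> (Bot (Suc (Suc m))) = y" by (simp_all add: \<psi>_def)
  have W: "?W = insert (Top (Suc (Suc m))) (insert (Bot (Suc (Suc m))) ?V)"
    by (rule ladder_vertices_Suc)
  have imV: "\<psi> ` ?V = \<phi> ` ?V" using \<psi> by auto
  have imW: "\<psi> ` ?W = insert x (insert y (\<phi> ` ?V))" unfolding W using \<psi>xy imV by simp
  have injV: "inj_on \<psi> ?V" using inj \<psi> by (simp add: inj_on_def)
  have nV: "x \<notin> \<phi> ` ?V" "y \<notin> \<phi> ` ?V" "x \<noteq> y" using nx d by auto
  have "\<psi> ` (insert (Bot (Suc (Suc m))) ?V - {Top (Suc (Suc m))}) \<subseteq> insert y (\<phi> ` ?V)"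
    "\<psi> ` (?V - {Bot (Suc (Suc m))}) \<subseteq> \<phi> ` ?V"
    using \<psi>xy(2) \<psi> by auto
  then have "x \<notin> \<psi> ` (insert (Bot (Suc (Suc m))) ?V - {Top (Suc (Suc m))})" "y \<notin> \<psi> ` (?V - {Bot (Suc (Suc m))})"
    using nV by blast+
  then have "inj_on \<psi> ?W" unfolding W inj_on_insert \<psi>xy using injV by simp
  moreover have "\<psi> ` ?W \<subseteq> {..<n}" unfolding imW using rn xy by simp
  moreover have "?b (\<psi> u) (\<psi> v) = ladder_weight u v" if u: "u \<in> ?V" and v: "v \<in> ?W" for u v
  proof (cases "v \<in> ?V")
    case True
    have "a (\<phi> u) (\<phi> v) = ladder_weight u v"
    proof (cases "u \<in> ladder_vertices m \<or> v \<in> ladder_vertices m")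
      case True
      then show ?thesis using w u \<open>v \<in> ?V\<close> by auto
    next
      case False
      then have "lvl u = Suc m" "lvl v = Suc m" using u \<open>v \<in> ?V\<close> by (auto simp: ladder_vertices_iff)
      then have "u = Top (Suc m) \<or> u = Bot (Suc m)" "v = Top (Suc m) \<or> v = Bot (Suc m)"
        "ladder_weight u v = 0"
        using m unfolding lvl_iff by (auto simp: ladder_weight_def)
      then show ?thesis using p0 pq qp qq by (elim disjE) simp_all
    qed
    then show ?thesis using h1 u True \<psi> by simp
  next
    case False
    then have v': "v = Top (Suc (Suc m)) \<or> v = Bot (Suc (Suc m))" using v W by auto
    show ?thesis
    proof (cases "u \<in> ladder_vertices m")
      case True
      have "x \<notin> \<phi> ` ?V" "y \<notin> \<phi> ` ?V" using nx by auto
      then have "x \<notin> D (\<phi> u)" "y \<notin> D (\<phi> u)" using nbs[OF True] by auto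
      then have "a (\<phi> u) (\<psi> v) = 0" using v' \<psi>xy xy D_zero by auto
      moreover have "ladder_weight u v = 0" using True v' by (auto simp: ladder_weight_def ladder_vertices_iff)
      ultimately show ?thesis using \<psi>[OF u] by simp
    next
      case False
      then have "lvl u = Suc m" using u by (auto simp: ladder_vertices_iff)
      then have u': "u = Top (Suc m) \<or> u = Bot (Suc m)" by (simp add: lvl_iff)
      have 1: "a ?p x * cnj (a ?p x) = 1" "a ?p y * cnj (a ?p y) = 1" using unit_cnj_mult(2) ux by auto
      have "a ?q x * cnj (a ?p x) = cnj (a ?p x * a x ?q)" "a ?q y * cnj (a ?p y) = cnj (a ?p y * a y ?q)"
        using herm[OF xy(1) lt[OF S(2)]] herm[OF xy(2) lt[OF S(2)]] by simp_all
      then have 2: "a ?q x * cnj (a ?p x) = -1" "a ?q y * cnj (a ?p y) = -1" using neg by simp_all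
      have e: "?b (\<psi> u) (\<psi> v) = a (\<phi> u) (\<psi> v) * cnj (h (\<psi> v))" using h1[OF u] \<psi>[OF u] by simp
      show ?thesis unfolding e using u' v' by (elim disjE) (simp_all add: \<psi>xy hxy 1 2 ladder_weight_def)
    qed
  qed
  moreover have "nb n ?b (\<psi> u) \<subseteq> \<psi> ` ?W" if u: "u \<in> ?V" for u
  proof -
    have e: "nb n ?b (\<psi> u) = D (\<phi> u)" unfolding \<psi>[OF u] by (rule nb_switch[OF h lt[OF u]])
    have "u \<in> ladder_vertices m \<or> u = Top (Suc m) \<or> u = Bot (Suc m)"
      using u lvl_iff[of u "Suc m"] by (auto simp: ladder_vertices_iff le_Suc_eq)
    then have "D (\<phi> u) \<subseteq> insert x (insert y (\<phi> ` ?V))"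
    proof (elim disjE)
      assume "u \<in> ladder_vertices m" then show ?thesis using nbs by blast
    next
      assume "u = Top (Suc m)" then show ?thesis unfolding \<open>u = _\<close> Dp using S by simp
    next
      assume "u = Bot (Suc m)" then show ?thesis unfolding \<open>u = _\<close> Dq using S by simp
    qed
    then show ?thesis unfolding e imW .
  qed
  ultimately have "ladder n ?b (Suc m) \<psi>" unfolding ladder_def by simp
  then show ?thesis using h by blast
qed

end

text \<open>The ladder cannot grow forever: the embedding of its vertices gives 2 (m + 1) <= n, so n
  - m decreases with each step.\<close>

lemma ladder_listed:
  assumes "sat_mat n a" "ladder n a m \<phi>"
  shows "listed n a"
  using assms
proof (induction "n - m" arbitrary: m a \<phi> rule: less_induct)
  case less
  interpret sat_mat n a by fact
  show ?case
  proof (cases "a (\<phi> (Top (Suc m))) (\<phi> (Top (Suc m))) = 0")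
    case False
    then show ?thesis using ladder_closed less.prems(2) by blast
  next
    case True
    then obtain h \<psi> where h: "\<forall>i. unit (h i)" and l: "ladder n (\<lambda>i j. h i * a i j * cnj (h j)) (Suc m) \<psi>"
      using ladder_step[OF less.prems(2)] by blast
    have "inj_on \<phi> (ladder_vertices (Suc m))" "\<phi> ` ladder_vertices (Suc m) \<subseteq> {..<n}"
      using less.prems(2) by (simp_all add: ladder_def)
    then have "card (ladder_vertices (Suc m)) \<le> card {..<n}" by (intro card_inj_on_le[of \<phi>]) simp_all
    then have "2 * Suc m \<le> n" unfolding card_ladder_vertices by simp
    then have "n - Suc m < n - m" by (intro diff_less_mono2) simp_all
    moreover have "sat_mat n (\<lambda>i j. h i * a i j * cnj (h j))" by (rule switch[of h]) (rule h[rule_format])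
    ultimately have "listed n (\<lambda>i j. h i * a i j * cnj (h j))" using l by (rule less.hyps[of "Suc m" "\<lambda>i j. h i * a i j * cnj (h j)" \<psi>])
    then show ?thesis by (rule listed_switch[of h, rotated]) (rule h[rule_format])
  qed
qed

context sat_mat
begin

lemma case_twins:
  assumes v: "v < n" "a v v = 1" and x: "x < n" "x \<noteq> v" "a v x \<noteq> 0" "a x x = 1"
  shows "listed n a"
proof -
  have "v \<in> D v" "x \<in> D v" using v x by (simp_all add: nb_def)
  from card4_cases2[OF degree[OF v(1)] this x(2)] obtain y z where
    D1: "D v = {v, x, y, z}" "distinct [v, x, y, z]" .
  show ?thesis
  proof (rule listed_tree[of "[(v, z), (v, y), (v, x)]"])
    fix b assume b: "sat_mat n b" and nb: "\<And>i. i < n \<Longrightarrow> nb n b i = D i" and dg: "\<And>i. b i i = a i i"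
      and e: "\<forall>(p, c)\<in>set [(v, z), (v, y), (v, x)]. b p c = 1"
    have D2: "nb n b v = {v, x, y, z}" using nb[OF v(1)] D1 by simp
    have N: "b v v = 1" "b v x = 1" "b v y = 1" "b v z = 1" "b x x = 1" using e v x dg by simp_all
    show "listed n b" using sat_mat.ladder_start[OF b v(1) D2 D1(2) N] ladder_listed[OF b] by blast
  qed (use v D1 in auto)
qed

lemma saturated_listed:
  assumes v: "v < n" "a v v \<noteq> 0"
  shows "listed n a"
proof (cases no_twins)
  case nt: True
  show ?thesis
  proof (cases "a v v = 1")
    case True then show ?thesis using case_no_twins[OF nt v(1)] by simp
  next
    case False
    then have "- a v v = 1" using diag_cases[OF v(1)] v(2) by auto
    from sat_mat.case_no_twins[OF negate no_twins_neg[OF nt] v(1) this] show ?thesis by (rule listed_neg)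
  qed
next
  case False
  then obtain x y where xy: "x < n" "y < n" "x \<noteq> y" "a x y \<noteq> 0" "a x x \<noteq> 0" "a y y = a x x"
    unfolding no_twins_def by blast
  show ?thesis
  proof (cases "a x x = 1")
    case True then show ?thesis using case_twins[of x y] xy by simp
  next
    case False
    then have "- a x x = 1" "- a y y = 1" "- a x y \<noteq> 0" using diag_cases[OF xy(1)] xy by auto
    from sat_mat.case_twins[OF negate xy(1) this(1) xy(2) xy(3)[symmetric] this(3,2)]
    show ?thesis by (rule listed_neg)
  qed
qed

end

section \<open>From maximal charged matrices to the list of graphs\<close>

lemma charged_max_listed:
  assumes "charged_max n a"
  shows "listed n a"
proof (cases "graph_iso n a graph_S1 \<or> graph_iso n a graph_S2_dagger")
  case True
  then show ?thesis by (auto simp: listed_def)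
next
  case False
  interpret max_charged n a by unfold_locales fact
  interpret unit_max n a
  proof unfold_locales
    show "unit (a i j)" if "i < n" "j < n" "a i j \<noteq> 0" for i j
      using unit_entries[OF _ _ that] False by blast
  qed
  have s: "sat_mat n a"
  proof
    show "a j i = cnj (a i j)" if "i < n" "j < n" for i j by (rule herm[OF that])
    show "unit (a i j)" if "i < n" "j < n" "a i j \<noteq> 0" for i j by (rule entries[OF that])
    show "conn n a" by (rule conn)
    show "sq n a i j = 0" if "i < n" "j < n" "i \<noteq> j" for i j
      by (rule sat[OF that(1) saturated[OF that(1)] that(2) that(3)[symmetric]])
    show "card (nb n a i) = 4" if "i < n" for i by (rule saturated[OF that])
  qed
  show ?thesis using charged sat_mat.saturated_listed[OF s] by blast
qed

theorem theorem3p6: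
  fixes A :: "complex mat"
  assumes "maximal_indecomposable_cyclotomic_mat A"
    and "\<exists>i < dim_row A. A $$ (i, i) \<noteq> 0"
  shows "equivalent_to_graph A graph_S1 \<or>
    equivalent_to_graph A graph_S2_dagger \<or>
    (\<exists>k \<ge> 2. equivalent_to_graph A (graph_Cpp k)) \<or>
    (\<exists>k \<ge> 2. equivalent_to_graph A (graph_Cpm k)) \<or>
    equivalent_to_graph A graph_S5 \<or>
    equivalent_to_graph A graph_S6 \<or>
    equivalent_to_graph A graph_S6_dagger \<or>
    equivalent_to_graph A graph_S7 \<or>
    equivalent_to_graph A graph_S8 \<or>
    equivalent_to_graph A graph_S8_prime"
proof -
  have A: "cyclotomic_mat A" "indecomposable_mat A"
    using assms(1) by (simp_all add: maximal_indecomposable_cyclotomic_mat_def)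
  have e: "eisenstein_mat (dim_row A) A" using A(1) by (simp add: cyclotomic_mat_def)
  have "charged_max (dim_row A) (\<lambda>i j. A $$ (i, j))"
    unfolding charged_max_def
    using cyclotomic_mat_cyc[OF A(1)] maximal_not_extendable[OF assms(1)] indecomposable_conn[OF A(2)] assms(2)
    by blast
  then have l: "listed (dim_row A) (\<lambda>i j. A $$ (i, j))" by (rule charged_max_listed)
  have s: "graph_iso (dim_row A) (\<lambda>i j. A $$ (i, j)) G \<Longrightarrow> equivalent_to_graph A G" for G :: "letter rgraph"
    by (rule graph_iso_equivalent[OF e])
  have t: "graph_iso (dim_row A) (\<lambda>i j. A $$ (i, j)) G \<Longrightarrow> equivalent_to_graph A G" for G :: "ladder_vertex rgraph"
    by (rule graph_iso_equivalent[OF e])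
  show ?thesis using l unfolding listed_def by (elim disjE exE conjE) (auto dest!: s t)
qed

end
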